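(* Let $0<q<1$, $q':=\frac{q}{q-1}$ (so $q'<0$) and $0<\vartheta<\infty$. Let $v,w$ be weights and let $U$ be a $\vartheta$-regular kernel. Then the following assertions are equivalent: (i) There exists a constant $C\in(0,\infty)$ such that the inequality $$\left(\int_0^\infty\left(\int_0^t f(x)U(x,t)\,dx\right)^q w(t)\,dt\right)^{\frac1q}\le C\int_0^\infty f(t)v(t)\,dt\qquad( * )$$ holds for all $f\in\mathscr M_+$. (ii) Both conditions $$A_3^*:=\int_0^\infty\left(\int_t^\infty w(x)\,dx\right)^{-q'}w(t)\ \operatorname*{ess\,sup}_{z\in(0,t)}U^{-q'}(z,t)\,v^{q'}(z)\,dt<\infty$$ and $$A_4^*:=\int_0^\infty\left(\int_t^\infty w(x)U^q(t,x)\,dx\right)^{-q'}w(t)\ \operatorname*{ess\,sup}_{z\in(0,t)}U^q(z,t)\,v^{q'}(z)\,dt<\infty$$ are satisfied. Moreover, if $C$ is the least constant such that $( * )$ holds for all $f\in\mathscr M_+$, then $$C^{-q'}\approx A_3^*+A_4^*.$$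
   Context: $\mathscr M_+$ denotes the set of all nonnegative Lebesgue measurable functions on $(0,\infty)$. A weight is a function $w\in\mathscr M_+$ such that $0<\int_0^t w(s)\,ds<\infty$ for all $t>0$. For $\vartheta>0$, a $\vartheta$-regular kernel is a measurable function $U:[0,\infty)^2\to[0,\infty)$ such that: (a) $U(x,y)$ is nonincreasing in $x$ and nondecreasing in $y$; (b) $U(x,z)\le\vartheta\,(U(x,y)+U(y,z))$ for all $0\le x<y<z<\infty$; (c) $U(0,y)>0$ for all $y>0$. For an exponent $\alpha$, $U^\alpha(x,y)$ means $(U(x,y))^\alpha$. $A\lesssim B$ means $A\le cB$ with a constant $c$ depending only on $q,\vartheta$ (in particular not on $v,w$); $A\approx B$ means $A\lesssim B$ and $B\lesssim A$. Values in $[0,\infty]$ are allowed, with the usual convention $0\cdot\infty=0$; $v^{q'}=\infty$ where $v=0$. *)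

theory Defs
  imports "HOL-Probability.Essential_Supremum"
begin

text \<open>
  Functions in \<open>M_plus\<close> have type \<^typ>\<open>real \<Rightarrow> ennreal\<close>; only their restriction to
  \<open>(0,\<infinity>)\<close> matters. In \<^typ>\<open>ennreal\<close> we have \<open>0 * \<infinity> = 0\<close>.
\<close>

definition M_plus :: "(real \<Rightarrow> ennreal) set"
  where "M_plus = borel_measurable (lebesgue_on {0<..})"

definition weight :: "(real \<Rightarrow> ennreal) \<Rightarrow> bool"
  where "weight w \<longleftrightarrow> w \<in> M_plus \<and>
    (\<forall>t>0. 0 < (\<integral>\<^sup>+ s. w s \<partial>lebesgue_on {0<..<t}) \<and>
           (\<integral>\<^sup>+ s. w s \<partial>lebesgue_on {0<..<t}) < \<infinity>)"

text \<open>
  Real powers on \<open>[0,\<infinity>]\<close>. For \<open>a < 0\<close> the power of \<open>0\<close> is \<open>\<infinity>\<close> and the power of \<open>\<infinity>\<close> is \<open>0\<close>,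
  unlike \<^term>\<open>(powr) :: real \<Rightarrow> real \<Rightarrow> real\<close>, where \<open>0 powr a = 0\<close>.
\<close>

definition epowr :: "ennreal \<Rightarrow> real \<Rightarrow> ennreal"  (infixr "epowr" 80)
  where "x epowr a =
    (if a = 0 then 1
     else if x = 0 then (if a < 0 then \<infinity> else 0)
     else if x = \<infinity> then (if a < 0 then 0 else \<infinity>)
     else ennreal (enn2real x powr a))"

definition regular_kernel :: "real \<Rightarrow> (real \<Rightarrow> real \<Rightarrow> real) \<Rightarrow> bool"
  where "regular_kernel \<theta> U \<longleftrightarrow>
    (\<lambda>(x, y). U x y) \<in> borel_measurable (lebesgue_on ({0..} \<times> {0..})) \<and>
    (\<forall>x\<ge>0. \<forall>y\<ge>0. 0 \<le> U x y) \<and>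
    (\<forall>y\<ge>0. antimono_on {0..} (\<lambda>x. U x y)) \<and>
    (\<forall>x\<ge>0. mono_on {0..} (\<lambda>y. U x y)) \<and>
    (\<forall>x y z. 0 \<le> x \<and> x < y \<and> y < z \<longrightarrow> U x z \<le> \<theta> * (U x y + U y z)) \<and>
    (\<forall>y>0. 0 < U 0 y)"

definition conj_exponent :: "real \<Rightarrow> real"
  where "conj_exponent q = q / (q - 1)"

definition hardy_inequality ::
  "real \<Rightarrow> (real \<Rightarrow> real \<Rightarrow> real) \<Rightarrow> (real \<Rightarrow> ennreal) \<Rightarrow> (real \<Rightarrow> ennreal) \<Rightarrow> ennreal \<Rightarrow> bool"
  where "hardy_inequality q U v w C \<longleftrightarrow>
    (\<forall>f\<in>M_plus.
      (\<integral>\<^sup>+ t. (\<integral>\<^sup>+ x. f x * ennreal (U x t) \<partial>lebesgue_on {0<..<t}) epowr q * w t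
         \<partial>lebesgue_on {0<..}) epowr (1 / q)
      \<le> C * (\<integral>\<^sup>+ t. f t * v t \<partial>lebesgue_on {0<..}))"

text \<open>
  The least constant. It is \<open>\<infinity>\<close> if no finite constant is admissible. For weights \<open>v\<close>, \<open>w\<close> and a
  regular kernel \<open>U\<close> the infimum is attained whenever it is finite; it may be \<open>0\<close>, since a
  regular kernel may satisfy \<open>U x y = 0\<close> for all \<open>x > 0\<close>.
\<close>

definition least_constant ::
  "real \<Rightarrow> (real \<Rightarrow> real \<Rightarrow> real) \<Rightarrow> (real \<Rightarrow> ennreal) \<Rightarrow> (real \<Rightarrow> ennreal) \<Rightarrow> ennreal"
  where "least_constant q U v w = Inf {C. hardy_inequality q U v w C}"

definition A3 ::
  "real \<Rightarrow> (real \<Rightarrow> real \<Rightarrow> real) \<Rightarrow> (real \<Rightarrow> ennreal) \<Rightarrow> (real \<Rightarrow> ennreal) \<Rightarrow> ennreal"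
  where "A3 q U v w =
    (\<integral>\<^sup>+ t. (\<integral>\<^sup>+ x. w x \<partial>lebesgue_on {t<..}) epowr (- conj_exponent q) * w t *
       esssup (lebesgue_on {0<..<t})
         (\<lambda>z. ennreal (U z t) epowr (- conj_exponent q) * v z epowr conj_exponent q)
     \<partial>lebesgue_on {0<..})"

definition A4 ::
  "real \<Rightarrow> (real \<Rightarrow> real \<Rightarrow> real) \<Rightarrow> (real \<Rightarrow> ennreal) \<Rightarrow> (real \<Rightarrow> ennreal) \<Rightarrow> ennreal"
  where "A4 q U v w =
    (\<integral>\<^sup>+ t. (\<integral>\<^sup>+ x. w x * ennreal (U t x) epowr q \<partial>lebesgue_on {t<..})
              epowr (- conj_exponent q) * w t *
       esssup (lebesgue_on {0<..<t})
         (\<lambda>z. ennreal (U z t) epowr q * v z epowr conj_exponent q)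
     \<partial>lebesgue_on {0<..})"

end

(*
  Write p = -q', k = U^q, W(t) = int_t^oo w, N(x) = int_x^oo k(x,s) w(s) ds, and let G(t) be the sum
  of the integrands of A_3* and A_4* without the factor w, so that A_3* + A_4* = int G w. Everything
  rests on U = k^(1 + 1/p) and on k satisfying the same kind of triangle inequality as U.

  Sufficiency. It is enough to factor the operator T through L^1: if Y satisfies
  N(x)^p k(x,t) v(x)^(-p) <= Y(t) for almost all x < t, then
  T f(t) <= Y(t)^(1/p) int f v k(.,t) / N, and by Hoelder
  int (T f)^q w <= (int f v)^q (int Y w)^(1-q). The function
  Y(t) = const * (G(t) + int_0^t G(s) (1/W(s) + k(s,t)/N(s)) w(s) ds) is admissible, because N(x)^p
  can be recovered from the tails M_x(s) = int_s^oo k(x,.) w with s between x and t, and these are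
  comparable with k(x,s) W(s) + N(s). Interchanging the integrals gives int Y w <= const * int G w.

  Necessity. Choose t_k with W(t_k) = a^(-k) W(0) for a large ratio a. Up to sums that are absorbed
  geometrically, A_3* + A_4* is then dominated by two sums over k, which are bounded by testing the
  inequality with f = sum_k c_k 1_(E_k) / (v |E_k|), where E_k is a set on which the relevant essential
  supremum is almost attained.

  Both directions are carried out for finite diffuse measures with bounded support in place of
  w(t) dt; the theorem follows by truncating w.
*)
theory Submission
  imports Defs "HOL-Probability.Distribution_Functions"
begin

section \<open>Powers on the extended half-line\<close>

text \<open>Bounds such as K(x,t) r(x)^p <= S(t) hold off a null set of x that depends on t, while
  sufficiency needs one null set that serves all t under an integral. Monotonicity in t provides it,
  at the price of countably many bad t. These are negligible only for a measure without atoms, and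
  division by N is legitimate only where N is finite; hence the finite diffuse measures with bounded
  support. Monotonicity also replaces joint measurability when integrals are interchanged. The
  integral terms of Y are needed because G(t) controls only the tail of the integral N(x) beyond t;
  the part before t has to be charged to G(s) with x < s < t. The weights 1/W(s) and K(s,t)/N(s)
  have integral one in t wherever W(s) and N(s) are positive, so the charge is not multiplied. The
  test functions lead to X <= E X^q with the same X on both sides, which is void for infinite X.
  They are therefore built from finite sums in which each essential supremum is replaced by a finite
  value strictly below it.\<close>

lemma zero_epowr [simp]: "a > 0 \<Longrightarrow> 0 epowr a = 0"
  by (simp add: epowr_def)

lemma top_epowr [simp]: "a > 0 \<Longrightarrow> top epowr a = top"
  by (simp add: epowr_def)

lemma ennreal_epowr: "0 \<le> x \<Longrightarrow> a > 0 \<Longrightarrow> ennreal x epowr a = ennreal (x powr a)"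
  by (auto simp: epowr_def)

lemma epowr_1 [simp]: "x epowr 1 = x"
  by (cases x) (simp_all add: ennreal_epowr)

lemma one_epowr [simp]: "a > 0 \<Longrightarrow> 1 epowr a = 1"
  using ennreal_epowr[of 1 a] by simp

lemma epowr_eq_0_iff [simp]: "a > 0 \<Longrightarrow> x epowr a = 0 \<longleftrightarrow> x = 0"
  by (cases x) (simp_all add: ennreal_epowr)

lemma epowr_eq_top_iff [simp]: "a > 0 \<Longrightarrow> x epowr a = top \<longleftrightarrow> x = top"
  by (cases x) (simp_all add: ennreal_epowr)

lemma epowr_less_top_iff [simp]: "a > 0 \<Longrightarrow> x epowr a < top \<longleftrightarrow> x < top"
  by (simp add: less_top[symmetric])

lemma epowr_mono: "a > 0 \<Longrightarrow> x \<le> y \<Longrightarrow> x epowr a \<le> y epowr a"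
proof (cases y)
  case (real s)
  assume "a > 0" "x \<le> y"
  with real obtain r where "x = ennreal r" "0 \<le> r" "r \<le> s"
    by (cases x) (auto simp: top_unique)
  with real \<open>a > 0\<close> show ?thesis by (simp add: ennreal_epowr powr_mono2 ennreal_leI)
qed simp

lemma epowr_epowr: "a > 0 \<Longrightarrow> b > 0 \<Longrightarrow> (x epowr a) epowr b = x epowr (a * b)"
  by (cases x) (simp_all add: ennreal_epowr powr_powr)

lemma epowr_inverse_cancel: "a > 0 \<Longrightarrow> (x epowr a) epowr (1 / a) = x"
  by (simp add: epowr_epowr)

lemma epowr_le_iff: "a > 0 \<Longrightarrow> x epowr a \<le> y epowr a \<longleftrightarrow> x \<le> y"
proof
  assume a: "a > 0" "x epowr a \<le> y epowr a"
  from a(2) have "(x epowr a) epowr (1 / a) \<le> (y epowr a) epowr (1 / a)"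
    by (rule epowr_mono[rotated]) (use a in simp)
  then show "x \<le> y" by (simp only: epowr_inverse_cancel[OF a(1)])
qed (simp add: epowr_mono)

lemma epowr_less_iff: "a > 0 \<Longrightarrow> x epowr a < y epowr a \<longleftrightarrow> x < y"
  by (simp add: epowr_le_iff flip: not_le)

lemma epowr_mult: "a > 0 \<Longrightarrow> (x * y) epowr a = x epowr a * y epowr a"
proof (cases x; cases y)
  fix r s :: real assume "a > 0" "0 \<le> r" "0 \<le> s" "x = ennreal r" "y = ennreal s"
  then show ?thesis
    by (simp add: ennreal_epowr powr_mult flip: ennreal_mult)
qed (auto simp: ennreal_mult_top ennreal_top_mult)

lemma epowr_add: "a > 0 \<Longrightarrow> b > 0 \<Longrightarrow> x epowr (a + b) = x epowr a * x epowr b"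
  by (cases x) (auto simp: ennreal_epowr powr_add ennreal_mult)

lemma epowr_Suc: "a > 0 \<Longrightarrow> x epowr (a + 1) = x epowr a * x"
  by (simp add: epowr_add)

text \<open>The conventions of \<open>epowr\<close> at 0 and infinity match those of
  \<open>inverse\<close>, so negative powers of \<open>v\<close> can be traded for positive powers
  of its reciprocal.\<close>

lemma epowr_uminus: "a > 0 \<Longrightarrow> x epowr (- a) = inverse x epowr a"
proof (cases x)
  case (real r)
  assume "a > 0"
  with real show ?thesis
    by (cases "r = 0") (auto simp: epowr_def inverse_ennreal powr_minus inverse_powr)
qed (simp add: epowr_def)

text \<open>The power is an increasing bijection whose inverse is again a power; no continuity
  argument is involved.\<close>

lemma epowr_SUP:
  assumes "a > 0"
  shows "(SUP i\<in>I. f i) epowr a = (SUP i\<in>I. f i epowr a)"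
proof (rule antisym)
  have "f i \<le> (SUP i\<in>I. f i epowr a) epowr (1 / a)" if "i \<in> I" for i
  proof -
    have "(f i epowr a) epowr (1 / a) \<le> (SUP i\<in>I. f i epowr a) epowr (1 / a)"
      using assms that by (intro epowr_mono SUP_upper) auto
    then show ?thesis using assms by (simp add: epowr_inverse_cancel)
  qed
  then have "(SUP i\<in>I. f i) \<le> (SUP i\<in>I. f i epowr a) epowr (1 / a)"
    by (rule SUP_least)
  from epowr_mono[OF assms this] show "(SUP i\<in>I. f i) epowr a \<le> (SUP i\<in>I. f i epowr a)"
    using assms by (simp add: epowr_epowr)
qed (intro SUP_least epowr_mono SUP_upper assms)

lemma borel_measurable_epowr [measurable]:
  assumes [measurable]: "f \<in> borel_measurable M"
  shows "(\<lambda>x. f x epowr a) \<in> borel_measurable M"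
  unfolding epowr_def by measurable

lemma epowr_add_le:
  assumes "a > 0"
  shows "(x + y) epowr a \<le> 2 epowr a * (x epowr a + y epowr a)"
proof -
  have "x + y \<le> 2 * max x y"
    by (simp add: mult_2 add_mono)
  then have "(x + y) epowr a \<le> 2 epowr a * max x y epowr a"
    using epowr_mono[OF assms, of "x + y" "2 * max x y"] by (simp add: epowr_mult assms)
  also have "max x y epowr a \<le> x epowr a + y epowr a"
    by (cases "x \<le> y") (simp_all add: max_def)
  finally show ?thesis by (simp add: mult_left_mono)
qed

text \<open>The substitute for Hoelder's inequality: it needs no discussion of zero or infinite norms.\<close>

lemma epowr_young:
  assumes "0 < a" "a < 1"
  shows "x epowr a * y epowr (1 - a) \<le> x + y"
proof (cases "x \<le> y")
  case True
  then have "x epowr a * y epowr (1 - a) \<le> y epowr a * y epowr (1 - a)"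
    using assms by (intro mult_right_mono epowr_mono) auto
  also have "\<dots> = y" using assms by (simp flip: epowr_add)
  finally show ?thesis by (simp add: add_increasing)
next
  case False
  then have "x epowr a * y epowr (1 - a) \<le> x epowr a * x epowr (1 - a)"
    using assms by (intro mult_left_mono epowr_mono) auto
  also have "\<dots> = x" using assms by (simp flip: epowr_add)
  finally show ?thesis by (simp add: add_increasing2)
qed

lemma ennreal_inverse_mult_le: "inverse x * x \<le> (1 :: ennreal)"
proof (cases x)
  case (real r)
  then show ?thesis
    by (cases "r = 0") (auto simp: inverse_ennreal simp flip: ennreal_mult)
qed simp

lemma ennreal_inverse_antimono: "x \<le> y \<Longrightarrow> inverse y \<le> inverse (x :: ennreal)"
proof (cases y)
  case (real s)
  assume "x \<le> y"
  with real obtain r where "x = ennreal r" "0 \<le> r" "r \<le> s"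
    by (cases x) (auto simp: top_unique)
  with real show ?thesis
    by (cases "r = 0") (auto simp: inverse_ennreal intro!: ennreal_leI le_imp_inverse_le)
qed simp

section \<open>Monotone functions and kernels\<close>

text \<open>The gaps between \<open>lo x\<close> and \<open>hi x\<close> are pairwise disjoint, so a
  rational picked in each of them determines \<open>x\<close>.\<close>

lemma countable_disjoint_gaps:
  fixes lo hi :: "'a :: linorder \<Rightarrow> ennreal"
  assumes "\<And>x. x \<in> J \<Longrightarrow> lo x < hi x"
    and "\<And>x y. x \<in> J \<Longrightarrow> y \<in> J \<Longrightarrow> x < y \<Longrightarrow> hi x \<le> lo y \<or> hi y \<le> lo x"
  shows "countable J"
proof -
  have "\<exists>r :: rat. lo x < ennreal (of_rat r) \<and> ennreal (of_rat r) < hi x" if "x \<in> J" for x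
    using ennreal_rat_dense[OF assms(1)[OF that]] by blast
  then obtain g :: "'a \<Rightarrow> rat" where g: "\<And>x. x \<in> J \<Longrightarrow> lo x < ennreal (of_rat (g x))"
      "\<And>x. x \<in> J \<Longrightarrow> ennreal (of_rat (g x)) < hi x"
    by metis
  have "g x \<noteq> g y" if "x \<in> J" "y \<in> J" "x < y" for x y
    using assms(2)[OF that] g[OF that(1)] g[OF that(2)]
    by (metis less_le_trans order.strict_trans less_irrefl)
  then have "inj_on g J" by (metis inj_onI linorder_neqE)
  then show ?thesis by (rule countableI')
qed

lemma mono_ennreal_countable_jumps:
  fixes f :: "real \<Rightarrow> ennreal"
  assumes "mono f"
  shows "countable {x. f x < (INF y\<in>{x<..}. f y)}"
proof (rule countable_disjoint_gaps[where lo = f and hi = "\<lambda>x. INF y\<in>{x<..}. f y"])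
  fix x y :: real assume "x < y"
  then show "(INF y\<in>{x<..}. f y) \<le> f y \<or> (INF z\<in>{y<..}. f z) \<le> f x"
    by (intro disjI1 INF_lower) auto
qed simp

lemma antimono_ennreal_countable_jumps:
  fixes f :: "real \<Rightarrow> ennreal"
  assumes "antimono f"
  shows "countable {x. (SUP y\<in>{x<..}. f y) < f x}"
proof (rule countable_disjoint_gaps[where hi = f and lo = "\<lambda>x. SUP y\<in>{x<..}. f y"])
  fix x y :: real assume "x < y"
  then show "f x \<le> (SUP y\<in>{y<..}. f y) \<or> f y \<le> (SUP y\<in>{x<..}. f y)"
    by (intro disjI2 SUP_upper) auto
qed simp

lemma mono_ennreal_borel_measurable:
  fixes f :: "real \<Rightarrow> ennreal"
  assumes "mono f"
  shows "f \<in> borel_measurable borel"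
proof (rule borel_measurableI_greater)
  fix y
  have "is_interval {x. y < f x}"
    unfolding is_interval_1 by (auto dest!: monoD[OF assms] intro: less_le_trans)
  then show "{x \<in> space borel. y < f x} \<in> sets borel"
    by (simp add: real_interval_borel_measurable)
qed

lemma antimono_ennreal_borel_measurable:
  fixes f :: "real \<Rightarrow> ennreal"
  assumes "antimono f"
  shows "f \<in> borel_measurable borel"
proof -
  have "mono (\<lambda>x. f (- x))"
    by (intro monoI antimonoD[OF assms]) simp
  from mono_ennreal_borel_measurable[OF this]
  have "(\<lambda>x. f (- (- x))) \<in> borel_measurable borel"
    by (rule measurable_compose[rotated]) simp
  then show ?thesis by simp
qed

text \<open>A kernel that is only separately measurable but monotone in \<open>x\<close> agrees, for every \<open>t\<close> and
  all but countably many \<open>x\<close>, with its right limit in \<open>x\<close>, and the latter is jointly measurable.\<close>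

lemma nn_integral_swap_antimono_kernel:
  fixes \<kappa> :: "real \<Rightarrow> real \<Rightarrow> ennreal" and \<nu> \<mu> :: "real measure" and a :: "real \<Rightarrow> ennreal"
  assumes "sigma_finite_measure \<nu>" "sigma_finite_measure \<mu>"
    and id_meas [measurable]: "(\<lambda>x. x) \<in> measurable \<nu> borel"
    and null: "\<And>A. countable A \<Longrightarrow> AE x in \<nu>. x \<notin> A"
    and sets_mu [measurable_cong]: "sets \<mu> = sets borel"
    and [measurable]: "a \<in> borel_measurable \<nu>"
    and anti: "\<And>t :: real. antimono (\<lambda>x :: real. \<kappa> x t)"
    and meas: "\<And>x :: real. \<kappa> x \<in> borel_measurable borel"
  shows "(\<integral>\<^sup>+ t. \<integral>\<^sup>+ x. a x * \<kappa> x t \<partial>\<nu> \<partial>\<mu>) \<le> (\<integral>\<^sup>+ x. a x * (\<integral>\<^sup>+ t. \<kappa> x t \<partial>\<mu>) \<partial>\<nu>)"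
proof -
  interpret \<nu>: sigma_finite_measure \<nu> by fact
  interpret \<mu>: sigma_finite_measure \<mu> by fact
  interpret pair_sigma_finite \<nu> \<mu> ..
  note meas[measurable]
  have meas_mu: "\<kappa> x \<in> borel_measurable \<mu>" for x
    using meas[of x] sets_mu by (metis measurable_cong_sets)
  \<comment> \<open>The right limit in x, taken along the rationals: a countable supremum of
    indicators in x times functions of t, which is why it is jointly measurable.\<close>
  define \<kappa>' where "\<kappa>' x t = (SUP r :: rat. if x < of_rat r then \<kappa> (of_rat r) t else 0)" for x t :: real
  have le: "\<kappa>' x t \<le> \<kappa> x t" for x t
    unfolding \<kappa>'_def by (intro SUP_least) (auto intro: antimonoD[OF anti])
  have ge: "AE x in \<nu>. \<kappa> x t \<le> \<kappa>' x t" for t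
  proof -
    have "(SUP y\<in>{x<..}. \<kappa> y t) \<le> \<kappa>' x t" for x
    proof (rule SUP_least)
      fix y assume "y \<in> {x<..}"
      then obtain r :: rat where "x < of_rat r" "of_rat r < y"
        using of_rat_dense[of x y] by auto
      then have "\<kappa> y t \<le> (if x < of_rat r then \<kappa> (of_rat r) t else 0)"
        by (auto intro: antimonoD[OF anti])
      also have "\<dots> \<le> \<kappa>' x t"
        unfolding \<kappa>'_def by (rule SUP_upper) simp
      finally show "\<kappa> y t \<le> \<kappa>' x t" .
    qed
    with null[OF antimono_ennreal_countable_jumps[OF anti[of t]]] show ?thesis
      by (auto elim!: eventually_mono simp: not_less intro: order_trans)
  qed
  have [measurable]: "(\<lambda>(x, t). \<kappa>' x t) \<in> borel_measurable (\<nu> \<Otimes>\<^sub>M \<mu>)"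
    unfolding \<kappa>'_def by measurable
  have "(\<integral>\<^sup>+ t. \<integral>\<^sup>+ x. a x * \<kappa> x t \<partial>\<nu> \<partial>\<mu>) \<le> (\<integral>\<^sup>+ t. \<integral>\<^sup>+ x. a x * \<kappa>' x t \<partial>\<nu> \<partial>\<mu>)"
  proof (rule nn_integral_mono, rule nn_integral_mono_AE)
    show "AE x in \<nu>. a x * \<kappa> x t \<le> a x * \<kappa>' x t" for t
      using ge[of t] by (auto elim!: eventually_mono intro: mult_left_mono)
  qed
  also have "\<dots> = (\<integral>\<^sup>+ x. \<integral>\<^sup>+ t. a x * \<kappa>' x t \<partial>\<mu> \<partial>\<nu>)"
    using Fubini[of "\<lambda>(x, t). a x * \<kappa>' x t"] by simp
  also have "\<dots> \<le> (\<integral>\<^sup>+ x. \<integral>\<^sup>+ t. a x * \<kappa> x t \<partial>\<mu> \<partial>\<nu>)"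
    by (intro nn_integral_mono mult_left_mono le) simp
  also have "\<dots> = (\<integral>\<^sup>+ x. a x * (\<integral>\<^sup>+ t. \<kappa> x t \<partial>\<mu>) \<partial>\<nu>)"
    by (intro nn_integral_cong nn_integral_cmult meas_mu)
  finally show ?thesis .
qed

lemma esssup_mono_family:
  fixes h :: "'a \<Rightarrow> real \<Rightarrow> ennreal"
  assumes [measurable]: "\<And>t. (\<lambda>x. h x t) \<in> borel_measurable M"
    and mono: "\<And>x. mono (h x)"
  shows "mono (\<lambda>t. esssup M (\<lambda>x. h x t))"
  by (intro monoI esssup_mono monoD[OF mono]) auto

text \<open>Intersecting the exceptional sets over rational parameters gives one null set for all of
  them. Monotonicity then squeezes \<open>h x t\<close> below the right limit of \<open>E\<close> at
  t, which equals \<open>E t\<close> except at the countably many jumps.\<close>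

lemma AE_le_esssup_mono_family:
  fixes h :: "'a \<Rightarrow> real \<Rightarrow> ennreal"
  assumes meas: "\<And>t. (\<lambda>x. h x t) \<in> borel_measurable M"
    and mono: "\<And>x. mono (h x)"
  defines "E \<equiv> \<lambda>t. esssup M (\<lambda>x. h x t)"
  shows "AE x in M. \<forall>t. t \<notin> {t. E t < (INF y\<in>{t<..}. E y)} \<longrightarrow> h x t \<le> E t"
proof -
  have "AE x in M. \<forall>r :: rat. h x (of_rat r) \<le> E (of_rat r)"
    unfolding E_def by (subst AE_all_countable) (simp add: esssup_AE)
  then show ?thesis
  proof (rule eventually_mono, intro allI impI)
    fix x t assume *: "\<forall>r :: rat. h x (of_rat r) \<le> E (of_rat r)" "t \<notin> {t. E t < (INF y\<in>{t<..}. E y)}"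
    have "h x t \<le> (INF y\<in>{t<..}. E y)"
    proof (rule INF_greatest)
      fix y assume "y \<in> {t<..}"
      then obtain r :: rat where r: "t < of_rat r" "of_rat r < y"
        using of_rat_dense[of t y] by auto
      have "h x t \<le> h x (of_rat r)" using r by (intro monoD[OF mono]) simp
      also have "\<dots> \<le> E (of_rat r)" using * by simp
      also have "\<dots> \<le> E y"
        using monoD[OF esssup_mono_family[OF meas mono]] r unfolding E_def by simp
      finally show "h x t \<le> E y" .
    qed
    with *(2) show "h x t \<le> E t" by simp
  qed
qed

lemma countable_null_lebesgue_on: "S \<in> sets lebesgue \<Longrightarrow> countable A \<Longrightarrow> AE x in lebesgue_on S. x \<notin> A"
  apply (subst AE_restrict_space_iff)
  apply simp
  apply (rule AE_I'[of A])
  apply (auto simp: countable_imp_null_set_lborel null_sets_completionI)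
  done

lemma id_measurable_lebesgue_on: "(\<lambda>x. x) \<in> measurable (lebesgue_on S) borel"
  by (simp add: measurable_restrict_space1 measurable_completion)

lemma sigma_finite_lebesgue_on:
  assumes "S \<in> sets lebesgue"
  shows "sigma_finite_measure (lebesgue_on S)"
proof -
  have "sigma_finite_measure (lebesgue :: 'a measure)"
  proof
    obtain A :: "'a set set" where "countable A" "A \<subseteq> sets lborel" "\<Union>A = space lborel"
        "\<forall>a\<in>A. emeasure lborel a \<noteq> \<infinity>"
      using lborel.sigma_finite_countable by blast
    then show "\<exists>A. countable A \<and> A \<subseteq> sets (lebesgue :: 'a measure) \<and> \<Union>A = space (lebesgue :: 'a measure) \<and>
        (\<forall>a\<in>A. emeasure lebesgue a \<noteq> \<infinity>)"
      by (intro exI[of _ A]) (auto simp: subset_iff)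
  qed
  with assms show ?thesis
    by (intro sigma_finite_measure_restrict_space) auto
qed

section \<open>The inequality for a finite diffuse measure\<close>

abbreviation L :: "real measure" where "L \<equiv> lebesgue_on {0<..}"

lemma ennreal_half_add: "x / 2 + x / 2 = (x :: ennreal)"
  by (cases x) (auto simp: ennreal_divide_numeral ennreal_top_divide simp flip: ennreal_plus)

text \<open>Here \<open>K x t\<close> plays the role of \<open>U(x,t)\<^sup>q\<close>, cut off to \<open>0\<close> for \<open>t \<le> x\<close>, so that \<open>U\<close> itself is
  \<open>K powr (1 + 1 / p)\<close>, and \<open>p\<close> is \<open>- q'\<close>.\<close>

locale hardy_core =
  fixes p c :: real and \<mu> :: "real measure" and K :: "real \<Rightarrow> real \<Rightarrow> ennreal"
    and v :: "real \<Rightarrow> ennreal" and R :: real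
  assumes p_pos: "0 < p" and c_ge_1: "1 \<le> c"
    and sets_mu [measurable_cong, simp]: "sets \<mu> = sets borel"
    and finite_mu: "emeasure \<mu> UNIV < top"
    and atomless: "emeasure \<mu> {x} = 0"
    and mu_nonpos: "emeasure \<mu> {..0} = 0"
    and mu_beyond: "emeasure \<mu> {R..} = 0"
    and K_antimono: "antimono (\<lambda>x. K x t)"
    and K_mono: "mono (K x)"
    and K_finite: "K x t < top"
    and K_zero: "t \<le> x \<Longrightarrow> K x t = 0"
    and K_triangle: "0 \<le> x \<Longrightarrow> x < y \<Longrightarrow> y < z \<Longrightarrow> K x z \<le> ennreal c * (K x y + K y z)"
    and v_measurable [measurable]: "v \<in> borel_measurable L"
    and v_finite: "AE x in L. v x < top"
begin

text \<open>In these terms \<open>v z\<close> to the power q' is \<open>r z epowr p\<close>, with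
  the prescribed value infinity where \<open>v z = 0\<close>, and no negative power remains.\<close>

definition r :: "real \<Rightarrow> ennreal" where "r z = inverse (v z)"
definition W :: "real \<Rightarrow> ennreal" where "W t = emeasure \<mu> {t<..}"
definition N :: "real \<Rightarrow> ennreal" where "N x = (\<integral>\<^sup>+ s. K x s \<partial>\<mu>)"
definition M :: "real \<Rightarrow> real \<Rightarrow> ennreal" where "M x t = (\<integral>\<^sup>+ s. K x s * indicator {t<..} s \<partial>\<mu>)"
text \<open>Since \<open>K z t\<close> vanishes for z >= t, the essential supremum over (0,t) can be
  taken over the fixed space \<open>L\<close>. This makes it an essential supremum of a monotone
  family on one measure space.\<close>

definition V :: "real \<Rightarrow> ennreal" where "V t = esssup L (\<lambda>z. K z t epowr (p + 1) * r z epowr p)"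
definition S :: "real \<Rightarrow> ennreal" where "S t = esssup L (\<lambda>z. K z t * r z epowr p)"
definition G :: "real \<Rightarrow> ennreal" where "G t = W t epowr p * V t + N t epowr p * S t"
definition T :: "(real \<Rightarrow> ennreal) \<Rightarrow> real \<Rightarrow> ennreal"
  where "T f t = (\<integral>\<^sup>+ x. f x * K x t epowr (1 + 1 / p) \<partial>L)"

lemma space_mu [simp]: "space \<mu> = UNIV"
  using sets_eq_imp_space_eq[OF sets_mu] by simp

sublocale finite_measure \<mu>
  by standard (use finite_mu in simp)

lemma r_measurable [measurable]: "r \<in> borel_measurable L"
  unfolding r_def by measurable

lemma K_meas_t [measurable]: "K x \<in> borel_measurable borel"
  by (rule mono_ennreal_borel_measurable[OF K_mono])

lemma K_meas_mu [measurable]: "K x \<in> borel_measurable \<mu>"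
  by measurable

lemma K_meas_x [measurable]: "(\<lambda>x. K x t) \<in> borel_measurable borel"
  by (rule antimono_ennreal_borel_measurable[OF K_antimono])

lemma K_meas_L [measurable]: "(\<lambda>x. K x t) \<in> borel_measurable L"
  by (rule measurable_compose[OF id_measurable_lebesgue_on K_meas_x])

lemma K_le_x: "x \<le> y \<Longrightarrow> K y t \<le> K x t"
  using antimonoD[OF K_antimono] by simp

lemma K_le_t: "s \<le> t \<Longrightarrow> K x s \<le> K x t"
  using monoD[OF K_mono] by simp

lemma W_antimono: "antimono W"
  unfolding W_def by (intro antimonoI emeasure_mono) auto

lemma N_antimono: "antimono N"
  unfolding N_def by (intro antimonoI nn_integral_mono K_le_x)

lemma M_antimono: "antimono (M x)"
  unfolding M_def by (intro antimonoI nn_integral_mono mult_left_mono) (auto simp: indicator_def)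

lemma W_meas [measurable]: "W \<in> borel_measurable borel"
  by (rule antimono_ennreal_borel_measurable[OF W_antimono])

lemma N_meas [measurable]: "N \<in> borel_measurable borel"
  by (rule antimono_ennreal_borel_measurable[OF N_antimono])

lemma M_meas [measurable]: "M x \<in> borel_measurable borel"
  by (rule antimono_ennreal_borel_measurable[OF M_antimono])

lemma V_kernel_mono: "mono (\<lambda>t. K z t epowr (p + 1) * r z epowr p)"
  using p_pos by (intro monoI mult_right_mono epowr_mono K_le_t) auto

lemma S_kernel_mono: "mono (\<lambda>t. K z t * r z epowr p)"
  by (intro monoI mult_right_mono K_le_t) auto

lemma V_mono: "mono V"
  unfolding V_def by (rule esssup_mono_family[OF _ V_kernel_mono]) simp

lemma S_mono: "mono S"
  unfolding S_def by (rule esssup_mono_family[OF _ S_kernel_mono]) simp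

lemma V_meas [measurable]: "V \<in> borel_measurable borel"
  by (rule mono_ennreal_borel_measurable[OF V_mono])

lemma S_meas [measurable]: "S \<in> borel_measurable borel"
  by (rule mono_ennreal_borel_measurable[OF S_mono])

lemma G_meas [measurable]: "G \<in> borel_measurable borel"
  unfolding G_def by measurable

lemma AE_mu_countable: "countable A \<Longrightarrow> AE x in \<mu>. x \<notin> A"
proof -
  assume A: "countable A"
  have "(\<Union>x\<in>A. {x}) \<in> null_sets \<mu>"
    using A by (intro null_sets_UN') (auto simp: null_sets_def atomless)
  then show ?thesis by (auto intro: AE_not_in)
qed

lemma AE_mu_pos: "AE t in \<mu>. 0 < t"
proof -
  have "{..0} \<in> null_sets \<mu>" by (auto simp: null_sets_def mu_nonpos)
  from AE_not_in[OF this] show ?thesis by (auto elim!: eventually_mono)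
qed

lemma W_finite: "W t < top"
  unfolding W_def using emeasure_finite[of "{t<..}"] by (simp add: less_top[symmetric])

text \<open>The measure lives below \<open>R\<close>, where the kernel is at most
  \<open>K x R\<close>. Finiteness of \<open>N\<close> is what later permits cancelling it.\<close>

lemma N_finite: "N x < top"
proof -
  have "{R..} \<in> null_sets \<mu>" by (auto simp: null_sets_def mu_beyond)
  from AE_not_in[OF this] have "N x \<le> (\<integral>\<^sup>+ s. K x R \<partial>\<mu>)"
    unfolding N_def by (intro nn_integral_mono_AE) (auto elim!: eventually_mono intro!: K_le_t)
  also have "\<dots> < top"
    using finite_mu K_finite by (simp add: ennreal_mult_less_top)
  finally show ?thesis .
qed

section \<open>Tails of the kernel integral\<close>

lemma M_ge_W: "K x t * W t \<le> M x t"
proof -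
  have "K x t * W t = (\<integral>\<^sup>+ s. K x t * indicator {t<..} s \<partial>\<mu>)"
    by (simp add: W_def nn_integral_cmult_indicator)
  also have "\<dots> \<le> M x t"
    unfolding M_def by (intro nn_integral_mono) (auto simp: indicator_def intro: K_le_t)
  finally show ?thesis .
qed

lemma M_ge_N: "x \<le> t \<Longrightarrow> N t \<le> M x t"
  unfolding M_def N_def
  by (intro nn_integral_mono) (auto simp: indicator_def K_zero intro: K_le_x)

lemma M_le_N: "M x t \<le> N x"
  unfolding M_def N_def by (intro nn_integral_mono) (auto simp: indicator_def)

lemma M_le:
  assumes "0 \<le> x" "x < t"
  shows "M x t \<le> ennreal c * (K x t * W t + N t)"
proof -
  have "M x t \<le> (\<integral>\<^sup>+ s. ennreal c * (K x t * indicator {t<..} s + K t s) \<partial>\<mu>)"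
    unfolding M_def using assms by (intro nn_integral_mono) (auto simp: indicator_def K_triangle)
  also have "\<dots> = ennreal c * (K x t * W t + N t)"
  proof -
    have [measurable]: "K t \<in> borel_measurable \<mu>" by measurable
    show ?thesis
      by (subst nn_integral_cmult, measurable, subst nn_integral_add, measurable)
        (simp add: W_def N_def nn_integral_cmult_indicator)
  qed
  finally show ?thesis .
qed

text \<open>Right of \<open>x\<close> the sublevel set of the decreasing tail is a ray with endpoint
  \<open>m\<close>. Every tail starting strictly right of \<open>m\<close> is below
  \<open>h\<close>, and these increase to the tail from \<open>m\<close> by monotone convergence.
  The point \<open>m\<close> itself carries no mass.\<close>

lemma tail_below_level: "(\<integral>\<^sup>+ s. K x s * indicator {t. M x t < h} s \<partial>\<mu>) \<le> h"
proof (cases "{t. M x t < h} \<inter> {x<..} = {}")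
  case True
  then have "(\<integral>\<^sup>+ s. K x s * indicator {t. M x t < h} s \<partial>\<mu>) = (\<integral>\<^sup>+ s. 0 \<partial>\<mu>)"
  proof (intro nn_integral_cong)
    show "K x s * indicator {t. M x t < h} s = 0" for s
      using True by (cases "x < s") (auto simp: indicator_def K_zero)
  qed
  then show ?thesis by simp
next
  case False
  define Q where "Q = {t. M x t < h} \<inter> {x<..}"
  define m where "m = Inf Q"
  have bdd: "bdd_below Q" by (intro bdd_belowI[of _ x]) (auto simp: Q_def)
  have in_Q: "M x (m + 1 / Suc n) < h" for n
  proof -
    have "Inf Q < m + 1 / Suc n" by (simp add: m_def)
    then obtain t where t: "t \<in> Q" "t < m + 1 / Suc n"
      using False bdd by (subst (asm) cInf_less_iff) (auto simp: Q_def)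
    have "M x (m + 1 / Suc n) \<le> M x t" using t antimonoD[OF M_antimono] by simp
    with t show ?thesis by (auto simp: Q_def)
  qed
  have "(\<integral>\<^sup>+ s. K x s * indicator {t. M x t < h} s \<partial>\<mu>) \<le> (\<integral>\<^sup>+ s. (SUP n. K x s * indicator {m + 1 / Suc n<..} s) \<partial>\<mu>)"
  proof (rule nn_integral_mono_AE)
    have "AE s in \<mu>. s \<notin> {m}" by (rule AE_mu_countable) simp
    then show "AE s in \<mu>. K x s * indicator {t. M x t < h} s \<le> (SUP n. K x s * indicator {m + 1 / Suc n<..} s)"
    proof (rule eventually_mono)
      fix s assume "s \<notin> {m}"
      show "K x s * indicator {t. M x t < h} s \<le> (SUP n. K x s * indicator {m + 1 / Suc n<..} s)"
      proof (cases "s \<in> Q")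
        case True
        then have "m < s" using \<open>s \<notin> {m}\<close> cInf_lower[OF True bdd] by (simp add: m_def)
        then obtain n where "1 / Suc n < s - m" using nat_approx_posE[of "s - m"] by auto
        then have "K x s * indicator {t. M x t < h} s \<le> K x s * indicator {m + 1 / Suc n<..} s"
          by (auto simp: indicator_def)
        also have "\<dots> \<le> (SUP n. K x s * indicator {m + 1 / Suc n<..} s)" by (rule SUP_upper) simp
        finally show ?thesis .
      next
        case False
        then show ?thesis by (auto simp: Q_def indicator_def K_zero not_less)
      qed
    qed
  qed
  also have "\<dots> = (SUP n. M x (m + 1 / Suc n))"
    unfolding M_def
  proof (rule nn_integral_monotone_convergence_SUP)
    show "incseq (\<lambda>n s. K x s * indicator {m + 1 / real (Suc n)<..} s)"
    proof (intro incseq_SucI le_funI mult_left_mono)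
      fix n s
      have "1 / real (Suc (Suc n)) \<le> 1 / real (Suc n)" by (simp add: frac_le)
      then show "indicator {m + 1 / real (Suc n)<..} s \<le> (indicator {m + 1 / real (Suc (Suc n))<..} s :: ennreal)"
        by (auto simp: indicator_def)
    qed simp
  qed simp
  also have "\<dots> \<le> h" using in_Q by (intro SUP_least) (auto intro: less_imp_le)
  finally show ?thesis .
qed

text \<open>The tail \<open>M x\<close> decreases continuously from \<open>N x\<close>: if it has not yet dropped below half of
  its initial value at \<open>t\<close>, the first summand does the job, and otherwise half of the mass of
  \<open>K x s d\<mu>(s)\<close> sits where \<open>M x s\<close> is comparable with \<open>N x\<close>.\<close>

lemma N_powr_le:
  assumes "x < t"
  shows "N x epowr p \<le> 2 epowr (p + 1) * (M x t epowr p +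
    (\<integral>\<^sup>+ s. M x s epowr p * inverse (M x s) * K x s * indicator {x<..<t} s \<partial>\<mu>))"
proof (cases "N x \<le> 2 * M x t")
  case True
  have "N x epowr p \<le> 2 epowr p * M x t epowr p"
    using epowr_mono[OF p_pos True] by (simp add: epowr_mult p_pos)
  also have "\<dots> \<le> 2 epowr (p + 1) * (M x t epowr p +
    (\<integral>\<^sup>+ s. M x s epowr p * inverse (M x s) * K x s * indicator {x<..<t} s \<partial>\<mu>))"
  proof (rule mult_mono)
    show "2 epowr p \<le> (2 :: ennreal) epowr (p + 1)"
      using mult_left_mono[of "1 :: ennreal" 2 "2 epowr p"] by (simp add: epowr_Suc p_pos)
  qed auto
  finally show ?thesis .
next
  case False
  define h where "h = N x / 2"
  have N0: "0 < N x" using False by (metis not_gr_zero zero_le)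
  have hN: "h + h = N x" by (simp add: h_def ennreal_half_add)
  have hfin: "h < top" using N_finite[of x] hN by (metis ennreal_add_eq_top less_top)
  have Mt: "M x t < h"
  proof (rule ccontr)
    assume "\<not> M x t < h"
    then have "h + h \<le> M x t + M x t" by (intro add_mono) auto
    with False hN show False by (simp add: mult_2)
  qed
  let ?J = "{s. h \<le> M x s}"
  have "{s \<in> space borel. M x s < h} \<in> sets borel" "{s \<in> space borel. h \<le> M x s} \<in> sets borel"
    by measurable
  then have [measurable]: "{s. M x s < h} \<in> sets borel" "?J \<in> sets borel" by simp_all
  have "h + h = (\<integral>\<^sup>+ s. K x s * indicator {s. M x s < h} s + K x s * indicator ?J s \<partial>\<mu>)"
    unfolding hN N_def by (intro nn_integral_cong) (auto simp: indicator_def)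
  also have "\<dots> = (\<integral>\<^sup>+ s. K x s * indicator {s. M x s < h} s \<partial>\<mu>) + (\<integral>\<^sup>+ s. K x s * indicator ?J s \<partial>\<mu>)"
    by (rule nn_integral_add) measurable
  also have "\<dots> \<le> h + (\<integral>\<^sup>+ s. K x s * indicator ?J s \<partial>\<mu>)"
    by (intro add_right_mono tail_below_level)
  finally have *: "h \<le> (\<integral>\<^sup>+ s. K x s * indicator ?J s \<partial>\<mu>)"
    using hfin by (auto simp: ennreal_add_left_cancel_le)
  have h0: "0 < h" using N0 hN by (metis add.right_neutral not_gr_zero)
  have "N x epowr p = 2 epowr p * h epowr p"
    by (simp add: hN[symmetric] epowr_mult[OF p_pos, symmetric] mult_2)
  also have "\<dots> = 2 epowr p * (h epowr p * inverse h * h)"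
  proof -
    have "inverse h * h = 1" using h0 hfin
      by (metis ennreal_divide_self less_numeral_extra(3) divide_ennreal_def mult.commute)
    then show ?thesis by (simp add: mult.assoc)
  qed
  also have "\<dots> \<le> 2 epowr p * (h epowr p * inverse h * (\<integral>\<^sup>+ s. K x s * indicator ?J s \<partial>\<mu>))"
    by (intro mult_left_mono *) auto
  also have "\<dots> = 2 epowr p * (\<integral>\<^sup>+ s. (h epowr p * inverse h) * (K x s * indicator ?J s) \<partial>\<mu>)"
    by (subst nn_integral_cmult) auto
  also have "\<dots> \<le> 2 epowr p * (\<integral>\<^sup>+ s. 2 * (M x s epowr p * inverse (M x s) * K x s * indicator {x<..<t} s) \<partial>\<mu>)"
  proof (intro mult_left_mono nn_integral_mono)
    fix s
    show "(h epowr p * inverse h) * (K x s * indicator ?J s) \<le> 2 * (M x s epowr p * inverse (M x s) * K x s * indicator {x<..<t} s)"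
    proof (cases "s \<in> ?J \<and> x < s")
      case True
      then have "s < t" using Mt antimonoD[OF M_antimono, of t s x] by (force simp: not_less)
      \<comment> \<open>The exponent p - 1 can have either sign. Splitting it into the power p and a
        reciprocal uses h <= M(x,s) for the first factor and M(x,s) <= N(x) = 2 h for the
        second.\<close>
      have "inverse h = 2 * inverse (N x)"
      proof -
        obtain a where a: "N x = ennreal a" "0 < a"
          using N0 N_finite[of x] by (cases "N x") auto
        then have "h = ennreal (a / 2)" by (simp add: h_def ennreal_divide_numeral)
        then have "inverse h = ennreal (2 / a)" using a by (simp add: inverse_ennreal)
        also have "\<dots> = 2 * inverse (N x)"
          using a by (simp add: inverse_ennreal numeral_mult_ennreal divide_inverse)
        finally show ?thesis .
      qed
      also have "\<dots> \<le> 2 * inverse (M x s)"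
        by (intro mult_left_mono ennreal_inverse_antimono M_le_N) simp
      finally have "h epowr p * inverse h \<le> M x s epowr p * (2 * inverse (M x s))"
        using True by (intro mult_mono epowr_mono p_pos) auto
      from mult_right_mono[OF this, of "K x s"] True \<open>s < t\<close> show ?thesis
        by (simp add: mult_ac)
    qed (auto simp: indicator_def K_zero not_less)
  qed simp
  also have "\<dots> = 2 epowr (p + 1) * (\<integral>\<^sup>+ s. M x s epowr p * inverse (M x s) * K x s * indicator {x<..<t} s \<partial>\<mu>)"
    by (subst nn_integral_cmult) (auto simp: epowr_Suc p_pos mult_ac)
  also have "\<dots> \<le> 2 epowr (p + 1) * (M x t epowr p +
    (\<integral>\<^sup>+ s. M x s epowr p * inverse (M x s) * K x s * indicator {x<..<t} s \<partial>\<mu>))"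
    by (intro mult_left_mono) auto
  finally show ?thesis .
qed

section \<open>The majorant that factors the operator through L^1\<close>

definition C\<^sub>M :: ennreal where "C\<^sub>M = ennreal c epowr p * 2 epowr p"

definition C\<^sub>Y :: ennreal where "C\<^sub>Y = 2 epowr (p + 1) * (C\<^sub>M * ennreal c)"

lemma one_le_c: "1 \<le> ennreal c"
  using c_ge_1 by simp

lemma M_powr_le:
  assumes "0 \<le> x" "x < t"
  shows "M x t epowr p \<le> C\<^sub>M * (K x t epowr p * W t epowr p + N t epowr p)"
proof -
  have "M x t epowr p \<le> ennreal c epowr p * (K x t * W t + N t) epowr p"
    using epowr_mono[OF p_pos M_le[OF assms]] by (simp add: epowr_mult p_pos)
  also have "\<dots> \<le> ennreal c epowr p * (2 epowr p * ((K x t * W t) epowr p + N t epowr p))"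
    by (intro mult_left_mono epowr_add_le p_pos) simp
  also have "\<dots> = C\<^sub>M * (K x t epowr p * W t epowr p + N t epowr p)"
    by (simp add: C\<^sub>M_def epowr_mult p_pos mult_ac)
  finally show ?thesis .
qed

lemma G_bound:
  assumes "K x t epowr (p + 1) * r x epowr p \<le> V t" "K x t * r x epowr p \<le> S t"
  shows "(K x t epowr p * W t epowr p + N t epowr p) * (K x t * r x epowr p) \<le> G t"
proof -
  have "(K x t epowr p * W t epowr p + N t epowr p) * (K x t * r x epowr p) =
      W t epowr p * (K x t epowr (p + 1) * r x epowr p) + N t epowr p * (K x t * r x epowr p)"
    by (simp add: epowr_Suc p_pos distrib_right distrib_left mult_ac)
  also have "\<dots> \<le> G t"
    unfolding G_def using assms by (intro add_mono mult_left_mono) auto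
  finally show ?thesis .
qed

text \<open>The triangle inequality splits \<open>K x t\<close> at s, and each half meets the lower
  bound of the tail that suits it: K(x,s) W(s) <= M(x,s) for the first, N(s) <= M(x,s) for the
  second. This is where the two weights in \<open>Y\<close> come from.\<close>

lemma K_inverse_M_le:
  assumes "0 \<le> x" "x < s" "s < t"
  shows "K x t * K x s * inverse (M x s) \<le> ennreal c * (inverse (W s) + inverse (N s) * K s t) * K x s"
proof -
  have 1: "K x s * inverse (M x s) \<le> inverse (W s)"
  proof (cases "K x s = 0")
    case False
    have "K x s * inverse (M x s) \<le> K x s * inverse (K x s * W s)"
      by (intro mult_left_mono ennreal_inverse_antimono M_ge_W) simp
    also have "\<dots> = (K x s * inverse (K x s)) * inverse (W s)"
      using K_finite W_finite by (simp add: ennreal_inverse_mult mult.assoc)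
    also have "\<dots> \<le> 1 * inverse (W s)"
      using ennreal_inverse_mult_le[of "K x s"] by (intro mult_right_mono) (auto simp: mult.commute)
    finally show ?thesis by simp
  qed simp
  have 2: "inverse (M x s) \<le> inverse (N s)"
    using assms by (intro ennreal_inverse_antimono M_ge_N) simp
  have "K x t * K x s * inverse (M x s) \<le> ennreal c * (K x s + K s t) * K x s * inverse (M x s)"
    using assms by (intro mult_right_mono K_triangle) auto
  also have "\<dots> = ennreal c * (K x s * inverse (M x s) + inverse (M x s) * K s t) * K x s"
    by (simp add: algebra_simps)
  also have "\<dots> \<le> ennreal c * (inverse (W s) + inverse (N s) * K s t) * K x s"
    by (intro mult_right_mono mult_left_mono add_mono 1 2) auto
  finally show ?thesis .
qed

definition Y :: "real \<Rightarrow> ennreal" where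
  "Y t = C\<^sub>Y * (G t + (\<integral>\<^sup>+ s. G s * inverse (W s) * indicator {s<..} t \<partial>\<mu>)
                 + (\<integral>\<^sup>+ s. G s * inverse (N s) * K s t \<partial>\<mu>))"

lemma Y_meas [measurable]: "Y \<in> borel_measurable borel"
proof -
  have [measurable]: "(\<lambda>t. \<integral>\<^sup>+ s. G s * inverse (W s) * indicator {s<..} t \<partial>\<mu>) \<in> borel_measurable borel"
    by (intro mono_ennreal_borel_measurable monoI nn_integral_mono mult_left_mono) (auto simp: indicator_def)
  have [measurable]: "(\<lambda>t. \<integral>\<^sup>+ s. G s * inverse (N s) * K s t \<partial>\<mu>) \<in> borel_measurable borel"
    by (intro mono_ennreal_borel_measurable monoI nn_integral_mono mult_left_mono K_le_t) auto
  show ?thesis unfolding Y_def by measurable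
qed

text \<open>After the interchange the inner integral over t of the indicator is \<open>W s\<close>,
  and that of \<open>K s t\<close> is \<open>N s\<close>. Each cancels its reciprocal, so each of
  the three summands of \<open>Y\<close> costs at most one integral of \<open>G\<close>.\<close>

lemma nn_integral_Y_le: "(\<integral>\<^sup>+ t. Y t \<partial>\<mu>) \<le> 3 * C\<^sub>Y * (\<integral>\<^sup>+ t. G t \<partial>\<mu>)"
proof -
  let ?I = "\<integral>\<^sup>+ t. G t \<partial>\<mu>"
  have sf: "sigma_finite_measure \<mu>" ..
  have id: "(\<lambda>x. x) \<in> measurable \<mu> borel" by measurable
  have "(\<integral>\<^sup>+ t. \<integral>\<^sup>+ s. G s * inverse (W s) * indicator {s<..} t \<partial>\<mu> \<partial>\<mu>)
      \<le> (\<integral>\<^sup>+ s. G s * inverse (W s) * (\<integral>\<^sup>+ t. indicator {s<..} t \<partial>\<mu>) \<partial>\<mu>)"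
    by (rule nn_integral_swap_antimono_kernel[OF sf sf id AE_mu_countable sets_mu])
      (auto intro!: antimonoI simp: indicator_def)
  also have "\<dots> \<le> ?I"
  proof (rule nn_integral_mono)
    fix s
    have "G s * (inverse (W s) * W s) \<le> G s * 1"
      by (intro mult_left_mono ennreal_inverse_mult_le) simp
    then show "G s * inverse (W s) * (\<integral>\<^sup>+ t. indicator {s<..} t \<partial>\<mu>) \<le> G s"
      by (simp add: W_def mult.assoc)
  qed
  finally have 1: "(\<integral>\<^sup>+ t. \<integral>\<^sup>+ s. G s * inverse (W s) * indicator {s<..} t \<partial>\<mu> \<partial>\<mu>) \<le> ?I" .
  have "(\<integral>\<^sup>+ t. \<integral>\<^sup>+ s. G s * inverse (N s) * K s t \<partial>\<mu> \<partial>\<mu>)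
      \<le> (\<integral>\<^sup>+ s. G s * inverse (N s) * (\<integral>\<^sup>+ t. K s t \<partial>\<mu>) \<partial>\<mu>)"
    by (rule nn_integral_swap_antimono_kernel[OF sf sf id AE_mu_countable sets_mu])
      (auto intro: K_antimono)
  also have "\<dots> \<le> ?I"
  proof (rule nn_integral_mono)
    fix s
    have "G s * (inverse (N s) * N s) \<le> G s * 1"
      by (intro mult_left_mono ennreal_inverse_mult_le) simp
    then show "G s * inverse (N s) * (\<integral>\<^sup>+ t. K s t \<partial>\<mu>) \<le> G s"
      by (simp add: N_def mult.assoc)
  qed
  finally have 2: "(\<integral>\<^sup>+ t. \<integral>\<^sup>+ s. G s * inverse (N s) * K s t \<partial>\<mu> \<partial>\<mu>) \<le> ?I" .
  define A where "A t = (\<integral>\<^sup>+ s. G s * inverse (W s) * indicator {s<..} t \<partial>\<mu>)" for t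
  define B where "B t = (\<integral>\<^sup>+ s. G s * inverse (N s) * K s t \<partial>\<mu>)" for t
  have "A \<in> borel_measurable borel" "B \<in> borel_measurable borel"
    unfolding A_def B_def
    by (intro mono_ennreal_borel_measurable monoI nn_integral_mono mult_left_mono K_le_t; auto simp: indicator_def)+
  then have [measurable]: "A \<in> borel_measurable \<mu>" "B \<in> borel_measurable \<mu>" "G \<in> borel_measurable \<mu>"
    by (auto simp: measurable_cong_sets[OF sets_mu refl])
  have "(\<integral>\<^sup>+ t. Y t \<partial>\<mu>) = C\<^sub>Y * (?I + (\<integral>\<^sup>+ t. \<integral>\<^sup>+ s. G s * inverse (W s) * indicator {s<..} t \<partial>\<mu> \<partial>\<mu>)
      + (\<integral>\<^sup>+ t. \<integral>\<^sup>+ s. G s * inverse (N s) * K s t \<partial>\<mu> \<partial>\<mu>))"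
    unfolding Y_def A_def[symmetric] B_def[symmetric]
    by (simp add: nn_integral_cmult nn_integral_add)
  also have "\<dots> \<le> C\<^sub>Y * (?I + ?I + ?I)"
    by (intro mult_left_mono add_mono 1 2) auto
  also have "?I + ?I + ?I = 3 * ?I"
  proof -
    have "(1 + 1 + 1) * ?I = ?I + ?I + ?I" by (simp only: distrib_right mult_1)
    then show ?thesis by simp
  qed
  finally show ?thesis by (simp add: mult_ac)
qed

text \<open>Multiply the decomposition of N(x)^p by K(x,t) r(x)^p. The boundary term is controlled
  by G(t). In the integral over s the factor K(x,s), already present there, joins r(x)^p to form
  G(s), while K(x,t) is spent on the triangle inequality. The set \<open>D\<close> of bad parameters
  is invisible to the integral because the measure is diffuse.\<close>

lemma Y_lower_bound:
  assumes x: "0 \<le> x" "x < t"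
    and good: "\<And>s. s \<notin> D \<Longrightarrow> K x s epowr (p + 1) * r x epowr p \<le> V s"
      "\<And>s. s \<notin> D \<Longrightarrow> K x s * r x epowr p \<le> S s"
    and D: "countable D" and t: "t \<notin> D"
  shows "N x epowr p * K x t * r x epowr p \<le> Y t"
proof -
  define J where "J = (\<integral>\<^sup>+ s. M x s epowr p * inverse (M x s) * K x s * indicator {x<..<t} s \<partial>\<mu>)"
  have "M x t epowr p * (K x t * r x epowr p) \<le> C\<^sub>M * (K x t epowr p * W t epowr p + N t epowr p) * (K x t * r x epowr p)"
    by (intro mult_right_mono M_powr_le x) simp
  also have "\<dots> \<le> C\<^sub>M * G t"
    unfolding mult.assoc by (intro mult_left_mono G_bound good t) simp
  also have "\<dots> \<le> C\<^sub>M * ennreal c * G t"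
    using mult_left_mono[OF one_le_c, of "C\<^sub>M * G t"] by (simp add: mult_ac)
  finally have 1: "M x t epowr p * (K x t * r x epowr p) \<le> C\<^sub>M * ennreal c * G t" .
  have "J * (K x t * r x epowr p)
      = (\<integral>\<^sup>+ s. M x s epowr p * inverse (M x s) * K x s * indicator {x<..<t} s * (K x t * r x epowr p) \<partial>\<mu>)"
    unfolding J_def by (subst nn_integral_multc) auto
  also have "\<dots> \<le> (\<integral>\<^sup>+ s. C\<^sub>M * ennreal c * (G s * inverse (W s) * indicator {s<..} t + G s * inverse (N s) * K s t) \<partial>\<mu>)"
  proof (rule nn_integral_mono_AE, rule eventually_mono[OF AE_mu_countable[OF D]])
    fix s assume s: "s \<notin> D"
    show "M x s epowr p * inverse (M x s) * K x s * indicator {x<..<t} s * (K x t * r x epowr p)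
      \<le> C\<^sub>M * ennreal c * (G s * inverse (W s) * indicator {s<..} t + G s * inverse (N s) * K s t)"
    proof (cases "x < s \<and> s < t")
      case True
      then have xs: "x < s" "s < t" by auto
      have "M x s epowr p * inverse (M x s) * K x s * indicator {x<..<t} s * (K x t * r x epowr p)
         = M x s epowr p * (K x t * K x s * inverse (M x s)) * r x epowr p"
        using xs by (simp add: mult_ac)
      also have "\<dots> \<le> (C\<^sub>M * (K x s epowr p * W s epowr p + N s epowr p)) *
          (ennreal c * (inverse (W s) + inverse (N s) * K s t) * K x s) * r x epowr p"
        by (intro mult_right_mono mult_mono M_powr_le K_inverse_M_le x xs) auto
      also have "\<dots> = C\<^sub>M * ennreal c * (((K x s epowr p * W s epowr p + N s epowr p) * (K x s * r x epowr p)) *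
          (inverse (W s) + inverse (N s) * K s t))"
        by (simp add: mult_ac)
      also have "\<dots> \<le> C\<^sub>M * ennreal c * (G s * (inverse (W s) + inverse (N s) * K s t))"
        by (intro mult_left_mono mult_right_mono G_bound good s) auto
      also have "\<dots> = C\<^sub>M * ennreal c * (G s * inverse (W s) * indicator {s<..} t + G s * inverse (N s) * K s t)"
        using xs by (simp add: distrib_left mult_ac)
      finally show ?thesis .
    qed (auto simp: indicator_def)
  qed
  also have "\<dots> = C\<^sub>M * ennreal c * ((\<integral>\<^sup>+ s. G s * inverse (W s) * indicator {s<..} t \<partial>\<mu>) + (\<integral>\<^sup>+ s. G s * inverse (N s) * K s t \<partial>\<mu>))"
  proof -
    have [measurable]: "(\<lambda>s. indicator {s<..} t :: ennreal) \<in> borel_measurable borel"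
      by (intro antimono_ennreal_borel_measurable antimonoI) (auto simp: indicator_def)
    have "(\<lambda>s. G s * inverse (W s) * indicator {s<..} t) \<in> borel_measurable borel"
      by (intro borel_measurable_times_ennreal) measurable
    then show ?thesis
      by (simp add: nn_integral_cmult nn_integral_add measurable_cong_sets[OF sets_mu refl])
  qed
  finally have 2: "J * (K x t * r x epowr p) \<le> \<dots>" .
  have "N x epowr p * K x t * r x epowr p = N x epowr p * (K x t * r x epowr p)"
    by (simp add: mult_ac)
  also have "\<dots> \<le> 2 epowr (p + 1) * (M x t epowr p + J) * (K x t * r x epowr p)"
    unfolding J_def by (intro mult_right_mono N_powr_le x) simp
  also have "\<dots> = 2 epowr (p + 1) * (M x t epowr p * (K x t * r x epowr p) + J * (K x t * r x epowr p))"
    by (simp add: distrib_right distrib_left mult_ac)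
  also have "\<dots> \<le> 2 epowr (p + 1) * (C\<^sub>M * ennreal c * G t +
     C\<^sub>M * ennreal c * ((\<integral>\<^sup>+ s. G s * inverse (W s) * indicator {s<..} t \<partial>\<mu>) + (\<integral>\<^sup>+ s. G s * inverse (N s) * K s t \<partial>\<mu>)))"
    by (intro mult_left_mono add_mono 1 2) simp
  also have "\<dots> = Y t"
    by (simp add: Y_def C\<^sub>Y_def distrib_left mult_ac add_ac)
  finally show ?thesis .
qed

text \<open>The p-th root of the bound \<open>le\<close>, multiplied by v(x)/N(x) and by K(x,t).
  Positivity of \<open>W t\<close> forces N(x) > 0 wherever K(x,t) does not vanish.\<close>

lemma kernel_le_Y:
  assumes W: "0 < W t" and x: "x < t" and v: "v x < top"
    and Y: "Y t < top" and le: "N x epowr p * K x t * r x epowr p \<le> Y t"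
  shows "K x t epowr (1 + 1 / p) \<le> Y t epowr (1 / p) * (v x * inverse (N x) * K x t)"
proof (cases "K x t = 0")
  case True
  then show ?thesis using p_pos by (simp add: add_pos_pos)
next
  case False
  have "0 < K x t * W t" using False W by (simp add: ennreal_zero_less_mult_iff zero_less_iff_neq_zero)
  also have "\<dots> \<le> N x" by (rule order_trans[OF M_ge_W M_le_N])
  finally have N0: "0 < N x" .
  \<comment> \<open>If \<open>v x\<close> were 0, then \<open>r x\<close> would be infinite and
    \<open>le\<close> would contradict the finiteness of \<open>Y t\<close>.\<close>
  have "0 < v x"
  proof (rule ccontr)
    assume "\<not> 0 < v x"
    then have "N x epowr p * K x t * r x epowr p = top"
      using N0 False p_pos by (simp add: r_def ennreal_mult_top)
    with le Y show False by (simp add: top_unique)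
  qed
  have "(N x epowr p * K x t * r x epowr p) epowr (1 / p) \<le> Y t epowr (1 / p)"
    using le p_pos by (intro epowr_mono) auto
  then have *: "N x * K x t epowr (1 / p) * r x \<le> Y t epowr (1 / p)"
    using p_pos by (simp add: epowr_mult epowr_inverse_cancel)
  have "K x t epowr (1 / p) = (N x * K x t epowr (1 / p) * r x) * (v x * inverse (N x))"
  proof -
    have "N x * inverse (N x) = 1" "r x * v x = 1"
      using N0 N_finite[of x] \<open>0 < v x\<close> v unfolding r_def
      by (metis divide_ennreal_def ennreal_divide_self less_irrefl mult.commute)+
    then have "K x t epowr (1 / p) = K x t epowr (1 / p) * (N x * inverse (N x)) * (r x * v x)"
      by simp
    then show ?thesis by (simp add: mult_ac)
  qed
  also have "\<dots> \<le> Y t epowr (1 / p) * (v x * inverse (N x))"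
    by (intro mult_right_mono *) simp
  finally have "K x t * K x t epowr (1 / p) \<le> K x t * (Y t epowr (1 / p) * (v x * inverse (N x)))"
    by (intro mult_left_mono) auto
  then show ?thesis
    using p_pos by (subst epowr_add) (auto simp: mult_ac)
qed

section \<open>Sufficiency: Young's inequality and integration\<close>

definition q :: real where "q = p / (p + 1)"

lemma q_bounds: "0 < q" "q < 1"
  using p_pos by (auto simp: q_def)

lemma one_minus_q: "1 - q = q / p"
proof -
  have "q / p = 1 / (p + 1)" using p_pos by (simp add: q_def)
  also have "\<dots> = 1 - q" using p_pos by (simp add: q_def field_simps)
  finally show ?thesis by simp
qed

text \<open>The parameter stays free so that the pointwise estimate is additive and can simply be
  integrated. The product form that Hoelder's inequality would give is recovered afterwards by
  \<open>epowr_optimise\<close>.\<close>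

lemma T_powr_le:
  assumes f [measurable]: "f \<in> borel_measurable L" and \<theta>: "0 < \<theta>"
    and W: "0 < W t" and t: "0 < t"
    and good: "AE x in L. N x epowr p * K x t * r x epowr p \<le> Y t"
  shows "T f t epowr q \<le> ennreal \<theta> * (\<integral>\<^sup>+ x. f x * v x * inverse (N x) * K x t \<partial>L)
     + ennreal (\<theta> powr (- p)) * Y t"
proof (cases "Y t < top")
  case False
  then have "Y t = top" by (simp add: not_less top_unique)
  then show ?thesis using \<theta> by (simp add: ennreal_mult_top)
next
  case True
  let ?X = "\<integral>\<^sup>+ x. f x * v x * inverse (N x) * K x t \<partial>L"
  have [measurable]: "N \<in> borel_measurable L"
    by (rule measurable_compose[OF id_measurable_lebesgue_on N_meas])
  have "T f t \<le> (\<integral>\<^sup>+ x. Y t epowr (1 / p) * (f x * v x * inverse (N x) * K x t) \<partial>L)"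
    unfolding T_def
  proof (rule nn_integral_mono_AE)
    show "AE x in L. f x * K x t epowr (1 + 1 / p) \<le> Y t epowr (1 / p) * (f x * v x * inverse (N x) * K x t)"
      using good v_finite
    proof eventually_elim
      case (elim x)
      show ?case
      proof (cases "x < t")
        case True
        from mult_left_mono[OF kernel_le_Y[OF W True elim(2) \<open>Y t < top\<close> elim(1)], of "f x"]
        show ?thesis by (simp add: mult_ac)
      next
        case False
        then show ?thesis using p_pos by (simp add: K_zero add_pos_pos)
      qed
    qed
  qed
  also have "\<dots> = Y t epowr (1 / p) * ?X"
    by (rule nn_integral_cmult) measurable
  finally have "T f t epowr q \<le> (Y t epowr (1 / p) * ?X) epowr q"
    by (intro epowr_mono q_bounds)
  also have "\<dots> = ?X epowr q * Y t epowr (1 - q)"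
    using q_bounds p_pos by (simp add: epowr_mult epowr_epowr one_minus_q mult.commute)
  \<comment> \<open>The scaling factors cancel because p (1 - q) = q.\<close>
  also have "\<dots> = (ennreal \<theta> * ?X) epowr q * (ennreal (\<theta> powr (- p)) * Y t) epowr (1 - q)"
  proof -
    have "ennreal \<theta> epowr q * ennreal (\<theta> powr (- p)) epowr (1 - q) = ennreal (\<theta> powr q * \<theta> powr (- q))"
      using q_bounds \<theta> p_pos
      by (simp add: ennreal_epowr powr_powr one_minus_q ennreal_mult)
    also have "\<dots> = 1" using \<theta> by (simp flip: powr_add)
    finally have *: "ennreal \<theta> epowr q * ennreal (\<theta> powr (- p)) epowr (1 - q) = 1" by simp
    have "0 < 1 - q" using q_bounds by simp
    then have "(ennreal \<theta> * ?X) epowr q * (ennreal (\<theta> powr (- p)) * Y t) epowr (1 - q)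
        = (ennreal \<theta> epowr q * ennreal (\<theta> powr (- p)) epowr (1 - q)) * (?X epowr q * Y t epowr (1 - q))"
      by (simp only: epowr_mult q_bounds mult_ac)
    then show ?thesis unfolding * by simp
  qed
  also have "\<dots> \<le> ennreal \<theta> * ?X + ennreal (\<theta> powr (- p)) * Y t"
    by (rule epowr_young[OF q_bounds])
  finally show ?thesis .
qed

text \<open>The zero set of \<open>W\<close> is an up-set. Rays from its rational members are null
  and cover all of it except possibly a smallest element, which is null because there are no
  atoms.\<close>

lemma AE_mu_W_pos: "AE t in \<mu>. 0 < W t"
proof -
  have "AE t in \<mu>. t \<notin> {t. W t = 0}"
  proof (rule AE_not_in)
    define Q where "Q = {t. W t = 0}"
    have "{of_rat q<..} \<in> null_sets \<mu>" if "of_rat q \<in> Q" for q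
      using that by (auto simp: Q_def W_def null_sets_def)
    then have 1: "(\<Union>q\<in>{q. of_rat q \<in> Q}. {of_rat q<..}) \<in> null_sets \<mu>"
      by (intro null_sets_UN') auto
    define E where "E = Q - (\<Union>q\<in>{q. of_rat q \<in> Q}. {of_rat q<..})"
    have "x = y" if "x \<in> E" "y \<in> E" "x \<le> y" for x y
    proof (rule ccontr)
      assume "x \<noteq> y"
      with that obtain q where q: "x < of_rat q" "of_rat q < y" using of_rat_dense[of x y] by auto
      have "W (of_rat q) \<le> W x" using antimonoD[OF W_antimono, of x "of_rat q"] q by simp
      then have "of_rat q \<in> Q" using that by (auto simp: Q_def E_def)
      with q that show False by (auto simp: E_def)
    qed
    then have "countable E"
      by (intro countableI'[of "\<lambda>_. 0 :: nat"] inj_onI) (metis linear)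
    then have 2: "(\<Union>x\<in>E. {x}) \<in> null_sets \<mu>"
      by (intro null_sets_UN') (auto simp: null_sets_def atomless)
    have "{t \<in> space borel. W t = 0} \<in> sets borel" by measurable
    then have Q: "Q \<in> sets \<mu>" by (simp add: Q_def)
    have "Q \<in> null_sets \<mu>"
      by (rule null_sets_subset[OF null_sets.Un[OF 1 2] Q]) (auto simp: E_def)
    then show "{t. W t = 0} \<in> null_sets \<mu>" by (simp add: Q_def)
  qed
  then show ?thesis by (auto elim!: eventually_mono simp: zero_less_iff_neq_zero)
qed

lemma sufficiency_scaled:
  assumes f [measurable]: "f \<in> borel_measurable L" and \<theta>: "0 < \<theta>"
  shows "(\<integral>\<^sup>+ t. T f t epowr q \<partial>\<mu>) \<le> ennreal \<theta> * (\<integral>\<^sup>+ x. f x * v x \<partial>L)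
     + ennreal (\<theta> powr (- p)) * (3 * C\<^sub>Y * (\<integral>\<^sup>+ t. G t \<partial>\<mu>))"
proof -
  define D where "D = {t. V t < (INF y\<in>{t<..}. V y)} \<union> {t. S t < (INF y\<in>{t<..}. S y)}"
  have D: "countable D"
    unfolding D_def by (intro countable_Un mono_ennreal_countable_jumps V_mono S_mono)
  have [measurable]: "N \<in> borel_measurable L"
    by (rule measurable_compose[OF id_measurable_lebesgue_on N_meas])
  have mX: "(\<lambda>t. \<integral>\<^sup>+ x. f x * v x * inverse (N x) * K x t \<partial>L) \<in> borel_measurable borel"
    by (intro mono_ennreal_borel_measurable monoI nn_integral_mono mult_left_mono K_le_t) auto
  have mX' [measurable]: "(\<lambda>t. \<integral>\<^sup>+ x. f x * v x * inverse (N x) * K x t \<partial>L) \<in> borel_measurable \<mu>"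
    using mX by (simp add: measurable_cong_sets[OF sets_mu refl])
  \<comment> \<open>The quantifier over s must stand inside the almost-everywhere statement:
    \<open>Y_lower_bound\<close> uses these bounds for fixed x at all s under the integral.\<close>
  have good: "AE x in L. \<forall>s. s \<notin> D \<longrightarrow>
      K x s epowr (p + 1) * r x epowr p \<le> V s \<and> K x s * r x epowr p \<le> S s"
  proof -
    have 1: "AE x in L. \<forall>s. s \<notin> {t. V t < (INF y\<in>{t<..}. V y)} \<longrightarrow> K x s epowr (p + 1) * r x epowr p \<le> V s"
      unfolding V_def by (rule AE_le_esssup_mono_family[OF _ V_kernel_mono]) measurable
    have 2: "AE x in L. \<forall>s. s \<notin> {t. S t < (INF y\<in>{t<..}. S y)} \<longrightarrow> K x s * r x epowr p \<le> S s"
      unfolding S_def by (rule AE_le_esssup_mono_family[OF _ S_kernel_mono]) measurable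
    from 1 2 show ?thesis
      by eventually_elim (unfold D_def Un_iff de_Morgan_disj, blast)
  qed
  have pos: "AE x in L. 0 \<le> x"
    by (rule AE_I2) simp
  have "(\<integral>\<^sup>+ t. T f t epowr q \<partial>\<mu>) \<le> (\<integral>\<^sup>+ t. ennreal \<theta> * (\<integral>\<^sup>+ x. f x * v x * inverse (N x) * K x t \<partial>L)
     + ennreal (\<theta> powr (- p)) * Y t \<partial>\<mu>)"
  proof (rule nn_integral_mono_AE)
    show "AE t in \<mu>. T f t epowr q \<le> ennreal \<theta> * (\<integral>\<^sup>+ x. f x * v x * inverse (N x) * K x t \<partial>L)
     + ennreal (\<theta> powr (- p)) * Y t"
      using AE_mu_pos AE_mu_W_pos AE_mu_countable[OF D]
    proof eventually_elim
      case (elim t)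
      have "AE x in L. N x epowr p * K x t * r x epowr p \<le> Y t"
        using good pos
      proof eventually_elim
        case (elim x)
        show ?case
        proof (cases "x < t")
          case True
          with elim \<open>t \<notin> D\<close> D show ?thesis by (intro Y_lower_bound) auto
        qed (simp add: K_zero)
      qed
      with elim f \<theta> show ?case by (intro T_powr_le)
    qed
  qed
  also have "\<dots> = ennreal \<theta> * (\<integral>\<^sup>+ t. \<integral>\<^sup>+ x. f x * v x * inverse (N x) * K x t \<partial>L \<partial>\<mu>)
     + ennreal (\<theta> powr (- p)) * (\<integral>\<^sup>+ t. Y t \<partial>\<mu>)"
    by (simp add: nn_integral_add nn_integral_cmult)
  finally have *: "(\<integral>\<^sup>+ t. T f t epowr q \<partial>\<mu>) \<le> \<dots>" .
  have "(\<integral>\<^sup>+ t. \<integral>\<^sup>+ x. f x * v x * inverse (N x) * K x t \<partial>L \<partial>\<mu>)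
      \<le> (\<integral>\<^sup>+ x. f x * v x * inverse (N x) * (\<integral>\<^sup>+ t. K x t \<partial>\<mu>) \<partial>L)"
    by (rule nn_integral_swap_antimono_kernel[OF sigma_finite_lebesgue_on _ id_measurable_lebesgue_on countable_null_lebesgue_on sets_mu])
      (auto intro: K_antimono sigma_finite_measure_axioms)
  \<comment> \<open>Dividing by \<open>N x\<close>, the integral of the kernel over t, makes the
    kernel have mass at most one. This is boundedness on L^1.\<close>
  also have "\<dots> \<le> (\<integral>\<^sup>+ x. f x * v x \<partial>L)"
  proof (rule nn_integral_mono)
    fix x
    have "f x * v x * (inverse (N x) * N x) \<le> f x * v x * 1"
      by (intro mult_left_mono ennreal_inverse_mult_le) simp
    then show "f x * v x * inverse (N x) * (\<integral>\<^sup>+ t. K x t \<partial>\<mu>) \<le> f x * v x"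
      by (simp add: N_def mult.assoc)
  qed
  finally show ?thesis
    by (intro order_trans[OF *] add_mono mult_left_mono nn_integral_Y_le) auto
qed

end

section \<open>Sums and optimisation\<close>

text \<open>Balancing the two terms would give \<theta> = (A/I)^(1-q). Since \<open>I\<close> or
  \<open>A\<close> may vanish, both are first enlarged by e > 0.\<close>

lemma epowr_optimise:
  fixes X I A :: ennreal
  assumes p: "0 < p" and fin: "I < top" "A < top"
    and le: "\<And>\<theta>. 0 < \<theta> \<Longrightarrow> X \<le> ennreal \<theta> * I + ennreal (\<theta> powr (- p)) * A"
  defines "q \<equiv> p / (p + 1)"
  shows "X \<le> 2 * (I epowr q * A epowr (1 - q))"
proof -
  obtain i a where i: "I = ennreal i" "0 \<le> i" and a: "A = ennreal a" "0 \<le> a"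
    using fin by (cases I; cases A) auto
  have q: "0 < q" "0 < 1 - q" and q': "1 - q = 1 / (p + 1)"
    using p by (auto simp: q_def field_simps)
  have "X \<le> ennreal (1 * i + 1 powr (- p) * a)"
    using le[of 1] i a by simp
  then obtain x where x: "X = ennreal x" "0 \<le> x"
    by (cases X) (auto simp: top_unique)
  have le': "x \<le> \<theta> * i + \<theta> powr (- p) * a" if "0 < \<theta>" for \<theta>
    using le[OF that] that i a x by (simp flip: ennreal_mult ennreal_plus)
  have eps: "x \<le> 2 * ((i + e) powr q * (a + e) powr (1 - q))" if e: "0 < e" for e
  proof -
    define \<theta> where "\<theta> = ((a + e) / (i + e)) powr (1 - q)"
    have pos: "0 < a + e" "0 < i + e" using i a e by auto
    then have \<theta>: "0 < \<theta>" by (simp add: \<theta>_def)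
    have 1: "\<theta> * (i + e) = (i + e) powr q * (a + e) powr (1 - q)"
    proof -
      have "(i + e) powr q * (i + e) powr (1 - q) = i + e" using pos by (simp flip: powr_add)
      then have "\<theta> * (i + e) = (a + e) powr (1 - q) / (i + e) powr (1 - q) * ((i + e) powr q * (i + e) powr (1 - q))"
        using pos by (simp add: \<theta>_def powr_divide)
      then show ?thesis using pos by (simp add: field_simps)
    qed
    have 2: "\<theta> powr (- p) * (a + e) = (i + e) powr q * (a + e) powr (1 - q)"
    proof -
      have "(1 - q) * p = (1 / (p + 1)) * p" by (simp only: q')
      then have qp: "(1 - q) * p = q" by (simp add: q_def)
      have "\<theta> powr (- p) = ((a + e) / (i + e)) powr (- q)"
        unfolding \<theta>_def powr_powr using qp by simp
      also have "\<dots> = (i + e) powr q * (a + e) powr (- q)"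
        using pos by (simp add: powr_divide powr_minus field_simps)
      finally have "\<theta> powr (- p) * (a + e) = (i + e) powr q * ((a + e) powr (- q) * (a + e) powr 1)"
        using pos by simp
      then show ?thesis by (simp only: powr_add[symmetric]) simp
    qed
    have "x \<le> \<theta> * i + \<theta> powr (- p) * a" by (rule le'[OF \<theta>])
    also have "\<dots> \<le> \<theta> * (i + e) + \<theta> powr (- p) * (a + e)"
      using \<theta> e by (intro add_mono mult_left_mono) auto
    finally show ?thesis using 1 2 by simp
  qed
  \<comment> \<open>Both exponents are positive, so the power functions are continuous at 0 from the
    right and the enlargement can be removed.\<close>
  have "((\<lambda>e. 2 * ((i + e) powr q * (a + e) powr (1 - q))) \<longlongrightarrow> 2 * ((i + 0) powr q * (a + 0) powr (1 - q))) (at_right 0)"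
    by (intro tendsto_intros tendsto_powr')
      (use q i a in \<open>auto intro!: eventually_at_rightI[of 0 1] tendsto_intros tendsto_eq_intros\<close>)
  then have "x \<le> 2 * ((i + 0) powr q * (a + 0) powr (1 - q))"
    by (rule tendsto_lowerbound) (auto intro!: eventually_at_rightI[of 0 1] eps)
  then have "ennreal x \<le> ennreal (2 * (i powr q * a powr (1 - q)))"
    by (intro ennreal_leI) simp
  then show ?thesis
    using x i a q by (simp add: ennreal_epowr ennreal_mult)
qed

text \<open>Cancelling X^q leaves X^(1/(p+1)) <= E. The cancellation is the reason for demanding
  that \<open>X\<close> be finite.\<close>

lemma epowr_self_improve:
  fixes X E :: ennreal
  assumes p: "0 < p" and fin: "X < top" and le: "X \<le> E * X epowr (p / (p + 1))"
  shows "X \<le> E epowr (p + 1)"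
proof (cases "X = 0 \<or> E = top")
  case False
  then obtain x e where x: "X = ennreal x" "0 < x" and e: "E = ennreal e" "0 \<le> e"
    using fin by (cases X; cases E) auto
  let ?q = "p / (p + 1)"
  have "x \<le> e * x powr ?q"
    using le x e p by (simp add: ennreal_epowr flip: ennreal_mult)
  moreover have "x = x powr (1 / (p + 1)) * x powr ?q"
  proof -
    have "1 / (p + 1) + p / (p + 1) = 1" using p by (simp flip: add_divide_distrib)
    then show ?thesis using x by (simp flip: powr_add)
  qed
  ultimately have "x powr (1 / (p + 1)) * x powr ?q \<le> e * x powr ?q" by simp
  then have "x powr (1 / (p + 1)) \<le> e"
    by (rule mult_right_le_imp_le) (use x in simp)
  then have "(x powr (1 / (p + 1))) powr (p + 1) \<le> e powr (p + 1)"
    using p by (intro powr_mono2) auto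
  then have "x \<le> e powr (p + 1)" using x p by (simp add: powr_powr)
  then show ?thesis using x e p by (simp add: ennreal_epowr ennreal_leI)
qed (use p in auto)

text \<open>Test functions can only reach values strictly below an essential supremum, and the sums
  tested must be finite. Half of the value cut off at m is such a choice on the indices where
  \<open>X\<close> does not vanish; the factor 2 pays for the halving, and the cutoffs are removed
  by monotone limits.\<close>

lemma suminf_le_twice_if_strict_lower:
  fixes A X :: "nat \<Rightarrow> ennreal"
  assumes le: "\<And>I x. finite I \<Longrightarrow> (\<And>k. k \<in> I \<Longrightarrow> 0 < x k \<and> x k < X k) \<Longrightarrow> (\<Sum>k\<in>I. A k * x k) \<le> B"
  shows "(\<Sum>k. A k * X k) \<le> 2 * B"
proof -
  have trunc: "(\<Sum>k<n. A k * min (X k) (of_nat m)) \<le> 2 * B" for n m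
  proof (cases "m = 0")
    case False
    define I where "I = {k. k < n \<and> X k \<noteq> 0}"
    define x where "x k = min (X k) (of_nat m) / 2" for k
    have "0 < x k \<and> x k < X k" if "k \<in> I" for k
    proof -
      let ?y = "min (X k) (of_nat m)"
      have "0 < X k" using that unfolding I_def by (metis (mono_tags) mem_Collect_eq not_gr_zero)
      moreover have "0 < (of_nat m :: ennreal)" using False by simp
      ultimately have y: "0 < ?y" by (simp add: min_less_iff_conj min_def)
      have "?y \<le> of_nat m" by (rule min.cobounded2)
      also have "\<dots> < top" by (rule of_nat_less_top)
      finally have "?y < top" .
      then obtain s where s: "?y = ennreal s" "0 < s" using y by (cases ?y) auto
      then have "x k = ennreal (s / 2)" by (simp add: x_def ennreal_divide_numeral)
      moreover have "x k < ?y" unfolding s calculation using s(2) by (intro ennreal_lessI) auto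
      ultimately show ?thesis using s(2) less_le_trans[OF _ min.cobounded1] by simp
    qed
    then have "(\<Sum>k\<in>I. A k * x k) \<le> B" by (intro le) (auto simp: I_def)
    moreover have "(\<Sum>k<n. A k * min (X k) (of_nat m)) = (\<Sum>k\<in>I. A k * min (X k) (of_nat m))"
      by (intro sum.mono_neutral_right) (auto simp: I_def)
    moreover have "\<dots> = (\<Sum>k\<in>I. 2 * (A k * x k))"
    proof (intro sum.cong refl)
      fix k
      have "2 * x k = min (X k) (of_nat m)" by (simp add: x_def mult_2 ennreal_half_add)
      then show "A k * min (X k) (of_nat m) = 2 * (A k * x k)" by (simp add: mult.left_commute[of 2])
    qed
    ultimately show ?thesis by (simp add: mult_left_mono flip: sum_distrib_left)
  qed simp
  have min_SUP: "(SUP m. min x (of_nat m)) = x" for x :: ennreal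
  proof (cases "x = top")
    case True then show ?thesis by (simp add: ennreal_SUP_of_nat_eq_top)
  next
    case False
    then obtain m where "x \<le> of_nat m"
      using ennreal_Ex_less_of_nat[of x] by (auto simp: less_top intro: less_imp_le)
    then show ?thesis by (intro antisym SUP_least) (auto intro!: SUP_upper2[of m])
  qed
  have "(\<Sum>k<n. A k * X k) \<le> 2 * B" for n
  proof -
    have "(\<Sum>k<n. A k * X k) = (\<Sum>k<n. SUP m. A k * min (X k) (of_nat m))"
      by (simp add: SUP_mult_left_ennreal[symmetric] min_SUP)
    also have "\<dots> = (SUP m. \<Sum>k<n. A k * min (X k) (of_nat m))"
    proof (rule ennreal_SUP_sum[symmetric])
      show "incseq (\<lambda>m. A k * min (X k) (of_nat m))" for k
        by (intro incseq_SucI mult_left_mono min.mono) (auto simp: add_increasing)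
    qed
    also have "\<dots> \<le> 2 * B" by (intro SUP_least trunc)
    finally show ?thesis .
  qed
  then show ?thesis by (intro suminf_le_const) auto
qed

text \<open>The induction carries a second copy of the last term. By the decay of \<omega> and the
  recursion, twice the next term is at most that copy plus the new contribution of \<open>s\<close>.
  No subtraction occurs, so infinite values do no harm.\<close>

lemma weighted_recursion_bound:
  fixes \<omega> x s :: "nat \<Rightarrow> ennreal"
  assumes x0: "x 0 \<le> c * s 0" and xS: "\<And>n. x (Suc n) \<le> c * (x n + s (Suc n))"
    and \<omega>: "\<And>n. 2 * c * \<omega> (Suc n) \<le> \<omega> n"
  shows "(\<Sum>n. \<omega> n * x n) \<le> 2 * c * (\<Sum>n. \<omega> n * s n)"
proof -
  have *: "(\<Sum>j\<le>n. \<omega> j * x j) + \<omega> n * x n \<le> 2 * c * (\<Sum>j\<le>n. \<omega> j * s j)" for n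
  proof (induction n)
    case 0
    have "\<omega> 0 * x 0 \<le> \<omega> 0 * (c * s 0)" by (intro mult_left_mono x0) simp
    then have "\<omega> 0 * x 0 + \<omega> 0 * x 0 \<le> \<omega> 0 * (c * s 0) + \<omega> 0 * (c * s 0)" by (intro add_mono)
    also have "\<dots> = 2 * c * (\<omega> 0 * s 0)" by (simp add: mult_ac flip: mult_2)
    finally show ?case by (simp flip: mult_2)
  next
    case (Suc n)
    have "\<omega> (Suc n) * x (Suc n) \<le> \<omega> (Suc n) * (c * (x n + s (Suc n)))"
      by (intro mult_left_mono xS) simp
    then have "2 * (\<omega> (Suc n) * x (Suc n)) \<le> 2 * (\<omega> (Suc n) * (c * (x n + s (Suc n))))"
      by (rule mult_left_mono) simp
    also have "\<dots> = (2 * c * \<omega> (Suc n)) * x n + 2 * c * (\<omega> (Suc n) * s (Suc n))"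
      by (simp add: distrib_left mult_ac)
    also have "\<dots> \<le> \<omega> n * x n + 2 * c * (\<omega> (Suc n) * s (Suc n))"
      by (intro add_mono mult_right_mono \<omega>) auto
    finally have "(\<Sum>j\<le>n. \<omega> j * x j) + 2 * (\<omega> (Suc n) * x (Suc n))
        \<le> ((\<Sum>j\<le>n. \<omega> j * x j) + \<omega> n * x n) + 2 * c * (\<omega> (Suc n) * s (Suc n))"
      by (simp add: add.assoc add_left_mono)
    also have "\<dots> \<le> 2 * c * (\<Sum>j\<le>n. \<omega> j * s j) + 2 * c * (\<omega> (Suc n) * s (Suc n))"
      by (intro add_right_mono Suc)
    finally show ?case by (simp add: add.assoc distrib_left flip: mult_2)
  qed
  show ?thesis
  proof (rule suminf_le_const)
    fix n
    have "(\<Sum>j<n. \<omega> j * x j) \<le> (\<Sum>j\<le>n. \<omega> j * x j) + \<omega> n * x n"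
      by (simp add: lessThan_Suc_atMost[symmetric] add_increasing2 flip: lessThan_Suc_atMost)
    also have "\<dots> \<le> 2 * c * (\<Sum>j\<le>n. \<omega> j * s j)" by (rule *)
    also have "\<dots> \<le> 2 * c * (\<Sum>n. \<omega> n * s n)"
      by (intro mult_left_mono sum_le_suminf) auto
    finally show "(\<Sum>j<n. \<omega> j * x j) \<le> 2 * c * (\<Sum>n. \<omega> n * s n)" .
  qed simp
qed

lemma mult_esssup_le:
  fixes h :: "'a \<Rightarrow> ennreal"
  assumes [measurable]: "h \<in> borel_measurable M" and "a < top" and le: "AE x in M. a * h x \<le> X"
  shows "a * esssup M h \<le> X"
proof (cases "a = 0")
  case False
  have "AE x in M. h x \<le> X / a"
    using le
  proof eventually_elim
    case (elim x)
    have "h x = a * h x / a"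
      using False assms(2) mult_divide_eq_ennreal[of a "h x"] by (auto simp: mult.commute)
    also have "\<dots> \<le> X / a" by (intro divide_right_mono_ennreal elim)
    finally show ?case .
  qed
  then have "esssup M h \<le> X / a" by (rule esssup_I[rotated]) simp
  then have "a * esssup M h \<le> a * (X / a)" by (intro mult_left_mono) auto
  also have "\<dots> = X" using False assms(2) by (simp add: ennreal_times_divide mult_divide_eq_ennreal mult.commute)
  finally show ?thesis .
qed simp

lemma tail_sum_Suc:
  fixes B :: "nat \<Rightarrow> ennreal"
  shows "(\<Sum>i. B (i + k)) = B k + (\<Sum>i. B (i + Suc k))"
  using suminf_offset[of "\<lambda>i. B (i + k)" 1] by simp

lemma tail_sum_split:
  fixes B :: "nat \<Rightarrow> ennreal"
  assumes "k \<le> m"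
  shows "(\<Sum>i. B (i + k)) = (\<Sum>i\<in>{k..<m}. B i) + (\<Sum>i. B (i + m))"
proof -
  obtain j where j: "m = k + j" using assms le_Suc_ex by blast
  have "(\<Sum>i. B (i + k)) = (\<Sum>i<j. B (i + k)) + (\<Sum>i. B (i + j + k))"
    by (subst suminf_offset[of _ j]) (simp_all add: add.commute)
  also have "(\<Sum>i<j. B (i + k)) = (\<Sum>i\<in>{k..<m}. B i)"
    using sum.shift_bounds_nat_ivl[of B 0 k j] by (simp add: j lessThan_atLeast0 add.commute)
  finally show ?thesis by (simp add: j add_ac)
qed

lemma tail_sum_antimono:
  fixes B :: "nat \<Rightarrow> ennreal"
  assumes "k \<le> m"
  shows "(\<Sum>i. B (i + m)) \<le> (\<Sum>i. B (i + k))"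
  using tail_sum_split[OF assms, of B] by (simp add: add_increasing)

text \<open>Both sides distribute the weight of \<open>k\<close> over later indices \<open>i\<close>. Only those \<open>i\<close> are used at
  which the tail has not yet dropped below half of its value at \<open>k + 1\<close>; this keeps the total weight
  that each \<open>i\<close> receives bounded.\<close>

lemma discrete_lower_bound:
  fixes B x :: "nat \<Rightarrow> ennreal"
  assumes p: "0 < p" and I: "finite I"
  defines "\<beta> \<equiv> \<lambda>k. \<Sum>i. B (i + k)"
  defines "b \<equiv> \<lambda>k. min (B k) (\<beta> (Suc k))"
  defines "H \<equiv> \<lambda>i. \<Sum>k\<in>I \<inter> {..<i}. b k * \<beta> (Suc k) epowr p * x k epowr (1 + 1 / p)"
  assumes fin: "\<beta> 0 < top"
  shows "(\<Sum>k\<in>I. b k * \<beta> (Suc k) epowr p * x k) \<le> 10 * (\<Sum>i. B i * H i epowr (p / (p + 1)))"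
proof -
  let ?q = "p / (p + 1)"
  have q: "0 < ?q" using p by simp
  have \<beta>_eq: "\<beta> k = (\<Sum>i. B (i + k))" for k by (simp add: \<beta>_def)
  have anti: "\<beta> m \<le> \<beta> k" if "k \<le> m" for k m
    unfolding \<beta>_def by (rule tail_sum_antimono[OF that])
  have \<beta>_fin: "\<beta> k < top" for k using anti[of 0 k] fin by (simp add: le_less_trans)
  have \<beta>_Suc: "\<beta> k = B k + \<beta> (Suc k)" for k unfolding \<beta>_def by (rule tail_sum_Suc)
  define F where "F i = {k \<in> I. k < i \<and> \<beta> (Suc k) \<le> 2 * \<beta> i}" for i
  have finF: "finite (F i)" for i using I by (simp add: F_def)
  \<comment> \<open>Chosen so that \<open>w k * \<Psi> k\<close> is the summand of \<open>H\<close>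
    and, with q = p/(p+1), the product of \<open>w k\<close>, the q-th power of
    \<open>\<Psi> k\<close> and \<open>\<beta> (Suc k)\<close> is the summand to be bounded. What
    remains is an inequality of Jensen type with weights \<open>w\<close>.\<close>
  define w where "w k = b k * inverse (\<beta> (Suc k))" for k
  define \<Psi> where "\<Psi> k = \<beta> (Suc k) epowr (p + 1) * x k epowr (1 + 1 / p)" for k
  have \<Psi>_q: "\<Psi> k epowr ?q = \<beta> (Suc k) epowr p * x k" for k
  proof -
    have "0 < p + p * p" using p by (intro add_pos_pos mult_pos_pos)
    then have "(p + 1) * ?q = p" "(1 + 1 / p) * ?q = 1" using p by (auto simp: field_simps)
    then show ?thesis using p q by (simp add: \<Psi>_def epowr_mult epowr_epowr)
  qed
  have b_le: "b k \<le> \<beta> (Suc k)" "b k \<le> B k" for k by (auto simp: b_def)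
  have w_\<beta>: "w k * \<beta> (Suc k) = b k" for k
  proof (cases "\<beta> (Suc k) = 0")
    case True
    then show ?thesis using b_le(1)[of k] by (simp add: w_def)
  next
    case False
    then have "inverse (\<beta> (Suc k)) * \<beta> (Suc k) = 1"
      using \<beta>_fin[of "Suc k"] by (metis divide_ennreal_def ennreal_divide_self mult.commute)
    then show ?thesis by (simp add: w_def mult.assoc)
  qed
  \<comment> \<open>If the tail falls below half of its value at some first index m, then the terms
    before m carry at least half of the mass; if it never does, all later indices qualify.\<close>
  have spread: "\<beta> (Suc k) \<le> 2 * (\<Sum>i. B i * indicator {i. k < i \<and> \<beta> (Suc k) \<le> 2 * \<beta> i} i)" for k
  proof (cases "\<forall>i>k. \<beta> (Suc k) \<le> 2 * \<beta> i")
    case True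
    have "\<beta> (Suc k) = (\<Sum>i. B (i + Suc k) * indicator {i. k < i \<and> \<beta> (Suc k) \<le> 2 * \<beta> i} (i + Suc k))"
    proof -
      have *: "B (i + Suc k) * indicator {i. k < i \<and> \<beta> (Suc k) \<le> 2 * \<beta> i} (i + Suc k) = B (i + Suc k)" for i
        using True by (auto simp: indicator_def)
      show ?thesis unfolding * by (rule \<beta>_eq)
    qed
    also have "\<dots> \<le> (\<Sum>i. B (i + 0) * indicator {i. k < i \<and> \<beta> (Suc k) \<le> 2 * \<beta> i} (i + 0))"
      by (rule tail_sum_antimono[of 0 "Suc k" "\<lambda>i. B i * indicator {i. k < i \<and> \<beta> (Suc k) \<le> 2 * \<beta> i} i"]) simp
    also have "\<dots> \<le> 2 * \<dots>" by (simp add: mult_2 add_increasing)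
    finally show ?thesis by simp
  next
    case False
    define m where "m = (LEAST i. i > k \<and> \<not> \<beta> (Suc k) \<le> 2 * \<beta> i)"
    from False have "\<exists>i. i > k \<and> \<not> \<beta> (Suc k) \<le> 2 * \<beta> i" by auto
    from LeastI_ex[OF this] have m: "k < m" "2 * \<beta> m < \<beta> (Suc k)" by (auto simp: m_def not_le)
    have below: "\<beta> (Suc k) \<le> 2 * \<beta> i" if "k < i" "i < m" for i
      using not_less_Least[OF that(2)[unfolded m_def]] that(1) by auto
    let ?s = "\<Sum>i\<in>{Suc k..<m}. B i"
    have split: "\<beta> (Suc k) = ?s + \<beta> m"
      unfolding \<beta>_def using m by (intro tail_sum_split) simp
    have "\<beta> m \<le> ?s"
    proof (rule ccontr)
      assume "\<not> \<beta> m \<le> ?s"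
      then have "?s + \<beta> m \<le> \<beta> m + \<beta> m" by (intro add_right_mono) simp
      with m(2) have "2 * \<beta> m < 2 * \<beta> m" unfolding split by (metis less_le_trans mult_2)
      then show False by simp
    qed
    then have "\<beta> (Suc k) \<le> 2 * ?s" unfolding split by (simp add: mult_2 add_left_mono)
    also have "?s = (\<Sum>i\<in>{Suc k..<m}. B i * indicator {i. k < i \<and> \<beta> (Suc k) \<le> 2 * \<beta> i} i)"
      using below by (intro sum.cong) (auto simp: indicator_def)
    also have "\<dots> \<le> (\<Sum>i. B i * indicator {i. k < i \<and> \<beta> (Suc k) \<le> 2 * \<beta> i} i)"
      by (intro sum_le_suminf) auto
    finally show ?thesis by (simp add: mult_left_mono)
  qed
  \<comment> \<open>Here the truncation in \<open>b\<close> is used. For the least index j of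
    \<open>F i\<close>, \<open>b j\<close> is at most \<beta>(j+1), and the other terms, bounded by
    \<open>B\<close>, add up to at most \<beta>(j+1) again. Membership of j gives \<beta>(j+1) <= 2
    \<beta>(i), hence 4. An untruncated \<open>B j\<close> could exceed the later tail by any
    factor.\<close>
  have mass: "(\<Sum>k\<in>F i. w k) \<le> 4" for i
  proof (cases "F i = {} \<or> \<beta> i = 0")
    case True
    then have "(\<Sum>k\<in>F i. w k) = 0"
    proof
      assume "\<beta> i = 0"
      moreover have "b k = 0" if "\<beta> (Suc k) = 0" for k
        using b_le(1)[of k] that by simp
      ultimately show ?thesis by (intro sum.neutral) (auto simp: F_def w_def)
    qed simp
    then show ?thesis by simp
  next
    case False
    define j where "j = Min (F i)"
    have j: "j \<in> F i" "\<And>k. k \<in> F i \<Longrightarrow> j \<le> k" using False finF by (auto simp: j_def)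
    have "(\<Sum>k\<in>F i. b k) = b j + (\<Sum>k\<in>F i - {j}. b k)"
      using j finF by (simp add: sum.remove)
    also have "(\<Sum>k\<in>F i - {j}. b k) \<le> (\<Sum>k\<in>{Suc j..<i}. B k)"
    proof (rule order_trans[OF sum_mono[of _ b B] sum_mono2])
      show "F i - {j} \<subseteq> {Suc j..<i}"
        using j(2) by (force simp: F_def Suc_le_eq)
    qed (auto intro: b_le)
    also have "\<dots> \<le> \<beta> (Suc j)"
      using tail_sum_split[of "Suc j" i B] j(1) unfolding \<beta>_def F_def by simp
    also have "b j \<le> \<beta> (Suc j)" by (rule b_le)
    finally have "(\<Sum>k\<in>F i. b k) \<le> 2 * \<beta> (Suc j)" by (simp add: mult_2 add_mono)
    also have "\<dots> \<le> 2 * (2 * \<beta> i)" using j(1) by (intro mult_left_mono) (auto simp: F_def)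
    finally have le: "(\<Sum>k\<in>F i. b k) \<le> 4 * \<beta> i" by (simp add: mult.assoc[symmetric])
    have "(\<Sum>k\<in>F i. w k) \<le> (\<Sum>k\<in>F i. b k * inverse (\<beta> i))"
      unfolding w_def by (intro sum_mono mult_left_mono ennreal_inverse_antimono anti) (auto simp: F_def)
    also have "\<dots> = (\<Sum>k\<in>F i. b k) * inverse (\<beta> i)" by (simp add: sum_distrib_right)
    also have "\<dots> \<le> 4 * (\<beta> i * inverse (\<beta> i))"
      using mult_right_mono[OF le, of "inverse (\<beta> i)"] by (simp add: mult.assoc)
    also have "\<dots> \<le> 4 * 1"
      using ennreal_inverse_mult_le[of "\<beta> i"] by (intro mult_left_mono) (auto simp: mult.commute)
    finally show ?thesis by simp
  qed
  have local: "(\<Sum>k\<in>F i. w k * \<Psi> k epowr ?q) \<le> 5 * H i epowr ?q" for i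
  proof -
    have w\<Psi>: "w k * \<Psi> k = b k * \<beta> (Suc k) epowr p * x k epowr (1 + 1 / p)" for k
    proof -
      have "w k * \<Psi> k = (w k * \<beta> (Suc k)) * \<beta> (Suc k) epowr p * x k epowr (1 + 1 / p)"
        using p by (simp add: \<Psi>_def epowr_Suc mult_ac)
      then show ?thesis by (simp add: w_\<beta>)
    qed
    have H_ge: "(\<Sum>k\<in>F i. w k * \<Psi> k) \<le> H i"
      unfolding H_def w\<Psi> using I by (intro sum_mono2) (auto simp: F_def)
    consider "H i = 0" | "H i = top" | "0 < H i" "H i < top"
      by (metis less_top not_gr_zero)
    then show ?thesis
    proof cases
      case 1
      then have "w k * \<Psi> k = 0" if "k \<in> F i" for k
        using H_ge finF that by (metis (no_types, lifting) le_zero_eq sum_eq_0_iff)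
      then have "(\<Sum>k\<in>F i. w k * \<Psi> k epowr ?q) = 0"
        using q by (intro sum.neutral) (metis mult_eq_0_iff epowr_eq_0_iff)
      then show ?thesis by simp
    next
      case 2
      then show ?thesis using q by (simp add: ennreal_mult_top)
    next
      case 3
      \<comment> \<open>The elementary bound y^q <= 1 + y for y = \<Psi>(k)/H(i) stands in for
        Jensen's inequality. Summed against \<open>w\<close> it gives 4 + 1.\<close>
      have *: "\<Psi> k epowr ?q \<le> H i epowr ?q * (1 + \<Psi> k * inverse (H i))" for k
      proof (cases "\<Psi> k \<le> H i")
        case True
        then have "\<Psi> k epowr ?q \<le> H i epowr ?q * 1" using q by (simp add: epowr_mono)
        also have "\<dots> \<le> H i epowr ?q * (1 + \<Psi> k * inverse (H i))" by (intro mult_left_mono) auto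
        finally show ?thesis .
      next
        case False
        define y where "y = \<Psi> k * inverse (H i)"
        have "inverse (H i) * H i = 1" using 3
          by (metis divide_ennreal_def ennreal_divide_self less_irrefl mult.commute)
        then have y: "\<Psi> k = y * H i" by (simp add: y_def mult.assoc)
        have "1 \<le> y"
        proof (rule ccontr)
          assume "\<not> 1 \<le> y"
          then have "y * H i \<le> 1 * H i" by (intro mult_right_mono) auto
          with False y show False by simp
        qed
        have "y epowr ?q \<le> y"
        proof -
          have "y epowr ?q * 1 \<le> y epowr ?q * y epowr (1 - ?q)"
            using epowr_mono[of "1 - ?q" 1 y] \<open>1 \<le> y\<close> p by (intro mult_left_mono) auto
          also have "\<dots> = y" using p by (simp flip: epowr_add)
          finally show ?thesis by simp
        qed
        then have "\<Psi> k epowr ?q \<le> H i epowr ?q * y"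
          unfolding y using q by (simp add: epowr_mult mult_left_mono mult.commute[of y] mult.commute[of "y epowr ?q"])
        also have "\<dots> \<le> H i epowr ?q * (1 + y)" by (intro mult_left_mono) auto
        finally show ?thesis by (simp add: y_def)
      qed
      have "(\<Sum>k\<in>F i. w k * \<Psi> k epowr ?q) \<le> (\<Sum>k\<in>F i. w k * (H i epowr ?q * (1 + \<Psi> k * inverse (H i))))"
        by (intro sum_mono mult_left_mono *) simp
      also have "\<dots> = H i epowr ?q * ((\<Sum>k\<in>F i. w k) + (\<Sum>k\<in>F i. w k * \<Psi> k) * inverse (H i))"
        by (simp add: sum_distrib_left sum_distrib_right sum.distrib distrib_left distrib_right mult_ac)
      also have "\<dots> \<le> H i epowr ?q * (4 + H i * inverse (H i))"
        by (intro mult_left_mono add_mono mult_right_mono mass H_ge) auto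
      also have "\<dots> \<le> H i epowr ?q * (4 + 1)"
        using ennreal_inverse_mult_le[of "H i"] by (intro mult_left_mono add_left_mono) (auto simp: mult.commute)
      finally show ?thesis by (simp add: mult.commute)
    qed
  qed
  have "(\<Sum>k\<in>I. b k * \<beta> (Suc k) epowr p * x k) = (\<Sum>k\<in>I. w k * \<Psi> k epowr ?q * \<beta> (Suc k))"
    by (simp add: \<Psi>_q w_\<beta>[symmetric] mult_ac)
  also have "\<dots> \<le> (\<Sum>k\<in>I. w k * \<Psi> k epowr ?q * (2 * (\<Sum>i. B i * indicator {i. k < i \<and> \<beta> (Suc k) \<le> 2 * \<beta> i} i)))"
    by (intro sum_mono mult_left_mono spread) simp
  also have "\<dots> = 2 * (\<Sum>k\<in>I. \<Sum>i. w k * \<Psi> k epowr ?q * (B i * indicator {i. k < i \<and> \<beta> (Suc k) \<le> 2 * \<beta> i} i))"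
    by (simp only: ennreal_suminf_cmult) (simp only: sum_distrib_left mult.left_commute[where b = 2])
  also have "\<dots> = 2 * (\<Sum>i. \<Sum>k\<in>I. w k * \<Psi> k epowr ?q * (B i * indicator {i. k < i \<and> \<beta> (Suc k) \<le> 2 * \<beta> i} i))"
    by (subst suminf_sum) auto
  also have "(\<lambda>i. \<Sum>k\<in>I. w k * \<Psi> k epowr ?q * (B i * indicator {i. k < i \<and> \<beta> (Suc k) \<le> 2 * \<beta> i} i))
      = (\<lambda>i. B i * (\<Sum>k\<in>F i. w k * \<Psi> k epowr ?q))"
  proof
    fix i
    have "(\<Sum>k\<in>I. w k * \<Psi> k epowr ?q * (B i * indicator {i. k < i \<and> \<beta> (Suc k) \<le> 2 * \<beta> i} i))
        = (\<Sum>k\<in>F i. w k * \<Psi> k epowr ?q * B i)"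
      using I by (intro sum.mono_neutral_cong_right) (auto simp: F_def indicator_def)
    then show "(\<Sum>k\<in>I. w k * \<Psi> k epowr ?q * (B i * indicator {i. k < i \<and> \<beta> (Suc k) \<le> 2 * \<beta> i} i))
        = B i * (\<Sum>k\<in>F i. w k * \<Psi> k epowr ?q)"
      by (simp add: sum_distrib_left mult_ac)
  qed
  also have "2 * (\<Sum>i. B i * (\<Sum>k\<in>F i. w k * \<Psi> k epowr ?q)) \<le> 2 * (\<Sum>i. B i * (5 * H i epowr ?q))"
    by (intro mult_left_mono suminf_le local) auto
  also have "\<dots> = 2 * (\<Sum>i. 5 * (B i * H i epowr ?q))"
    by (simp only: mult.left_commute)
  also have "\<dots> = 10 * (\<Sum>i. B i * H i epowr ?q)"
    unfolding ennreal_suminf_cmult by (simp add: mult.assoc[symmetric])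
  finally show ?thesis .
qed

section \<open>Testing the inequality on a geometric grid\<close>

context hardy_core
begin

text \<open>Without atoms the distribution function is continuous, and the tail vanishes at
  \<open>max 0 R\<close>, so the intermediate value theorem applies.\<close>

lemma tail_value_attained:
  assumes "0 < y" "y \<le> measure \<mu> {0<..}"
  shows "\<exists>s\<ge>0. measure \<mu> {s<..} = y"
proof -
  interpret finite_borel_measure \<mu> by standard simp
  have tail: "measure \<mu> {s<..} = measure \<mu> UNIV - cdf \<mu> s" for s
  proof -
    have "measure \<mu> (UNIV - {..s}) = measure \<mu> (space \<mu>) - measure \<mu> {..s}"
      using finite_measure_compl[of "{..s}"] by simp
    moreover have "UNIV - {..s} = {s<..}" by auto
    ultimately show ?thesis by (simp add: cdf_def)
  qed
  have cont: "isCont (\<lambda>s. measure \<mu> {s<..}) s" for s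
    unfolding tail using atomless by (intro continuous_intros) (auto simp: isCont_cdf measure_def)
  have "emeasure \<mu> {max 0 R<..} \<le> emeasure \<mu> {R..}" by (intro emeasure_mono) auto
  then have "emeasure \<mu> {max 0 R<..} = 0" using mu_beyond by simp
  then have R0: "measure \<mu> {max 0 R<..} = 0" by (simp add: measure_def)
  have "\<exists>s. 0 \<le> s \<and> s \<le> max 0 R \<and> measure \<mu> {s<..} = y"
    by (rule IVT2) (use assms R0 cont in auto)
  then show ?thesis by blast
qed

lemma W_eq_measure: "W t = ennreal (measure \<mu> {t<..})"
  by (simp add: W_def emeasure_eq_measure)

lemma grid_exists:
  assumes a: "1 < (a :: real)" and W0: "0 < W 0"
  shows "\<exists>t :: nat \<Rightarrow> real. t 0 = 0 \<and> strict_mono t \<and> (\<forall>k. 0 < W (t k)) \<and> (\<forall>k. W (t k) = ennreal a * W (t (Suc k)))"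
proof -
  define m where "m = measure \<mu> {0<..}"
  have m: "0 < m" using W0 by (simp add: W_eq_measure m_def)
  have "\<exists>s\<ge>0. measure \<mu> {s<..} = m / a ^ k" for k
  proof (rule tail_value_attained)
    show "0 < m / a ^ k" using m a by simp
    have "m \<le> m * a ^ k" using m a by (simp add: one_le_power)
    then show "m / a ^ k \<le> measure \<mu> {0<..}" using a by (simp add: m_def divide_le_eq)
  qed
  then obtain t' where t': "\<And>k. 0 \<le> t' k" "\<And>k. measure \<mu> {t' k<..} = m / a ^ k"
    by metis
  \<comment> \<open>The point 0 also realises the level of index 0, and the grid has to start there
    in order to cover the support from the left.\<close>
  define t where "t k = (if k = 0 then 0 else t' k)" for k :: nat
  have t: "measure \<mu> {t k<..} = m / a ^ k" for k
    using t' by (cases k) (auto simp: t_def m_def)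
  have "strict_mono t"
  proof (rule strict_mono_Suc_iff[THEN iffD2], rule allI)
    fix k
    have "measure \<mu> {t (Suc k)<..} < measure \<mu> {t k<..}"
      unfolding t using m a by (simp add: divide_strict_left_mono)
    moreover have "measure \<mu> {t k<..} \<le> measure \<mu> {t (Suc k)<..}" if "t (Suc k) \<le> t k"
      using that by (intro finite_measure_mono) auto
    ultimately show "t k < t (Suc k)" by force
  qed
  moreover have "0 < W (t k)" "W (t k) = ennreal a * W (t (Suc k))" for k
    using m a by (auto simp: W_eq_measure t simp flip: ennreal_mult)
  ultimately show ?thesis by (intro exI[of _ t]) (auto simp: t_def)
qed

end

text \<open>The ratio a = 2 c makes 2 c \<omega>(k+1) equal to \<omega>(k), the decay that
  \<open>weighted_recursion_bound\<close> asks for against the constant of the triangle inequality.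
  As a >= 2, each grid interval also carries at least the mass beyond it. The constant
  \<open>D\<close> stands for C^q.\<close>

locale hardy_grid = hardy_core +
  fixes a :: real and t :: "nat \<Rightarrow> real" and D :: ennreal
  assumes a_eq: "a = 2 * c"
    and t_0: "t 0 = 0" and t_strict: "strict_mono t"
    and W_t_pos: "0 < W (t k)" and W_t: "W (t k) = ennreal a * W (t (Suc k))"
    and D_finite: "D < top"
    and hardy: "f \<in> borel_measurable L \<Longrightarrow> (\<integral>\<^sup>+ s. T f s epowr q \<partial>\<mu>) \<le> D * (\<integral>\<^sup>+ x. f x * v x \<partial>L) epowr q"
begin

lemma a_ge_2: "2 \<le> a" using c_ge_1 by (simp add: a_eq)

abbreviation \<omega> :: "nat \<Rightarrow> ennreal" where "\<omega> k \<equiv> W (t k)"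
abbreviation \<Delta> :: "nat \<Rightarrow> real set" where "\<Delta> k \<equiv> {t k<..t (Suc k)}"

lemma t_less: "j < k \<Longrightarrow> t j < t k" using t_strict by (simp add: strict_mono_def)
lemma t_le: "j \<le> k \<Longrightarrow> t j \<le> t k" using t_strict by (simp add: strict_mono_less_eq)
lemma t_nonneg: "0 \<le> t k" using t_le[of 0 k] t_0 by simp

lemma disjoint_\<Delta>: "disjoint_family \<Delta>"
unfolding disjoint_family_on_def
proof (intro ballI impI)
  fix i j :: nat assume "i \<noteq> j"
  then have "Suc i \<le> j \<or> Suc j \<le> i" by auto
  then have "t (Suc i) \<le> t j \<or> t (Suc j) \<le> t i" using t_le by blast
  then show "\<Delta> i \<inter> \<Delta> j = {}" by auto
qed

lemma mu_\<Delta>: "emeasure \<mu> (\<Delta> k) \<le> \<omega> k" "\<omega> (Suc k) \<le> emeasure \<mu> (\<Delta> k)"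
proof -
  show "emeasure \<mu> (\<Delta> k) \<le> \<omega> k" unfolding W_def by (intro emeasure_mono) auto
  have "\<Delta> k \<union> {t (Suc k)<..} = {t k<..}" using t_less[of k "Suc k"] by auto
  moreover have "emeasure \<mu> (\<Delta> k) + emeasure \<mu> {t (Suc k)<..} = emeasure \<mu> (\<Delta> k \<union> {t (Suc k)<..})"
    by (rule plus_emeasure) auto
  ultimately have "\<omega> k = emeasure \<mu> (\<Delta> k) + \<omega> (Suc k)" by (simp add: W_def)
  moreover have "2 * \<omega> (Suc k) \<le> \<omega> k"
    unfolding W_t[of k] using ennreal_leI[OF a_ge_2] by (intro mult_right_mono) auto
  ultimately have "\<omega> (Suc k) + \<omega> (Suc k) \<le> emeasure \<mu> (\<Delta> k) + \<omega> (Suc k)" by (simp add: mult_2)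
  then show "\<omega> (Suc k) \<le> emeasure \<mu> (\<Delta> k)"
    using W_finite[of "t (Suc k)"] by (auto simp: ennreal_add_left_cancel_le add.commute)
qed

text \<open>The grid need not exhaust the half-line. Since \<omega>(k) tends to 0, every point with
  W(s) > 0 lies below some grid point, and the remaining points form a null set.\<close>

lemma AE_covered: "AE s in \<mu>. \<exists>k. s \<in> \<Delta> k"
  using AE_mu_pos AE_mu_W_pos
proof eventually_elim
  case (elim s)
  have pow: "\<omega> 0 = ennreal (a ^ k) * \<omega> k" for k
  proof (induction k)
    case (Suc k)
    then show ?case unfolding W_t[of k] using a_ge_2 by (simp add: ennreal_mult mult_ac)
  qed simp
  have "\<exists>k. \<omega> k < W s"
  proof (rule ccontr)
    assume neg: "\<not> ?thesis"
    obtain x y where x: "\<omega> 0 = ennreal x" "0 \<le> x" and y: "W s = ennreal y" "0 < y"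
      using W_finite[of "t 0"] W_finite[of s] elim by (cases "\<omega> 0"; cases "W s") auto
    obtain k where "x / y < a ^ k" using real_arch_pow[of a "x / y"] a_ge_2 by auto
    then have "x < a ^ k * y" using y by (simp add: field_simps)
    moreover have "ennreal (a ^ k) * W s \<le> \<omega> 0"
      unfolding pow[of k] using neg by (intro mult_left_mono) (auto simp: not_less)
    then have "a ^ k * y \<le> x" using x y a_ge_2 by (simp flip: ennreal_mult)
    ultimately show False by simp
  qed
  then obtain k where k: "\<omega> k < W s" ..
  have "s \<le> t k"
  proof (rule ccontr)
    assume "\<not> s \<le> t k"
    then have "W s \<le> \<omega> k" using antimonoD[OF W_antimono, of "t k" s] by simp
    with k show False by simp
  qed
  then have ex: "\<exists>k. s \<le> t k" ..
  define j where "j = (LEAST k. s \<le> t k)"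
  have j: "s \<le> t j" unfolding j_def by (rule LeastI_ex[OF ex])
  then have "j \<noteq> 0" using elim t_0 by (metis not_le)
  then obtain i where i: "j = Suc i" by (cases j) auto
  then have "\<not> s \<le> t i" using not_less_Least[of i "\<lambda>k. s \<le> t k"] by (simp add: j_def)
  then have "s \<in> \<Delta> i" using i j by simp
  then show ?case ..
qed

lemma nn_integral_le_grid:
  assumes "\<And>k s. s \<in> \<Delta> k \<Longrightarrow> h s \<le> b k"
  shows "(\<integral>\<^sup>+ s. h s \<partial>\<mu>) \<le> (\<Sum>k. b k * \<omega> k)"
proof -
  have "(\<integral>\<^sup>+ s. h s \<partial>\<mu>) \<le> (\<integral>\<^sup>+ s. (\<Sum>k. b k * indicator (\<Delta> k) s) \<partial>\<mu>)"
  proof (rule nn_integral_mono_AE, rule eventually_mono[OF AE_covered])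
    fix s assume "\<exists>k. s \<in> \<Delta> k"
    then obtain k where "s \<in> \<Delta> k" ..
    then show "h s \<le> (\<Sum>k. b k * indicator (\<Delta> k) s)"
      using suminf_cmult_indicator[OF disjoint_\<Delta>, of s k b] assms by simp
  qed
  also have "\<dots> = (\<Sum>k. b k * emeasure \<mu> (\<Delta> k))"
    by (subst nn_integral_suminf) (auto simp: nn_integral_cmult_indicator)
  also have "\<dots> \<le> (\<Sum>k. b k * \<omega> k)"
    by (intro suminf_le mult_left_mono mu_\<Delta>) auto
  finally show ?thesis .
qed

lemma grid_le_nn_integral:
  assumes "\<And>k s. s \<in> \<Delta> k \<Longrightarrow> d k \<le> h s"
  shows "(\<Sum>k. d k * \<omega> (Suc k)) \<le> (\<integral>\<^sup>+ s. h s \<partial>\<mu>)"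
proof -
  have "(\<Sum>k. d k * \<omega> (Suc k)) \<le> (\<Sum>k. d k * emeasure \<mu> (\<Delta> k))"
    by (intro suminf_le mult_left_mono mu_\<Delta>) auto
  also have "\<dots> = (\<integral>\<^sup>+ s. (\<Sum>k. d k * indicator (\<Delta> k) s) \<partial>\<mu>)"
    by (subst nn_integral_suminf) (auto simp: nn_integral_cmult_indicator)
  also have "\<dots> \<le> (\<integral>\<^sup>+ s. h s \<partial>\<mu>)"
  proof (rule nn_integral_mono)
    fix s
    show "(\<Sum>k. d k * indicator (\<Delta> k) s) \<le> h s"
    proof (cases "\<exists>k. s \<in> \<Delta> k")
      case True
      then obtain k where "s \<in> \<Delta> k" ..
      then show ?thesis
        using suminf_cmult_indicator[OF disjoint_\<Delta>, of s k d] assms by simp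
    next
      case False
      then have "(\<lambda>k. d k * indicator (\<Delta> k) s) = (\<lambda>k. 0)" by (auto simp: indicator_def)
      then show ?thesis by simp
    qed
  qed
  finally show ?thesis .
qed

text \<open>The normalised functions \<open>1 / v\<close> on sets \<open>E k\<close> replace point masses, for which the choice of
  test function would be most transparent.\<close>

lemma test_inequality:
  fixes g :: "nat \<Rightarrow> real \<Rightarrow> ennreal" and b :: "nat \<Rightarrow> ennreal"
  assumes I: "finite I"
    and E: "\<And>k. k \<in> I \<Longrightarrow> E k \<in> sets L" "\<And>k. k \<in> I \<Longrightarrow> 0 < emeasure L (E k)" "\<And>k. k \<in> I \<Longrightarrow> emeasure L (E k) < top"
    and g: "\<And>k z s. k \<in> I \<Longrightarrow> z \<in> E k \<Longrightarrow> g k s \<le> r z * K z s epowr (1 + 1 / p)"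
  shows "(\<integral>\<^sup>+ s. (\<Sum>k\<in>I. b k * g k s) epowr q \<partial>\<mu>) \<le> D * (\<Sum>k\<in>I. b k) epowr q"
proof -
  define e where "e k = emeasure L (E k)" for k
  have e: "inverse (e k) * e k = 1" if "k \<in> I" for k
    using E(2,3)[OF that] unfolding e_def
    by (metis divide_ennreal_def ennreal_divide_self less_irrefl mult.commute)
  define f where "f z = (\<Sum>k\<in>I. b k * inverse (e k) * (r z * indicator (E k) z))" for z
  have f_k [measurable]: "(\<lambda>z. r z * indicator (E k) z) \<in> borel_measurable L" if "k \<in> I" for k
    using E(1)[OF that] by measurable
  have f [measurable]: "f \<in> borel_measurable L"
    unfolding f_def by (intro borel_measurable_sum borel_measurable_times f_k) auto
  have "(\<integral>\<^sup>+ s. (\<Sum>k\<in>I. b k * g k s) epowr q \<partial>\<mu>) \<le> (\<integral>\<^sup>+ s. T f s epowr q \<partial>\<mu>)"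
  proof (intro nn_integral_mono epowr_mono q_bounds)
    fix s
    have "(\<Sum>k\<in>I. b k * g k s) = (\<Sum>k\<in>I. b k * inverse (e k) * (g k s * e k))"
      using e by (intro sum.cong refl) (simp add: mult.assoc mult.left_commute[of "inverse _" "g _ _"])
    also have "\<dots> = (\<Sum>k\<in>I. b k * inverse (e k) * (\<integral>\<^sup>+ z. g k s * indicator (E k) z \<partial>L))"
      using E by (simp add: e_def nn_integral_cmult_indicator)
    also have "\<dots> \<le> (\<Sum>k\<in>I. b k * inverse (e k) * (\<integral>\<^sup>+ z. (r z * indicator (E k) z) * K z s epowr (1 + 1 / p) \<partial>L))"
      using g by (intro sum_mono mult_left_mono nn_integral_mono) (auto simp: indicator_def)
    also have "\<dots> = (\<Sum>k\<in>I. (\<integral>\<^sup>+ z. b k * inverse (e k) * ((r z * indicator (E k) z) * K z s epowr (1 + 1 / p)) \<partial>L))"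
      by (intro sum.cong refl nn_integral_cmult[symmetric] borel_measurable_times f_k) auto
    also have "\<dots> = (\<integral>\<^sup>+ z. (\<Sum>k\<in>I. b k * inverse (e k) * ((r z * indicator (E k) z) * K z s epowr (1 + 1 / p))) \<partial>L)"
      by (intro nn_integral_sum[symmetric] borel_measurable_times f_k) auto
    also have "\<dots> = T f s"
      unfolding T_def f_def by (simp add: sum_distrib_right mult.assoc)
    finally show "(\<Sum>k\<in>I. b k * g k s) \<le> T f s" .
  qed
  also have "\<dots> \<le> D * (\<integral>\<^sup>+ x. f x * v x \<partial>L) epowr q" by (rule hardy[OF f])
  finally have *: "(\<integral>\<^sup>+ s. (\<Sum>k\<in>I. b k * g k s) epowr q \<partial>\<mu>) \<le> D * (\<integral>\<^sup>+ x. f x * v x \<partial>L) epowr q" .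
  have "(\<integral>\<^sup>+ x. f x * v x \<partial>L) \<le> (\<integral>\<^sup>+ z. (\<Sum>k\<in>I. b k * inverse (e k) * indicator (E k) z) \<partial>L)"
  proof (rule nn_integral_mono)
    fix z
    have "f z * v z = (\<Sum>k\<in>I. b k * inverse (e k) * ((r z * v z) * indicator (E k) z))"
      unfolding f_def sum_distrib_right by (simp add: mult_ac)
    \<comment> \<open>Only an inequality: where \<open>v\<close> is 0 the test function may be
      infinite, but its product with \<open>v\<close> is 0.\<close>
    also have "\<dots> \<le> (\<Sum>k\<in>I. b k * inverse (e k) * (1 * indicator (E k) z))"
      unfolding r_def by (intro sum_mono mult_left_mono mult_right_mono ennreal_inverse_mult_le) auto
    finally show "f z * v z \<le> (\<Sum>k\<in>I. b k * inverse (e k) * indicator (E k) z)" by simp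
  qed
  also have "\<dots> = (\<Sum>k\<in>I. \<integral>\<^sup>+ z. b k * inverse (e k) * indicator (E k) z \<partial>L)"
    using E by (intro nn_integral_sum) auto
  also have "\<dots> = (\<Sum>k\<in>I. b k * (inverse (e k) * e k))"
  proof (intro sum.cong refl)
    fix k assume "k \<in> I"
    from nn_integral_cmult_indicator[OF E(1)[OF this], of "b k * inverse (e k)"]
    show "(\<integral>\<^sup>+ z. b k * inverse (e k) * indicator (E k) z \<partial>L) = b k * (inverse (e k) * e k)"
      by (simp add: e_def mult.assoc)
  qed
  also have "\<dots> = (\<Sum>k\<in>I. b k)" using e by (intro sum.cong) auto
  finally show ?thesis
    using q_bounds by (intro order_trans[OF *] mult_left_mono epowr_mono) auto
qed

section \<open>The two families of test functions\<close>

lemma q_eq: "(p + 1) * q = p" "(1 + 1 / p) * q = 1"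
proof -
  have "0 < p + p * p" using p_pos by (intro add_pos_pos mult_pos_pos)
  then show "(p + 1) * q = p" "(1 + 1 / p) * q = 1" using p_pos by (auto simp: q_def field_simps)
qed

text \<open>The factor a^2 pays for testing on later intervals, 10 comes from
  \<open>discrete_lower_bound\<close>, and the power p + 1 from
  \<open>epowr_self_improve\<close>.\<close>

definition C\<^sub>D :: ennreal where "C\<^sub>D = (10 * (ennreal a * ennreal a) * D) epowr (p + 1)"

lemma \<omega>_Suc_Suc: "ennreal a * ennreal a * \<omega> (Suc (Suc k)) = \<omega> k"
  using W_t[of k] W_t[of "Suc k"] by (simp add: mult.assoc)

text \<open>This supplies the sets \<open>E k\<close> for \<open>test_inequality\<close>. The level
  lies strictly below the essential supremum, so the set is not null; it is bounded because
  \<open>h\<close> does not exceed the level beyond \<open>T'\<close>.\<close>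

lemma positive_measure_level_set:
  fixes h :: "real \<Rightarrow> ennreal"
  assumes [measurable]: "h \<in> borel_measurable L" and x: "x < esssup L h" and out: "\<And>z. T' \<le> z \<Longrightarrow> h z \<le> x"
  defines "E \<equiv> {z. 0 < z \<and> x < h z}"
  shows "E \<in> sets L" "0 < emeasure L E" "emeasure L E < top" "z \<in> E \<Longrightarrow> 0 < z \<and> z < T' \<and> x < h z"
proof -
  have "{z \<in> space L. x < h z} \<in> sets L" by measurable
  moreover have eq: "{z \<in> space L. x < h z} = E" by (auto simp: E_def)
  ultimately show E: "E \<in> sets L" by simp
  show "0 < emeasure L E" using esssup_pos_measure[OF assms(1) x] unfolding eq .
  have sub: "E \<subseteq> {0<..<T'}" using out by (auto simp: E_def not_le[symmetric])
  then have "emeasure L E \<le> emeasure L {0<..<T'}"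
    by (rule emeasure_mono) (auto simp: sets_restrict_space)
  also have "\<dots> = emeasure lborel {0<..<T'}"
    by (subst emeasure_restrict_space) auto
  also have "\<dots> < top" by (cases "0 \<le> T'") (auto simp: less_top[symmetric])
  finally show "emeasure L E < top" .
  show "z \<in> E \<Longrightarrow> 0 < z \<and> z < T' \<and> x < h z" using sub by (auto simp: E_def)
qed

text \<open>With coefficients c_k = \<omega>(k)^(p+1) x_k, the k-th bump contributes at least c_k
  x_k^(1/p) to the operator on the interval of index k + 1. The q-th power of this is \<omega>(k)^p
  x_k, and multiplication by \<omega>(k) gives c_k back, so the tested inequality has the same sum
  on both sides.\<close>

lemma V_sum_bound: "(\<Sum>k. \<omega> k epowr (p + 1) * V (t (Suc k))) \<le> 2 * C\<^sub>D"
proof (rule suminf_le_twice_if_strict_lower)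
  fix I :: "nat set" and x :: "nat \<Rightarrow> ennreal"
  assume I: "finite I" and x: "\<And>k. k \<in> I \<Longrightarrow> 0 < x k \<and> x k < V (t (Suc k))"
  define X where "X = (\<Sum>k\<in>I. \<omega> k epowr (p + 1) * x k)"
  define E where "E k = {z. 0 < z \<and> x k < K z (t (Suc k)) epowr (p + 1) * r z epowr p}" for k
  define g where "g k s = x k epowr (1 / p) * indicator {t (Suc k)<..} s" for k s
  \<comment> \<open>Shifted by one: the bump of index j is exploited only beyond t(j+1), thus on the
    next interval, and the first interval receives nothing.\<close>
  define d where "d k = (case k of 0 \<Rightarrow> 0 | Suc j \<Rightarrow> indicator I j * (\<omega> j epowr p * x j))" for k
  have p1: "0 < p + 1" using p_pos by simp
  have E: "E k \<in> sets L" "0 < emeasure L (E k)" "emeasure L (E k) < top"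
      "\<And>z. z \<in> E k \<Longrightarrow> 0 < z \<and> z < t (Suc k) \<and> x k < K z (t (Suc k)) epowr (p + 1) * r z epowr p" if "k \<in> I" for k
  proof -
    let ?h = "\<lambda>z. K z (t (Suc k)) epowr (p + 1) * r z epowr p"
    have 1: "?h \<in> borel_measurable L" by measurable
    have 2: "x k < esssup L ?h" using x[OF that] by (simp add: V_def)
    have 3: "?h z \<le> x k" if "t (Suc k) \<le> z" for z
      using p1 that by (simp add: K_zero)
    note * = positive_measure_level_set[OF 1 2 3, folded E_def]
    show "E k \<in> sets L" "0 < emeasure L (E k)" "emeasure L (E k) < top" by (rule *; assumption)+
    show "z \<in> E k \<Longrightarrow> 0 < z \<and> z < t (Suc k) \<and> x k < ?h z" for z by (rule *(4))
  qed
  have "X \<le> ennreal a * ennreal a * (\<Sum>k. d k * \<omega> (Suc k))"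
  proof -
    have "X = (\<Sum>k\<in>I. ennreal a * ennreal a * (d (Suc k) * \<omega> (Suc (Suc k))))"
      unfolding X_def
    proof (intro sum.cong refl)
      fix k assume "k \<in> I"
      have "\<omega> k epowr (p + 1) * x k = \<omega> k epowr p * x k * (ennreal a * ennreal a * \<omega> (Suc (Suc k)))"
        using p_pos unfolding \<omega>_Suc_Suc by (simp add: epowr_Suc mult_ac)
      then show "\<omega> k epowr (p + 1) * x k = ennreal a * ennreal a * (d (Suc k) * \<omega> (Suc (Suc k)))"
        using \<open>k \<in> I\<close> by (simp add: d_def mult_ac)
    qed
    also have "\<dots> = ennreal a * ennreal a * (\<Sum>k\<in>Suc ` I. d k * \<omega> (Suc k))"
      by (simp add: sum.reindex sum_distrib_left)
    also have "\<dots> \<le> ennreal a * ennreal a * (\<Sum>k. d k * \<omega> (Suc k))"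
      using I by (intro mult_left_mono sum_le_suminf) auto
    finally show ?thesis .
  qed
  also have "(\<Sum>k. d k * \<omega> (Suc k)) \<le> (\<integral>\<^sup>+ s. (\<Sum>k\<in>I. \<omega> k epowr (p + 1) * x k * g k s) epowr q \<partial>\<mu>)"
  proof (rule grid_le_nn_integral)
    fix k s assume s: "s \<in> \<Delta> k"
    show "d k \<le> (\<Sum>k\<in>I. \<omega> k epowr (p + 1) * x k * g k s) epowr q"
    proof (cases "\<exists>j. k = Suc j \<and> j \<in> I")
      case True
      then obtain j where j: "k = Suc j" "j \<in> I" by auto
      have "d k = (\<omega> j epowr (p + 1) * x j * x j epowr (1 / p)) epowr q"
      proof -
        have "(\<omega> j epowr (p + 1) * x j * x j epowr (1 / p)) = \<omega> j epowr (p + 1) * x j epowr (1 + 1 / p)"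
          using p_pos by (simp add: epowr_add mult.assoc)
        also have "\<dots> epowr q = \<omega> j epowr p * x j"
          using p_pos q_bounds by (simp add: epowr_mult epowr_epowr q_eq add_pos_pos)
        finally show ?thesis using j by (simp add: d_def)
      qed
      also have "\<dots> = (\<omega> j epowr (p + 1) * x j * g j s) epowr q"
        using s j by (simp add: g_def)
      also have "\<dots> \<le> (\<Sum>k\<in>I. \<omega> k epowr (p + 1) * x k * g k s) epowr q"
        using I j by (intro epowr_mono q_bounds member_le_sum) auto
      finally show ?thesis .
    qed (auto simp: d_def split: nat.split)
  qed
  also have "\<dots> \<le> D * (\<Sum>k\<in>I. \<omega> k epowr (p + 1) * x k) epowr q"
  proof (rule test_inequality[OF I E(1-3)])
    fix k z s assume k: "k \<in> I" and z: "z \<in> E k"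
    show "g k s \<le> r z * K z s epowr (1 + 1 / p)"
    proof (cases "t (Suc k) < s")
      case True
      have "x k epowr (1 / p) \<le> (K z (t (Suc k)) epowr (p + 1) * r z epowr p) epowr (1 / p)"
        using E(4)[OF k z] p_pos by (intro epowr_mono) auto
      also have "\<dots> = r z * K z (t (Suc k)) epowr (1 + 1 / p)"
        using p_pos by (simp add: epowr_mult epowr_epowr add_divide_distrib mult.commute)
      also have "\<dots> \<le> r z * K z s epowr (1 + 1 / p)"
        using True p_pos by (intro mult_left_mono epowr_mono K_le_t) (auto intro: add_pos_pos)
      finally show ?thesis using True by (simp add: g_def)
    qed (simp add: g_def)
  qed
  finally have "X \<le> (ennreal a * ennreal a * D) * X epowr (p / (p + 1))"
    by (simp add: X_def q_def mult.assoc mult_left_mono)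
  moreover have "X < top"
  proof -
    have "x k < top" if "k \<in> I" for k using x[OF that] less_le_trans[OF _ top_greatest] by blast
    then show ?thesis
      unfolding X_def using I W_finite p1 by (simp add: ennreal_mult_less_top)
  qed
  ultimately have "X \<le> (ennreal a * ennreal a * D) epowr (p + 1)"
    by (intro epowr_self_improve p_pos)
  also have "\<dots> \<le> C\<^sub>D"
    unfolding C\<^sub>D_def using p1 mult_right_mono[of "1 :: ennreal" 10 "ennreal a * ennreal a * D"]
    by (intro epowr_mono) (auto simp: mult.assoc)
  finally show "(\<Sum>k\<in>I. \<omega> k epowr (p + 1) * x k) \<le> C\<^sub>D" by (simp add: X_def)
qed

text \<open>One-step kernel mass. Its tail sums \<beta> act as a discrete form of \<open>N\<close>
  that involves only neighbouring grid points.\<close>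

definition B :: "nat \<Rightarrow> ennreal" where "B k = \<omega> k * K (t k) (t (Suc k))"
definition \<beta> :: "nat \<Rightarrow> ennreal" where "\<beta> k = (\<Sum>i. B (i + k))"
definition b :: "nat \<Rightarrow> ennreal" where "b k = min (B k) (\<beta> (Suc k))"
definition Rv :: "real \<Rightarrow> ennreal" where "Rv u = esssup L (\<lambda>z. r z epowr p * indicator {..<u} z)"

lemma \<beta>_antimono: "k \<le> m \<Longrightarrow> \<beta> m \<le> \<beta> k"
  unfolding \<beta>_def by (rule tail_sum_antimono)

lemma t_less_R: "t k < R"
proof (rule ccontr)
  assume "\<not> t k < R"
  then have "\<omega> k \<le> emeasure \<mu> {R..}" unfolding W_def by (intro emeasure_mono) auto
  then show False using W_t_pos[of k] mu_beyond by simp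
qed

lemma \<beta>_finite: "\<beta> k < top"
proof -
  have "\<beta> 0 \<le> (\<Sum>k. ennreal a * (K 0 R * \<omega> (Suc k)))"
    unfolding \<beta>_def B_def
  proof (intro suminf_le allI)
    fix k
    have "K (t k) (t (Suc k)) \<le> K 0 R"
      using t_nonneg[of k] t_less_R[of "Suc k"] by (intro order_trans[OF K_le_t K_le_x]) auto
    then have "\<omega> k * K (t k) (t (Suc k)) \<le> \<omega> k * K 0 R" by (intro mult_left_mono) auto
    also have "\<dots> = ennreal a * (K 0 R * \<omega> (Suc k))" by (subst W_t) (simp add: mult_ac)
    finally show "\<omega> (k + 0) * K (t (k + 0)) (t (Suc (k + 0))) \<le> ennreal a * (K 0 R * \<omega> (Suc k))"
      by simp
  qed auto
  also have "\<dots> = ennreal a * (\<Sum>k. K 0 R * \<omega> (Suc k))" by simp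
  also have "\<dots> \<le> ennreal a * (\<integral>\<^sup>+ s. K 0 R \<partial>\<mu>)"
    by (intro mult_left_mono grid_le_nn_integral) auto
  also have "\<dots> < top"
    using finite_mu K_finite by (simp add: ennreal_mult_less_top)
  finally have "\<beta> 0 < top" .
  with \<beta>_antimono[of 0 k] show ?thesis by (simp add: le_less_trans)
qed

text \<open>On the interval of index i + 1 all bumps with k < i act together. Since they sit left of
  t(k+1) <= t(i), the kernel there is at least K(t(i),t(i+1)). The q-th power of the operator,
  weighted by \<omega>(i), is therefore at least B(i) H(i)^q, and
  \<open>discrete_lower_bound\<close> returns to the sum of the coefficients.\<close>

lemma Rv_sum_bound: "(\<Sum>k. b k * \<beta> (Suc k) epowr p * Rv (t (Suc k))) \<le> 2 * C\<^sub>D"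
proof (rule suminf_le_twice_if_strict_lower)
  fix I :: "nat set" and x :: "nat \<Rightarrow> ennreal"
  assume I: "finite I" and x: "\<And>k. k \<in> I \<Longrightarrow> 0 < x k \<and> x k < Rv (t (Suc k))"
  define X where "X = (\<Sum>k\<in>I. b k * \<beta> (Suc k) epowr p * x k)"
  define H where "H i = (\<Sum>k\<in>I \<inter> {..<i}. b k * \<beta> (Suc k) epowr p * x k epowr (1 + 1 / p))" for i
  define E where "E k = {z. 0 < z \<and> x k < r z epowr p * indicator {..<t (Suc k)} z}" for k
  define g where "g k s = x k epowr (1 / p) * K (t (Suc k)) s epowr (1 + 1 / p)" for k s
  define d where "d k = (case k of 0 \<Rightarrow> 0 | Suc i \<Rightarrow> H i epowr q * K (t i) (t (Suc i)))" for k
  have p1: "0 < p + 1" "0 < 1 + 1 / p" using p_pos by (auto intro: add_pos_pos)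
  have E: "E k \<in> sets L" "0 < emeasure L (E k)" "emeasure L (E k) < top"
      "\<And>z. z \<in> E k \<Longrightarrow> 0 < z \<and> z < t (Suc k) \<and> x k < r z epowr p * indicator {..<t (Suc k)} z" if "k \<in> I" for k
  proof -
    let ?h = "\<lambda>z. r z epowr p * indicator {..<t (Suc k)} z"
    have [measurable]: "(\<lambda>z. indicator {..<t (Suc k)} z :: ennreal) \<in> borel_measurable L"
      by (rule measurable_compose[OF id_measurable_lebesgue_on]) simp
    have 1: "?h \<in> borel_measurable L" by measurable
    have 2: "x k < esssup L ?h" using x[OF that] by (simp add: Rv_def)
    have 3: "?h z \<le> x k" if "t (Suc k) \<le> z" for z
      using that by simp
    note * = positive_measure_level_set[OF 1 2 3, folded E_def]
    show "E k \<in> sets L" "0 < emeasure L (E k)" "emeasure L (E k) < top" by (rule *; assumption)+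
    show "z \<in> E k \<Longrightarrow> 0 < z \<and> z < t (Suc k) \<and> x k < ?h z" for z by (rule *(4))
  qed
  have "X \<le> 10 * (\<Sum>i. B i * H i epowr q)"
    unfolding X_def H_def b_def \<beta>_def q_def
    by (rule discrete_lower_bound[OF p_pos I]) (use \<beta>_finite[of 0] in \<open>simp add: \<beta>_def\<close>)
  also have "(\<Sum>i. B i * H i epowr q) = (\<Sum>i. ennreal a * ennreal a * (d (Suc i) * \<omega> (Suc (Suc i))))"
  proof (rule suminf_cong)
    fix i
    have "B i = K (t i) (t (Suc i)) * (ennreal a * ennreal a * \<omega> (Suc (Suc i)))"
      unfolding \<omega>_Suc_Suc B_def by (simp add: mult.commute)
    then show "B i * H i epowr q = ennreal a * ennreal a * (d (Suc i) * \<omega> (Suc (Suc i)))"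
      by (simp add: d_def mult_ac)
  qed
  also have "\<dots> = ennreal a * ennreal a * (\<Sum>i. d (Suc i) * \<omega> (Suc (Suc i)))" by simp
  also have "(\<Sum>i. d (Suc i) * \<omega> (Suc (Suc i))) \<le> (\<Sum>k. d k * \<omega> (Suc k))"
    using tail_sum_antimono[of 0 1 "\<lambda>k. d k * \<omega> (Suc k)"] by simp
  also have "(\<Sum>k. d k * \<omega> (Suc k)) \<le> (\<integral>\<^sup>+ s. (\<Sum>k\<in>I. b k * \<beta> (Suc k) epowr p * x k * g k s) epowr q \<partial>\<mu>)"
  proof (rule grid_le_nn_integral)
    fix k s assume s: "s \<in> \<Delta> k"
    show "d k \<le> (\<Sum>k\<in>I. b k * \<beta> (Suc k) epowr p * x k * g k s) epowr q"
    proof (cases k)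
      case (Suc i)
      have "d k = (H i * K (t i) (t (Suc i)) epowr (1 + 1 / p)) epowr q"
        using p1 q_bounds by (simp add: d_def Suc epowr_mult epowr_epowr q_eq)
      also have "\<dots> \<le> (\<Sum>k\<in>I. b k * \<beta> (Suc k) epowr p * x k * g k s) epowr q"
      proof (intro epowr_mono q_bounds)
        have "H i * K (t i) (t (Suc i)) epowr (1 + 1 / p)
            = (\<Sum>k\<in>I \<inter> {..<i}. b k * \<beta> (Suc k) epowr p * x k epowr (1 + 1 / p) * K (t i) (t (Suc i)) epowr (1 + 1 / p))"
          by (simp add: H_def sum_distrib_right)
        also have "\<dots> \<le> (\<Sum>k\<in>I \<inter> {..<i}. b k * \<beta> (Suc k) epowr p * x k * g k s)"
        proof (rule sum_mono)
          fix k assume k: "k \<in> I \<inter> {..<i}"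
          have "K (t i) (t (Suc i)) \<le> K (t (Suc k)) s"
            using s Suc k t_le[of "Suc k" i] by (intro order_trans[OF K_le_t K_le_x]) auto
          then have "K (t i) (t (Suc i)) epowr (1 + 1 / p) \<le> K (t (Suc k)) s epowr (1 + 1 / p)"
            using p1 by (intro epowr_mono)
          then have "b k * \<beta> (Suc k) epowr p * x k epowr (1 + 1 / p) * K (t i) (t (Suc i)) epowr (1 + 1 / p)
             \<le> b k * \<beta> (Suc k) epowr p * x k epowr (1 + 1 / p) * K (t (Suc k)) s epowr (1 + 1 / p)"
            by (intro mult_left_mono) auto
          also have "\<dots> = b k * \<beta> (Suc k) epowr p * x k * g k s"
          proof -
            have "x k epowr (1 + 1 / p) = x k * x k epowr (1 / p)"
              using p_pos by (subst epowr_add) auto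
            then show ?thesis by (simp add: g_def mult_ac)
          qed
          finally show "b k * \<beta> (Suc k) epowr p * x k epowr (1 + 1 / p) * K (t i) (t (Suc i)) epowr (1 + 1 / p)
             \<le> b k * \<beta> (Suc k) epowr p * x k * g k s"
.
        qed
        also have "\<dots> \<le> (\<Sum>k\<in>I. b k * \<beta> (Suc k) epowr p * x k * g k s)"
          using I by (intro sum_mono2) auto
        finally show "H i * K (t i) (t (Suc i)) epowr (1 + 1 / p) \<le> (\<Sum>k\<in>I. b k * \<beta> (Suc k) epowr p * x k * g k s)" .
      qed
      finally show ?thesis .
    qed (simp add: d_def)
  qed
  also have "\<dots> \<le> D * (\<Sum>k\<in>I. b k * \<beta> (Suc k) epowr p * x k) epowr q"
  proof (rule test_inequality[OF I E(1-3)])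
    fix k z s assume k: "k \<in> I" and z: "z \<in> E k"
    have "x k epowr (1 / p) \<le> (r z epowr p) epowr (1 / p)"
      using E(4)[OF k z] p_pos by (intro epowr_mono) auto
    also have "\<dots> = r z" using p_pos by (simp add: epowr_inverse_cancel)
    finally show "g k s \<le> r z * K z s epowr (1 + 1 / p)"
      unfolding g_def using E(4)[OF k z] p1 by (intro mult_mono epowr_mono K_le_x) auto
  qed
  finally have "X \<le> (10 * (ennreal a * ennreal a) * D) * X epowr (p / (p + 1))"
    by (simp add: X_def q_def mult.assoc mult_left_mono)
  moreover have "X < top"
  proof -
    have "b k < top" for k using \<beta>_finite[of "Suc k"] by (simp add: b_def min_less_iff_disj)
    moreover have "x k < top" if "k \<in> I" for k
      using x[OF that] less_le_trans[OF _ top_greatest] by blast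
    ultimately show ?thesis
      unfolding X_def using I \<beta>_finite p_pos by (simp add: ennreal_mult_less_top)
  qed
  ultimately show "(\<Sum>k\<in>I. b k * \<beta> (Suc k) epowr p * x k) \<le> C\<^sub>D"
    unfolding C\<^sub>D_def X_def[symmetric] by (intro epowr_self_improve p_pos)
qed

end

text \<open>The first summand collects the sum with \<open>V\<close>, which enters directly and once
  more through \<open>NS_local\<close>. In the second, the power comes from replacing
  \<open>N\<close> by \<beta>, the next factor from \<open>S_sum_le\<close>, and 4 from adding the
  two tested sums. The constant depends neither on the grid nor on \<open>D\<close>.\<close>

definition (in hardy_core) C\<^sub>N :: ennreal where
  "C\<^sub>N = (1 + C\<^sub>M) * 2 + C\<^sub>M * (2 * ennreal c) epowr p * (2 * ennreal c * 4)"

section \<open>From the tested sums back to the integral of G\<close>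

context hardy_grid
begin

lemma a_eq_ennreal: "ennreal a = 2 * ennreal c"
  using c_ge_1 by (simp add: a_eq ennreal_mult)

text \<open>The triangle inequality reduces the kernel from t(k) to a distant grid point to one-step
  values, recursively. The decay of \<omega> absorbs the constants that accumulate.\<close>

lemma N_grid_le: "N (t k) \<le> 2 * ennreal c * \<beta> k"
proof -
  define f where "f j = \<omega> j * K (t k) (t (Suc j))" for j
  have "N (t k) \<le> (\<Sum>j. K (t k) (t (Suc j)) * \<omega> j)"
    unfolding N_def by (rule nn_integral_le_grid) (auto intro: K_le_t)
  also have "\<dots> = (\<Sum>j. f (j + 0))" by (simp add: f_def mult.commute)
  also have "\<dots> = (\<Sum>j\<in>{0..<k}. f j) + (\<Sum>j. f (j + k))" by (rule tail_sum_split) simp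
  also have "(\<Sum>j\<in>{0..<k}. f j) = 0"
    by (intro sum.neutral) (auto simp: f_def intro!: K_zero t_le)
  also have "0 + (\<Sum>j. f (j + k)) = (\<Sum>j. \<omega> (j + k) * K (t k) (t (Suc (j + k))))"
    by (simp add: f_def)
  also have "\<dots> \<le> 2 * ennreal c * (\<Sum>j. \<omega> (j + k) * K (t (j + k)) (t (Suc (j + k))))"
  proof (rule weighted_recursion_bound)
    show "K (t k) (t (Suc (0 + k))) \<le> ennreal c * K (t (0 + k)) (t (Suc (0 + k)))"
      using mult_right_mono[OF one_le_c] by simp
    show "K (t k) (t (Suc (Suc n + k))) \<le> ennreal c * (K (t k) (t (Suc (n + k))) + K (t (Suc n + k)) (t (Suc (Suc n + k))))" for n
      using K_triangle[of "t k" "t (Suc (n + k))" "t (Suc (Suc n + k))"] t_nonneg t_less by simp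
    show "2 * ennreal c * \<omega> (Suc n + k) \<le> \<omega> (n + k)" for n
      unfolding W_t[of "n + k"] a_eq_ennreal by simp
  qed
  also have "(\<Sum>j. \<omega> (j + k) * K (t (j + k)) (t (Suc (j + k)))) = \<beta> k"
    by (simp add: \<beta>_def B_def)
  finally show ?thesis .
qed

text \<open>As the kernel decreases in its first variable, the minimum is its value at
  \<open>max z (t k)\<close>. Thus \<open>s k\<close> is what passing from t(k) to t(k+1) adds to
  \<open>S\<close>.\<close>

definition s :: "nat \<Rightarrow> ennreal" where
  "s k = esssup L (\<lambda>z. min (K z (t (Suc k))) (K (t k) (t (Suc k))) * r z epowr p)"

lemma s_measurable [measurable]:
  "(\<lambda>z. min (K z (t (Suc k))) (K (t k) (t (Suc k))) * r z epowr p) \<in> borel_measurable L"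
  by measurable

lemma AE_L_pos: "AE z in L. 0 < z"
  by (rule AE_I2) simp

lemma S_0_le: "S (t (Suc 0)) \<le> ennreal c * s 0"
proof -
  have "S (t (Suc 0)) \<le> s 0"
    unfolding S_def s_def
  proof (rule esssup_AE_mono)
    show "AE z in L. K z (t (Suc 0)) * r z epowr p \<le> min (K z (t (Suc 0))) (K (t 0) (t (Suc 0))) * r z epowr p"
      using AE_L_pos by eventually_elim (use t_0 in \<open>auto intro!: mult_right_mono K_le_x\<close>)
  qed simp
  also have "\<dots> \<le> ennreal c * s 0" using mult_right_mono[OF one_le_c, of "s 0"] by simp
  finally show ?thesis .
qed

lemma S_Suc_le: "S (t (Suc (Suc k))) \<le> ennreal c * (S (t (Suc k)) + s (Suc k))"
  unfolding S_def[of "t (Suc (Suc k))"]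
proof (rule esssup_I)
  have 1: "AE z in L. K z (t (Suc k)) * r z epowr p \<le> S (t (Suc k))"
    unfolding S_def by (rule esssup_AE)
  have 2: "AE z in L. min (K z (t (Suc (Suc k)))) (K (t (Suc k)) (t (Suc (Suc k)))) * r z epowr p \<le> s (Suc k)"
    unfolding s_def by (rule esssup_AE)
  show "AE z in L. K z (t (Suc (Suc k))) * r z epowr p \<le> ennreal c * (S (t (Suc k)) + s (Suc k))"
    using 1 2 AE_L_pos
  proof eventually_elim
    case (elim z)
    let ?m = "min (K z (t (Suc (Suc k)))) (K (t (Suc k)) (t (Suc (Suc k))))"
    have "K z (t (Suc (Suc k))) \<le> ennreal c * (K z (t (Suc k)) + ?m)"
    proof (cases "z < t (Suc k)")
      case True
      then have "?m = K (t (Suc k)) (t (Suc (Suc k)))" by (intro min_absorb2 K_le_x) simp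
      then show ?thesis using K_triangle[of z "t (Suc k)" "t (Suc (Suc k))"] True elim t_less by simp
    next
      case False
      then have "?m = K z (t (Suc (Suc k)))" by (intro min_absorb1 K_le_x) simp
      then have "K z (t (Suc (Suc k))) \<le> 1 * (K z (t (Suc k)) + ?m)" by (simp add: add_increasing)
      also have "\<dots> \<le> ennreal c * (K z (t (Suc k)) + ?m)" by (intro mult_right_mono one_le_c) simp
      finally show ?thesis .
    qed
    then have "K z (t (Suc (Suc k))) * r z epowr p \<le> ennreal c * (K z (t (Suc k)) + ?m) * r z epowr p"
      by (intro mult_right_mono) auto
    also have "\<dots> = ennreal c * (K z (t (Suc k)) * r z epowr p + ?m * r z epowr p)"
      by (simp add: distrib_right mult.assoc)
    also have "\<dots> \<le> ennreal c * (S (t (Suc k)) + s (Suc k))"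
      using elim by (intro mult_left_mono add_mono) auto
    finally show ?case .
  qed
qed simp

lemma S_sum_le: "(\<Sum>k. \<omega> k * \<beta> (Suc k) epowr p * S (t (Suc k)))
    \<le> 2 * ennreal c * (\<Sum>k. \<omega> k * \<beta> (Suc k) epowr p * s k)"
proof (rule weighted_recursion_bound[OF S_0_le S_Suc_le])
  fix n
  have "2 * ennreal c * (\<omega> (Suc n) * \<beta> (Suc (Suc n)) epowr p) = \<omega> n * \<beta> (Suc (Suc n)) epowr p"
    unfolding W_t[of n] a_eq_ennreal by (simp add: mult_ac)
  also have "\<dots> \<le> \<omega> n * \<beta> (Suc n) epowr p"
    by (intro mult_left_mono epowr_mono p_pos \<beta>_antimono) auto
  finally show "2 * ennreal c * (\<omega> (Suc n) * \<beta> (Suc (Suc n)) epowr p) \<le> \<omega> n * \<beta> (Suc n) epowr p" .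
qed

text \<open>Let d be \<omega>(k) times the minimum. If d <= \<beta>(k+1), then d is below both
  entries of \<open>b k\<close>, which gives the term with \<open>Rv\<close>. Otherwise
  \<beta>(k+1)^p <= d^p, and d^(p+1) is absorbed by the term with \<open>V\<close>. So cutting
  \<open>B\<close> down to \<open>b\<close> loses nothing.\<close>

lemma s_le: "\<omega> k * \<beta> (Suc k) epowr p * s k
    \<le> \<omega> k epowr (p + 1) * V (t (Suc k)) + b k * \<beta> (Suc k) epowr p * Rv (t (Suc k))"
  unfolding s_def
proof (rule mult_esssup_le)
  show "\<omega> k * \<beta> (Suc k) epowr p < top"
    using W_finite \<beta>_finite p_pos by (simp add: ennreal_mult_less_top)
  have 1: "AE z in L. K z (t (Suc k)) epowr (p + 1) * r z epowr p \<le> V (t (Suc k))"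
    unfolding V_def by (rule esssup_AE)
  have 2: "AE z in L. r z epowr p * indicator {..<t (Suc k)} z \<le> Rv (t (Suc k))"
    unfolding Rv_def by (rule esssup_AE)
  show "AE z in L. \<omega> k * \<beta> (Suc k) epowr p * (min (K z (t (Suc k))) (K (t k) (t (Suc k))) * r z epowr p)
    \<le> \<omega> k epowr (p + 1) * V (t (Suc k)) + b k * \<beta> (Suc k) epowr p * Rv (t (Suc k))"
    using 1 2
  proof eventually_elim
    case (elim z)
    show ?case
    proof (cases "z < t (Suc k)")
      case True
      define d where "d = \<omega> k * min (K z (t (Suc k))) (K (t k) (t (Suc k)))"
      have dB: "d \<le> B k" unfolding d_def B_def by (intro mult_left_mono) auto
      have dK: "d \<le> \<omega> k * K z (t (Suc k))" unfolding d_def by (intro mult_left_mono) auto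
      have "d * \<beta> (Suc k) epowr p \<le> d epowr (p + 1) + b k * \<beta> (Suc k) epowr p"
      proof (cases "d \<le> \<beta> (Suc k)")
        case True
        then have "d * \<beta> (Suc k) epowr p \<le> b k * \<beta> (Suc k) epowr p"
          using dB by (intro mult_right_mono) (auto simp: b_def)
        then show ?thesis by (simp add: add_increasing)
      next
        case False
        then have "d * \<beta> (Suc k) epowr p \<le> d * d epowr p"
          by (intro mult_left_mono epowr_mono p_pos) auto
        also have "\<dots> = d epowr (p + 1)" using p_pos by (simp add: epowr_Suc mult.commute)
        finally show ?thesis by (simp add: add_increasing2)
      qed
      then have "d * \<beta> (Suc k) epowr p * r z epowr p \<le> (d epowr (p + 1) + b k * \<beta> (Suc k) epowr p) * r z epowr p"
        by (intro mult_right_mono) auto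
      also have "\<dots> \<le> ((\<omega> k * K z (t (Suc k))) epowr (p + 1) + b k * \<beta> (Suc k) epowr p) * r z epowr p"
        using p_pos by (intro mult_right_mono add_right_mono epowr_mono dK) auto
      also have "\<dots> = \<omega> k epowr (p + 1) * (K z (t (Suc k)) epowr (p + 1) * r z epowr p)
          + b k * \<beta> (Suc k) epowr p * (r z epowr p * indicator {..<t (Suc k)} z)"
        using True p_pos by (simp add: epowr_mult distrib_right mult.assoc)
      also have "\<dots> \<le> \<omega> k epowr (p + 1) * V (t (Suc k)) + b k * \<beta> (Suc k) epowr p * Rv (t (Suc k))"
        using elim by (intro add_mono mult_left_mono) auto
      finally show ?thesis by (simp add: d_def mult_ac)
    qed (simp add: K_zero)
  qed
qed simp

lemma N_local:
  assumes "u \<in> \<Delta> k"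
  shows "N u \<le> ennreal c * (K u (t (Suc k)) * \<omega> k + N (t (Suc k)))"
proof -
  have u: "t k < u" "u \<le> t (Suc k)" using assms by auto
  have "N u \<le> (\<integral>\<^sup>+ y. ennreal c * (K u (t (Suc k)) * indicator {t k<..} y + K (t (Suc k)) y) \<partial>\<mu>)"
    unfolding N_def
  proof (rule nn_integral_mono)
    fix y
    have "K u y \<le> ennreal c * (K u (t (Suc k)) + K (t (Suc k)) y)" if y: "u < y"
    proof (cases "y \<le> t (Suc k) \<or> u = t (Suc k)")
      case True
      then have "K u y \<le> 1 * (K u (t (Suc k)) + K (t (Suc k)) y)"
        by (auto intro: add_increasing add_increasing2 K_le_t)
      also have "\<dots> \<le> ennreal c * (K u (t (Suc k)) + K (t (Suc k)) y)"
        by (intro mult_right_mono one_le_c) simp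
      finally show ?thesis .
    next
      case False
      then show ?thesis using u t_nonneg[of k] by (intro K_triangle) auto
    qed
    then show "K u y \<le> ennreal c * (K u (t (Suc k)) * indicator {t k<..} y + K (t (Suc k)) y)"
      using u by (cases "u < y") (auto simp: K_zero)
  qed
  also have "\<dots> = ennreal c * (K u (t (Suc k)) * \<omega> k + N (t (Suc k)))"
    by (subst nn_integral_cmult, measurable, subst nn_integral_add, measurable)
      (simp add: W_def N_def nn_integral_cmult_indicator)
  finally show ?thesis .
qed

text \<open>\<open>N\<close> decreases while \<open>S\<close> increases, so the product cannot be
  compared with one endpoint by monotonicity. The excess of N(u) over its value at t(k+1) costs a
  factor K(u,t(k+1))^p, and for z < u this times K(z,u) is at most K(z,t(k+1))^(p+1), the kernel of
  \<open>V\<close>.\<close>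

lemma NS_local:
  assumes "u \<in> \<Delta> k"
  shows "N u epowr p * S u \<le> C\<^sub>M * (\<omega> k epowr p * V (t (Suc k)) + N (t (Suc k)) epowr p * S (t (Suc k)))"
proof -
  have u: "t k < u" "u \<le> t (Suc k)" using assms by auto
  have KS: "K u (t (Suc k)) epowr p * S u \<le> V (t (Suc k))"
    unfolding S_def
  proof (rule mult_esssup_le)
    have "AE z in L. K z (t (Suc k)) epowr (p + 1) * r z epowr p \<le> V (t (Suc k))"
      unfolding V_def by (rule esssup_AE)
    then show "AE z in L. K u (t (Suc k)) epowr p * (K z u * r z epowr p) \<le> V (t (Suc k))"
    proof eventually_elim
      case (elim z)
      show ?case
      proof (cases "z < u")
        case True
        have "K u (t (Suc k)) epowr p * (K z u * r z epowr p) \<le> K z (t (Suc k)) epowr p * (K z (t (Suc k)) * r z epowr p)"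
          using True u by (intro mult_mono epowr_mono p_pos K_le_x K_le_t mult_right_mono) auto
        also have "\<dots> \<le> V (t (Suc k))" using elim p_pos by (simp add: epowr_Suc mult.assoc)
        finally show ?thesis .
      qed (simp add: K_zero)
    qed
    show "K u (t (Suc k)) epowr p < top" using K_finite p_pos by simp
  qed simp
  have "N u epowr p \<le> ennreal c epowr p * (K u (t (Suc k)) * \<omega> k + N (t (Suc k))) epowr p"
    using epowr_mono[OF p_pos N_local[OF assms]] by (simp add: epowr_mult p_pos)
  also have "\<dots> \<le> ennreal c epowr p * (2 epowr p * ((K u (t (Suc k)) * \<omega> k) epowr p + N (t (Suc k)) epowr p))"
    by (intro mult_left_mono epowr_add_le p_pos) simp
  also have "\<dots> = C\<^sub>M * (K u (t (Suc k)) epowr p * \<omega> k epowr p + N (t (Suc k)) epowr p)"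
    using p_pos by (simp add: C\<^sub>M_def epowr_mult mult.assoc)
  finally have "N u epowr p * S u \<le> C\<^sub>M * (K u (t (Suc k)) epowr p * \<omega> k epowr p + N (t (Suc k)) epowr p) * S u"
    by (intro mult_right_mono) auto
  also have "\<dots> = C\<^sub>M * (\<omega> k epowr p * (K u (t (Suc k)) epowr p * S u) + N (t (Suc k)) epowr p * S u)"
    by (simp add: distrib_left distrib_right mult_ac)
  also have "\<dots> \<le> C\<^sub>M * (\<omega> k epowr p * V (t (Suc k)) + N (t (Suc k)) epowr p * S (t (Suc k)))"
    using u monoD[OF S_mono] by (intro mult_left_mono add_mono KS) auto
  finally show ?thesis .
qed

lemma nn_integral_G_le: "(\<integral>\<^sup>+ u. G u \<partial>\<mu>) \<le> C\<^sub>N * C\<^sub>D"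
proof -
  let ?V = "\<Sum>k. \<omega> k epowr (p + 1) * V (t (Suc k))"
  let ?c = "(2 * ennreal c) epowr p"
  have "(\<integral>\<^sup>+ u. G u \<partial>\<mu>) \<le> (\<Sum>k. ((1 + C\<^sub>M) * (\<omega> k epowr p * V (t (Suc k))) + C\<^sub>M * (N (t (Suc k)) epowr p * S (t (Suc k)))) * \<omega> k)"
  proof (rule nn_integral_le_grid)
    fix k u assume u: "u \<in> \<Delta> k"
    have "W u epowr p * V u \<le> \<omega> k epowr p * V (t (Suc k))"
      using u monoD[OF V_mono] antimonoD[OF W_antimono] by (intro mult_mono epowr_mono p_pos) auto
    then have "G u \<le> \<omega> k epowr p * V (t (Suc k)) + C\<^sub>M * (\<omega> k epowr p * V (t (Suc k)) + N (t (Suc k)) epowr p * S (t (Suc k)))"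
      unfolding G_def by (intro add_mono NS_local u)
    also have "\<dots> = (1 + C\<^sub>M) * (\<omega> k epowr p * V (t (Suc k))) + C\<^sub>M * (N (t (Suc k)) epowr p * S (t (Suc k)))"
      by (simp add: distrib_left distrib_right add.assoc)
    finally show "G u \<le> \<dots>" .
  qed
  also have "\<dots> \<le> (\<Sum>k. (1 + C\<^sub>M) * (\<omega> k epowr (p + 1) * V (t (Suc k))) + C\<^sub>M * ?c * (\<omega> k * \<beta> (Suc k) epowr p * S (t (Suc k))))"
  proof (intro suminf_le allI)
    fix k
    have "N (t (Suc k)) epowr p \<le> ?c * \<beta> (Suc k) epowr p"
      using epowr_mono[OF p_pos N_grid_le[of "Suc k"]] by (simp add: epowr_mult p_pos)
    then have "C\<^sub>M * \<omega> k * S (t (Suc k)) * N (t (Suc k)) epowr p \<le> C\<^sub>M * \<omega> k * S (t (Suc k)) * (?c * \<beta> (Suc k) epowr p)"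
      by (intro mult_left_mono) auto
    moreover have "((1 + C\<^sub>M) * (\<omega> k epowr p * V (t (Suc k))) + C\<^sub>M * (N (t (Suc k)) epowr p * S (t (Suc k)))) * \<omega> k
      = (1 + C\<^sub>M) * (\<omega> k epowr (p + 1) * V (t (Suc k))) + C\<^sub>M * \<omega> k * S (t (Suc k)) * N (t (Suc k)) epowr p"
      unfolding epowr_Suc[OF p_pos] distrib_right[of _ _ "\<omega> k"] by (simp add: mult_ac)
    ultimately show "((1 + C\<^sub>M) * (\<omega> k epowr p * V (t (Suc k))) + C\<^sub>M * (N (t (Suc k)) epowr p * S (t (Suc k)))) * \<omega> k
      \<le> (1 + C\<^sub>M) * (\<omega> k epowr (p + 1) * V (t (Suc k))) + C\<^sub>M * ?c * (\<omega> k * \<beta> (Suc k) epowr p * S (t (Suc k)))"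
      by (simp add: mult_ac add_left_mono)
  qed auto
  also have "\<dots> = (1 + C\<^sub>M) * ?V + C\<^sub>M * ?c * (\<Sum>k. \<omega> k * \<beta> (Suc k) epowr p * S (t (Suc k)))"
    by (subst suminf_add[symmetric]) auto
  also have "\<dots> \<le> (1 + C\<^sub>M) * (2 * C\<^sub>D) + C\<^sub>M * ?c * (2 * ennreal c * (4 * C\<^sub>D))"
  proof (intro add_mono mult_left_mono V_sum_bound order_trans[OF S_sum_le])
    have "(\<Sum>k. \<omega> k * \<beta> (Suc k) epowr p * s k) \<le> (\<Sum>k. \<omega> k epowr (p + 1) * V (t (Suc k)) + b k * \<beta> (Suc k) epowr p * Rv (t (Suc k)))"
      by (intro suminf_le s_le) auto
    also have "\<dots> = ?V + (\<Sum>k. b k * \<beta> (Suc k) epowr p * Rv (t (Suc k)))"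
      by (subst suminf_add[symmetric]) auto
    also have "\<dots> \<le> 2 * C\<^sub>D + 2 * C\<^sub>D" by (intro add_mono V_sum_bound Rv_sum_bound)
    also have "\<dots> = 4 * C\<^sub>D" by (simp flip: distrib_right)
    finally show "(\<Sum>k. \<omega> k * \<beta> (Suc k) epowr p * s k) \<le> 4 * C\<^sub>D" .
  qed auto
  also have "\<dots> = C\<^sub>N * C\<^sub>D"
    unfolding C\<^sub>N_def distrib_right[of _ _ "C\<^sub>D"] by (simp only: mult.assoc)
  finally show ?thesis .
qed

end

context hardy_core
begin

lemma necessity:
  assumes "D < top"
    and "\<And>f. f \<in> borel_measurable L \<Longrightarrow> (\<integral>\<^sup>+ s. T f s epowr q \<partial>\<mu>) \<le> D * (\<integral>\<^sup>+ x. f x * v x \<partial>L) epowr q"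
  shows "(\<integral>\<^sup>+ t. G t \<partial>\<mu>) \<le> C\<^sub>N * (10 * (ennreal (2 * c) * ennreal (2 * c)) * D) epowr (p + 1)"
proof (cases "W 0 = 0")
  case True
  \<comment> \<open>No grid exists in this case, but the measure is then zero.\<close>
  have "AE t in \<mu>. False"
    using AE_mu_pos AE_mu_W_pos
  proof eventually_elim
    case (elim t)
    then show ?case using antimonoD[OF W_antimono, of 0 t] True by simp
  qed
  then have "(\<integral>\<^sup>+ t. G t \<partial>\<mu>) = (\<integral>\<^sup>+ t. 0 \<partial>\<mu>)"
    by (intro nn_integral_cong_AE) auto
  then show ?thesis by simp
next
  case False
  then have W0: "0 < W 0" by (simp add: zero_less_iff_neq_zero)
  have "1 < 2 * c" using c_ge_1 by simp
  from grid_exists[OF this W0] obtain t where t: "t 0 = 0" "strict_mono t"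
      "\<And>k. 0 < W (t k)" "\<And>k. W (t k) = ennreal (2 * c) * W (t (Suc k))"
    by blast
  interpret hardy_grid p c \<mu> K v R "2 * c" t D
    by unfold_locales (rule refl t assms | assumption)+
  show ?thesis using nn_integral_G_le unfolding C\<^sub>D_def .
qed

end

section \<open>Truncation of the weight\<close>

lemma nn_integral_lebesgue_on_subset:
  assumes "S \<subseteq> {0<..}" "S \<in> sets lebesgue"
  shows "(\<integral>\<^sup>+ x. g x \<partial>lebesgue_on S) = (\<integral>\<^sup>+ x. g x * indicator S x \<partial>L)"
proof -
  have "(\<integral>\<^sup>+ x. g x * indicator S x \<partial>L) = (\<integral>\<^sup>+ x. (g x * indicator S x) * indicator {0<..} x \<partial>lebesgue)"
    by (rule nn_integral_restrict_space) simp
  also have "\<dots> = (\<integral>\<^sup>+ x. g x * indicator S x \<partial>lebesgue)"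
    using assms by (intro nn_integral_cong) (auto simp: indicator_def)
  also have "\<dots> = (\<integral>\<^sup>+ x. g x \<partial>lebesgue_on S)"
    by (rule nn_integral_restrict_space[symmetric]) (use assms in simp)
  finally show ?thesis ..
qed

lemma AE_lebesgue_on_subset:
  assumes "S \<subseteq> {0<..}" "S \<in> sets lebesgue"
  shows "(AE x in lebesgue_on S. P x) \<longleftrightarrow> (AE x in L. x \<in> S \<longrightarrow> P x)"
proof -
  have "(AE x in lebesgue_on S. P x) \<longleftrightarrow> (AE x in lebesgue. x \<in> S \<longrightarrow> P x)"
    by (rule AE_restrict_space_iff) (use assms in simp)
  moreover have "(AE x in L. x \<in> S \<longrightarrow> P x) \<longleftrightarrow> (AE x in lebesgue. x \<in> {0<..} \<longrightarrow> x \<in> S \<longrightarrow> P x)"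
    by (rule AE_restrict_space_iff) simp
  moreover have "(AE x in lebesgue. x \<in> {0<..} \<longrightarrow> x \<in> S \<longrightarrow> P x) \<longleftrightarrow> (AE x in lebesgue. x \<in> S \<longrightarrow> P x)"
    using assms(1) by (intro iffI; elim eventually_mono; auto)
  ultimately show ?thesis by blast
qed

lemma measurable_lebesgue_on_subset:
  assumes "S \<subseteq> {0<..}" "g \<in> borel_measurable L"
  shows "g \<in> borel_measurable (lebesgue_on S)"
  using assms by (metis Int_absorb1 measurable_restrict_mono)

text \<open>Extension by 0 cannot raise an essential supremum of functions with values in
  [0,\<infinity>].\<close>

lemma esssup_lebesgue_on_eq:
  fixes g h :: "real \<Rightarrow> ennreal"
  assumes h: "h \<in> borel_measurable L" and out: "\<And>z. t \<le> z \<Longrightarrow> h z = 0"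
    and eq: "\<And>z. 0 < z \<Longrightarrow> z < t \<Longrightarrow> g z = h z"
  shows "esssup (lebesgue_on {0<..<t}) g = esssup L h"
proof -
  have h': "h \<in> borel_measurable (lebesgue_on {0<..<t})"
    by (rule measurable_lebesgue_on_subset[OF _ h]) auto
  have "g \<in> borel_measurable (lebesgue_on {0<..<t}) \<longleftrightarrow> h \<in> borel_measurable (lebesgue_on {0<..<t})"
    using eq by (intro measurable_cong) auto
  then have g': "g \<in> borel_measurable (lebesgue_on {0<..<t})" using h' by simp
  have "esssup (lebesgue_on {0<..<t}) g = esssup (lebesgue_on {0<..<t}) h"
    by (rule esssup_AE_cong[OF g' h']) (auto intro!: AE_I2 eq)
  also have "\<dots> = esssup L h"
  proof (rule antisym)
    have "AE z in L. h z \<le> esssup L h" by (rule esssup_AE)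
    then have "AE z in lebesgue_on {0<..<t}. h z \<le> esssup L h"
      by (subst AE_lebesgue_on_subset) (auto elim!: eventually_mono)
    then show "esssup (lebesgue_on {0<..<t}) h \<le> esssup L h" by (rule esssup_I[OF h'])
    have "AE z in lebesgue_on {0<..<t}. h z \<le> esssup (lebesgue_on {0<..<t}) h" by (rule esssup_AE)
    then have "AE z in L. z \<in> {0<..<t} \<longrightarrow> h z \<le> esssup (lebesgue_on {0<..<t}) h"
      by (subst (asm) AE_lebesgue_on_subset) auto
    moreover have "AE z in L. 0 < z" by (rule AE_I2) simp
    ultimately have "AE z in L. h z \<le> esssup (lebesgue_on {0<..<t}) h"
    proof eventually_elim
      case (elim z)
      then show ?case using out[of z] by (cases "z < t") auto
    qed
    then show "esssup L h \<le> esssup (lebesgue_on {0<..<t}) h" by (rule esssup_I[OF h])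
  qed
  finally show ?thesis .
qed

lemma weight_finite_AE:
  assumes "weight v"
  shows "AE x in L. v x < top"
proof -
  have v: "v \<in> borel_measurable L" using assms by (simp add: weight_def M_plus_def)
  have "AE x in L. x \<in> {0<..<real (Suc n)} \<longrightarrow> v x < top" for n
  proof -
    have "v \<in> borel_measurable (lebesgue_on {0<..<real (Suc n)})"
      by (rule measurable_lebesgue_on_subset[OF _ v]) auto
    moreover have "(\<integral>\<^sup>+ s. v s \<partial>lebesgue_on {0<..<real (Suc n)}) < \<infinity>"
      using assms by (auto simp: weight_def simp del: of_nat_Suc)
    ultimately have "AE x in lebesgue_on {0<..<real (Suc n)}. v x \<noteq> \<infinity>"
      by (intro nn_integral_noteq_infinite) auto
    then have "AE x in lebesgue_on {0<..<real (Suc n)}. v x < top"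
      by (auto elim!: eventually_mono simp: less_top[symmetric])
    then show ?thesis by (subst (asm) AE_lebesgue_on_subset) auto
  qed
  then have "AE x in L. \<forall>n. x \<in> {0<..<real (Suc n)} \<longrightarrow> v x < top"
    by (subst AE_all_countable) simp
  moreover have "AE x in L. 0 < x" by (rule AE_I2) simp
  ultimately show ?thesis
  proof eventually_elim
    case (elim x)
    obtain n where "x < real n" using reals_Archimedean2 by blast
    then have "x \<in> {0<..<real (Suc n)}" using elim by simp
    then show ?case using elim by blast
  qed
qed

locale hardy_setting =
  fixes q \<theta> :: real and U :: "real \<Rightarrow> real \<Rightarrow> real" and v w :: "real \<Rightarrow> ennreal"
  assumes q0: "0 < q" and q1: "q < 1" and \<theta>0: "0 < \<theta>"
    and weight_v: "weight v" and weight_w: "weight w" and kernel: "regular_kernel \<theta> U"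
begin

definition p :: real where "p = q / (1 - q)"
text \<open>The triangle inequality of \<open>U\<close> raised to the power q, using (a + b)^q <=
  2^q (a^q + b^q). The maximum with 1 lets single kernel values be bounded with the same
  constant.\<close>

definition c :: real where "c = max 1 (2 powr q * \<theta> powr q)"
text \<open>Clamping the arguments at 0 makes the monotonicity hypotheses valid on the whole line;
  cutting off at t <= x builds the range of integration into the kernel and, the values being
  nonnegative, preserves monotonicity.\<close>

definition K :: "real \<Rightarrow> real \<Rightarrow> ennreal" where
  "K x t = (if x < t then ennreal (U (max 0 x) (max 0 t)) epowr q else 0)"
definition w' :: "nat \<Rightarrow> real \<Rightarrow> ennreal" where "w' n t = w t * indicator {..<real (Suc n)} t"
text \<open>The image under the identity only replaces the Lebesgue sets by the Borel sets, which
  \<open>hardy_core\<close> expects.\<close>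

definition \<mu> :: "nat \<Rightarrow> real measure" where "\<mu> n = distr (density L (w' n)) borel (\<lambda>x. x)"

lemma p_pos: "0 < p" using q0 q1 by (simp add: p_def)

lemma conj_eq: "conj_exponent q = - p"
  unfolding conj_exponent_def p_def by (metis minus_diff_eq minus_divide_right)

lemma q_eq: "q = p / (p + 1)"
proof -
  have "p + 1 = 1 / (1 - q)" using q1 by (simp add: p_def field_simps)
  then show ?thesis using q1 by (simp add: p_def)
qed

lemma exponents: "q * (p + 1) = p" "q * (1 + 1 / p) = 1" "(1 - q) * (p / q) = 1"
proof -
  have "p \<noteq> 0" "p + 1 \<noteq> 0" using p_pos by auto
  show 1: "q * (p + 1) = p" 
    using \<open>p + 1 \<noteq> 0\<close> nonzero_divide_eq_eq[of "p + 1" p q] q_eq[symmetric] by simp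
  have "1 + 1 / p = (p + 1) / p" using \<open>p \<noteq> 0\<close> by (simp add: field_simps)
  then show "q * (1 + 1 / p) = 1" using 1 \<open>p \<noteq> 0\<close> by simp
  show "(1 - q) * (p / q) = 1" using q0 q1 by (simp add: p_def)
qed

lemma w_meas [measurable]: "w \<in> borel_measurable L"
  using weight_w by (simp add: weight_def M_plus_def)

lemma v_meas [measurable]: "v \<in> borel_measurable L"
  using weight_v by (simp add: weight_def M_plus_def)

lemma id_L [measurable]: "(\<lambda>x. x) \<in> measurable L borel"
  by (rule id_measurable_lebesgue_on)

lemma w'_meas [measurable]: "w' n \<in> borel_measurable L"
  unfolding w'_def
  by (intro borel_measurable_times_ennreal w_meas measurable_compose[OF id_L]) simp

lemma borel_imp_L: "g \<in> borel_measurable borel \<Longrightarrow> g \<in> borel_measurable L"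
  by (rule measurable_compose[OF id_L])

lemma nn_integral_mu:
  assumes "g \<in> borel_measurable borel"
  shows "(\<integral>\<^sup>+ t. g t \<partial>\<mu> n) = (\<integral>\<^sup>+ t. g t * w' n t \<partial>L)"
proof -
  have "(\<integral>\<^sup>+ t. g t \<partial>\<mu> n) = (\<integral>\<^sup>+ t. g t \<partial>density L (w' n))"
    unfolding \<mu>_def using assms by (intro nn_integral_distr) (auto simp: id_L)
  also have "\<dots> = (\<integral>\<^sup>+ t. w' n t * g t \<partial>L)"
    using borel_imp_L[OF assms] by (intro nn_integral_density) auto
  finally show ?thesis by (simp add: mult.commute)
qed

lemma emeasure_mu:
  assumes "A \<in> sets borel"
  shows "emeasure (\<mu> n) A = (\<integral>\<^sup>+ t. indicator A t * w' n t \<partial>L)"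
proof -
  have "emeasure (\<mu> n) A = (\<integral>\<^sup>+ t. indicator A t \<partial>\<mu> n)"
    using assms by (intro nn_integral_indicator[symmetric]) (simp add: \<mu>_def)
  then show ?thesis using assms by (subst (asm) nn_integral_mu) auto
qed

lemma emeasure_mu_eq_0:
  assumes "A \<in> sets borel" "AE t in L. t \<in> A \<longrightarrow> w' n t = 0"
  shows "emeasure (\<mu> n) A = 0"
proof -
  have "(\<integral>\<^sup>+ t. indicator A t * w' n t \<partial>L) = (\<integral>\<^sup>+ t. 0 \<partial>L)"
    using assms(2) by (intro nn_integral_cong_AE) (auto elim!: eventually_mono simp: indicator_def)
  then show ?thesis by (simp add: emeasure_mu[OF assms(1)])
qed

lemma U_facts: "0 \<le> x \<Longrightarrow> 0 \<le> y \<Longrightarrow> 0 \<le> U x y"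
  "0 \<le> x \<Longrightarrow> x \<le> x' \<Longrightarrow> 0 \<le> y \<Longrightarrow> U x' y \<le> U x y"
  "0 \<le> x \<Longrightarrow> 0 \<le> y \<Longrightarrow> y \<le> y' \<Longrightarrow> U x y \<le> U x y'"
  "0 \<le> x \<Longrightarrow> x < y \<Longrightarrow> y < z \<Longrightarrow> U x z \<le> \<theta> * (U x y + U y z)"
  using kernel unfolding regular_kernel_def monotone_on_def by auto

lemma K_antimono: "antimono (\<lambda>x. K x t)"
  by (rule antimonoI) (auto simp: K_def intro!: epowr_mono q0 ennreal_leI U_facts)

lemma K_mono: "mono (K x)"
  by (rule monoI) (auto simp: K_def intro!: epowr_mono q0 ennreal_leI U_facts)

lemma K_triangle:
  assumes "0 \<le> x" "x < y" "y < z"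
  shows "K x z \<le> ennreal c * (K x y + K y z)"
proof -
  have "ennreal (U x z) epowr q \<le> ennreal (\<theta> * (U x y + U y z)) epowr q"
    using assms by (intro epowr_mono q0 ennreal_leI U_facts)
  also have "ennreal (\<theta> * (U x y + U y z)) = ennreal \<theta> * (ennreal (U x y) + ennreal (U y z))"
    using assms \<theta>0 U_facts(1)[of x y] U_facts(1)[of y z] by (simp add: ennreal_mult ennreal_plus)
  also have "\<dots> epowr q = ennreal \<theta> epowr q * (ennreal (U x y) + ennreal (U y z)) epowr q"
    by (rule epowr_mult[OF q0])
  also have "\<dots> \<le> ennreal \<theta> epowr q * (2 epowr q * (ennreal (U x y) epowr q + ennreal (U y z) epowr q))"
    by (intro mult_left_mono epowr_add_le q0) simp
  also have "\<dots> = (2 epowr q * ennreal \<theta> epowr q) * (K x y + K y z)"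
    using assms by (simp add: K_def mult_ac)
  also have "\<dots> \<le> ennreal c * (K x y + K y z)"
  proof (rule mult_right_mono)
    have "(2 :: ennreal) epowr q = ennreal (2 powr q)" using ennreal_epowr[of 2 q] q0 by simp
    then have "2 epowr q * ennreal \<theta> epowr q = ennreal (2 powr q * \<theta> powr q)"
      using \<theta>0 q0 by (simp add: ennreal_epowr ennreal_mult)
    also have "\<dots> \<le> ennreal c" by (rule ennreal_leI) (simp add: c_def)
    finally show "2 epowr q * ennreal \<theta> epowr q \<le> ennreal c" .
  qed simp
  finally show ?thesis using assms by (simp add: K_def)
qed

lemma core: "hardy_core p c (\<mu> n) K v (real (Suc n))"
proof
  have "(\<integral>\<^sup>+ s. w s \<partial>lebesgue_on {0<..<real (Suc n)}) < \<infinity>"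
    using weight_w by (auto simp: weight_def simp del: of_nat_Suc)
  also have "(\<integral>\<^sup>+ s. w s \<partial>lebesgue_on {0<..<real (Suc n)}) = (\<integral>\<^sup>+ t. indicator UNIV t * w' n t \<partial>L)"
    by (subst nn_integral_lebesgue_on_subset) (auto simp: w'_def indicator_def intro!: nn_integral_cong)
  also have "\<dots> = emeasure (\<mu> n) UNIV" by (rule emeasure_mu[symmetric]) simp
  finally show "emeasure (\<mu> n) UNIV < top" by simp
  have null: "AE t in L. t \<notin> {x}" for x by (rule countable_null_lebesgue_on) auto
  have "AE t in L. t \<in> {x} \<longrightarrow> w' n t = 0" for x by (rule eventually_mono[OF null[of x]]) simp
  then show "emeasure (\<mu> n) {x} = 0" for x by (intro emeasure_mu_eq_0) auto
  show "emeasure (\<mu> n) {..0} = 0"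
    by (intro emeasure_mu_eq_0 AE_I2) auto
  show "emeasure (\<mu> n) {real (Suc n)..} = 0"
    by (intro emeasure_mu_eq_0 AE_I2) (auto simp: w'_def)
  show "K x t < top" for x t using q0 by (auto simp: K_def)
  show "K x t = 0" if "t \<le> x" for x t using that by (simp add: K_def)
  show "1 \<le> c" by (simp add: c_def)
  show "sets (\<mu> n) = sets borel" by (simp add: \<mu>_def)
qed (rule p_pos K_antimono K_mono K_triangle weight_finite_AE weight_v v_meas | assumption)+

text \<open>\<open>V\<close>, \<open>S\<close>, \<open>T\<close> and the constants do not refer to
  the measure, so they carry no index n. This uniformity is what allows the limit in n.\<close>

sublocale core: hardy_core p c "\<mu> n" K v "real (Suc n)" for n
  by (rule core)

section \<open>Identification of the two conditions and monotone convergence\<close>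

definition W' :: "real \<Rightarrow> ennreal" where "W' t = (\<integral>\<^sup>+ x. w x * indicator {t<..} x \<partial>L)"
definition N' :: "real \<Rightarrow> ennreal" where "N' t = (\<integral>\<^sup>+ x. w x * K t x \<partial>L)"
definition A :: ennreal where
  "A = (\<integral>\<^sup>+ t. (W' t epowr p * core.V t + N' t epowr p * core.S t) * w t \<partial>L)"

lemma core_q [simp]: "core.q = q"
  using q_eq by (simp add: core.q_def)

lemma W'_antimono: "antimono W'"
  unfolding W'_def by (intro antimonoI nn_integral_mono mult_left_mono) (auto simp: indicator_def)

lemma N'_antimono: "antimono N'"
  unfolding N'_def by (intro antimonoI nn_integral_mono mult_left_mono antimonoD[OF K_antimono]) auto

lemma L_measurable [measurable]:
  "W' \<in> borel_measurable L" "N' \<in> borel_measurable L"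
  "core.V \<in> borel_measurable L" "core.S \<in> borel_measurable L"
  using antimono_ennreal_borel_measurable[OF W'_antimono] antimono_ennreal_borel_measurable[OF N'_antimono]
    core.V_meas core.S_meas
  by (blast intro: borel_imp_L)+

lemma K_powr: "0 \<le> z \<Longrightarrow> z < t \<Longrightarrow> 0 < e \<Longrightarrow> K z t epowr e = ennreal (U z t) epowr (q * e)"
  using q0 by (simp add: K_def epowr_epowr)

lemma V_eq: "0 < t \<Longrightarrow> esssup (lebesgue_on {0<..<t})
    (\<lambda>z. ennreal (U z t) epowr (- conj_exponent q) * v z epowr conj_exponent q) = core.V t"
  unfolding core.V_def conj_eq
proof (rule esssup_lebesgue_on_eq)
  have p1: "0 < p + 1" using p_pos by simp
  show "K z t epowr (p + 1) * core.r z epowr p = 0" if "t \<le> z" for z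
    using that p1 by (simp add: K_def)
  show "ennreal (U z t) epowr (- (- p)) * v z epowr (- p) = K z t epowr (p + 1) * core.r z epowr p"
    if "0 < z" "z < t" for z
    using that p1 p_pos by (simp add: K_powr exponents epowr_uminus core.r_def)
qed simp

lemma S_eq: "0 < t \<Longrightarrow> esssup (lebesgue_on {0<..<t})
    (\<lambda>z. ennreal (U z t) epowr q * v z epowr conj_exponent q) = core.S t"
  unfolding core.S_def conj_eq
proof (rule esssup_lebesgue_on_eq)
  show "K z t * core.r z epowr p = 0" if "t \<le> z" for z
    using that by (simp add: K_def)
  show "ennreal (U z t) epowr q * v z epowr (- p) = K z t * core.r z epowr p"
    if "0 < z" "z < t" for z
    using that p_pos by (simp add: K_def epowr_uminus core.r_def)
qed simp

lemma A_eq: "A3 q U v w + A4 q U v w = A"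
proof -
  have "A3 q U v w = (\<integral>\<^sup>+ t. W' t epowr p * w t * core.V t \<partial>L)"
    unfolding A3_def
  proof (rule nn_integral_cong)
    fix t assume "t \<in> space L"
    then have t: "0 < t" by simp
    have "(\<integral>\<^sup>+ x. w x \<partial>lebesgue_on {t<..}) = W' t"
      unfolding W'_def using t by (intro nn_integral_lebesgue_on_subset) auto
    then show "(\<integral>\<^sup>+ x. w x \<partial>lebesgue_on {t<..}) epowr (- conj_exponent q) * w t *
       esssup (lebesgue_on {0<..<t}) (\<lambda>z. ennreal (U z t) epowr (- conj_exponent q) * v z epowr conj_exponent q)
       = W' t epowr p * w t * core.V t"
      unfolding V_eq[OF t] by (simp add: conj_eq)
  qed
  moreover have "A4 q U v w = (\<integral>\<^sup>+ t. N' t epowr p * w t * core.S t \<partial>L)"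
    unfolding A4_def
  proof (rule nn_integral_cong)
    fix t assume "t \<in> space L"
    then have t: "0 < t" by simp
    have "(\<integral>\<^sup>+ x. w x * ennreal (U t x) epowr q \<partial>lebesgue_on {t<..})
        = (\<integral>\<^sup>+ x. w x * ennreal (U t x) epowr q * indicator {t<..} x \<partial>L)"
      using t by (intro nn_integral_lebesgue_on_subset) auto
    also have "\<dots> = N' t"
      unfolding N'_def using t by (intro nn_integral_cong) (auto simp: K_def indicator_def)
    finally show "(\<integral>\<^sup>+ x. w x * ennreal (U t x) epowr q \<partial>lebesgue_on {t<..}) epowr (- conj_exponent q) * w t *
       esssup (lebesgue_on {0<..<t}) (\<lambda>z. ennreal (U z t) epowr q * v z epowr conj_exponent q)
       = N' t epowr p * w t * core.S t"
      unfolding S_eq[OF t] by (simp add: conj_eq)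
  qed
  ultimately have "A3 q U v w + A4 q U v w = (\<integral>\<^sup>+ t. W' t epowr p * w t * core.V t + N' t epowr p * w t * core.S t \<partial>L)"
    by (simp add: nn_integral_add)
  also have "\<dots> = A"
    unfolding A_def by (intro nn_integral_cong) (simp add: distrib_left distrib_right mult_ac)
  finally show ?thesis .
qed

lemma w'_mono: "m \<le> n \<Longrightarrow> w' m t \<le> w' n t"
  by (auto simp: w'_def indicator_def)

lemma w'_le: "w' n t \<le> w t"
  by (auto simp: w'_def indicator_def)

lemma w'_eventually: "\<exists>m. \<forall>n\<ge>m. w' n t = w t"
proof -
  obtain m where "t < real m" using reals_Archimedean2 by blast
  then have "\<forall>n\<ge>m. w' n t = w t" by (auto simp: w'_def indicator_def)
  then show ?thesis ..
qed

lemma nn_integral_SUP_w':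
  assumes [measurable]: "g \<in> borel_measurable L"
  shows "(\<integral>\<^sup>+ t. g t * w t \<partial>L) = (SUP n. \<integral>\<^sup>+ t. g t * w' n t \<partial>L)"
proof -
  have "g t * w t = (SUP n. g t * w' n t)" for t
  proof (rule antisym)
    obtain m where "w' m t = w t" using w'_eventually[of t] by blast
    then have "g t * w t = g t * w' m t" by simp
    also have "\<dots> \<le> (SUP n. g t * w' n t)" by (rule SUP_upper) simp
    finally show "g t * w t \<le> (SUP n. g t * w' n t)" .
  qed (intro SUP_least mult_left_mono w'_le, simp)
  then have "(\<integral>\<^sup>+ t. g t * w t \<partial>L) = (\<integral>\<^sup>+ t. (SUP n. g t * w' n t) \<partial>L)" by simp
  also have "\<dots> = (SUP n. \<integral>\<^sup>+ t. g t * w' n t \<partial>L)"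
    by (intro nn_integral_monotone_convergence_SUP incseq_SucI le_funI mult_left_mono w'_mono) auto
  finally show ?thesis .
qed

lemma core_W: "core.W n t = (\<integral>\<^sup>+ x. indicator {t<..} x * w' n x \<partial>L)"
  by (simp add: core.W_def emeasure_mu)

lemma core_N: "core.N n t = (\<integral>\<^sup>+ x. K t x * w' n x \<partial>L)"
  unfolding core.N_def by (rule nn_integral_mu[OF core.K_meas_t])

lemma core_W_mono: "m \<le> n \<Longrightarrow> core.W m t \<le> core.W n t"
  unfolding core_W by (intro nn_integral_mono mult_left_mono w'_mono) auto

lemma core_N_mono: "m \<le> n \<Longrightarrow> core.N m t \<le> core.N n t"
  unfolding core_N by (intro nn_integral_mono mult_left_mono w'_mono) auto

lemma W'_SUP: "W' t = (SUP n. core.W n t)"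
  unfolding core_W W'_def by (subst mult.commute, rule nn_integral_SUP_w', rule borel_imp_L) simp

lemma N'_SUP: "N' t = (SUP n. core.N n t)"
  unfolding core_N N'_def by (subst mult.commute, rule nn_integral_SUP_w', rule borel_imp_L, rule core.K_meas_t)

lemma core_G_mono: "m \<le> n \<Longrightarrow> core.G m t \<le> core.G n t"
  unfolding core.G_def by (intro add_mono mult_right_mono epowr_mono p_pos core_W_mono core_N_mono) auto

lemma SUP_core_G: "(SUP n. core.G n t) = W' t epowr p * core.V t + N' t epowr p * core.S t"
proof -
  have "(SUP n. core.G n t) = (SUP n. core.W n t epowr p * core.V t) + (SUP n. core.N n t epowr p * core.S t)"
    unfolding core.G_def
    by (intro ennreal_SUP_add incseq_SucI mult_right_mono epowr_mono p_pos core_W_mono core_N_mono) auto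
  then show ?thesis
    by (simp add: W'_SUP N'_SUP epowr_SUP p_pos SUP_mult_right_ennreal)
qed

lemma nn_integral_core_G: "(\<integral>\<^sup>+ t. core.G n t \<partial>\<mu> n) = (\<integral>\<^sup>+ t. core.G n t * w' n t \<partial>L)"
  by (rule nn_integral_mu[OF core.G_meas])

lemma A_SUP: "A = (SUP n. \<integral>\<^sup>+ t. core.G n t \<partial>\<mu> n)"
proof -
  have "(SUP n. core.G n t) * w t = (SUP n. core.G n t * w' n t)" for t
  proof (rule antisym)
    obtain m where m: "\<And>n. n \<ge> m \<Longrightarrow> w' n t = w t" using w'_eventually[of t] by blast
    have "core.G n t * w t \<le> (SUP n. core.G n t * w' n t)" for n
    proof -
      \<comment> \<open>Both factors grow with the truncation index; passing to the larger index
        merges their two limits into one.\<close>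
      have "core.G n t * w t \<le> core.G (max m n) t * w' (max m n) t"
        by (intro mult_mono core_G_mono) (auto simp: m)
      also have "\<dots> \<le> (SUP n. core.G n t * w' n t)" by (rule SUP_upper) simp
      finally show ?thesis .
    qed
    then show "(SUP n. core.G n t) * w t \<le> (SUP n. core.G n t * w' n t)"
      unfolding SUP_mult_right_ennreal by (intro SUP_least)
    show "(SUP n. core.G n t * w' n t) \<le> (SUP n. core.G n t) * w t"
      by (intro SUP_least mult_mono w'_le SUP_upper) auto
  qed
  then have "A = (\<integral>\<^sup>+ t. (SUP n. core.G n t * w' n t) \<partial>L)"
    by (simp add: A_def SUP_core_G)
  also have "\<dots> = (SUP n. \<integral>\<^sup>+ t. core.G n t * w' n t \<partial>L)"
    using borel_imp_L[OF core.G_meas]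
    by (intro nn_integral_monotone_convergence_SUP incseq_SucI le_funI mult_mono w'_mono core_G_mono) auto
  finally show ?thesis by (simp add: nn_integral_core_G)
qed

lemma T_eq:
  assumes "0 < t"
  shows "(\<integral>\<^sup>+ x. f x * ennreal (U x t) \<partial>lebesgue_on {0<..<t}) = core.T f t"
proof -
  have e: "0 < 1 + 1 / p" using p_pos by (simp add: add_pos_pos)
  have "(\<integral>\<^sup>+ x. f x * ennreal (U x t) \<partial>lebesgue_on {0<..<t})
      = (\<integral>\<^sup>+ x. f x * ennreal (U x t) * indicator {0<..<t} x \<partial>L)"
    by (rule nn_integral_lebesgue_on_subset) auto
  also have "\<dots> = core.T f t"
    unfolding core.T_def
  proof (rule nn_integral_cong)
    fix x assume "x \<in> space L"
    then have x: "0 < x" by simp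
    show "f x * ennreal (U x t) * indicator {0<..<t} x = f x * K x t epowr (1 + 1 / p)"
    proof (cases "x < t")
      case True
      have "K x t epowr (1 + 1 / p) = ennreal (U x t)"
        using x True e K_powr[of x t "1 + 1 / p"] by (simp only: exponents(2) epowr_1 less_imp_le)
      then show ?thesis using x True by simp
    next
      case False
      then have "K x t = 0" by (simp add: K_def)
      then show ?thesis using False zero_epowr[OF e] by simp
    qed
  qed
  finally show ?thesis .
qed

lemma T_measurable: "(\<lambda>t. core.T f t epowr q) \<in> borel_measurable borel"
proof -
  have e: "0 < 1 + 1 / p" using p_pos by (simp add: add_pos_pos)
  have "mono (core.T f)"
    unfolding core.T_def by (intro monoI nn_integral_mono mult_left_mono epowr_mono[OF e] core.K_le_t) auto
  then show ?thesis by (intro borel_measurable_epowr mono_ennreal_borel_measurable)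
qed

section \<open>Transfer of both directions to the original weight\<close>

lemma hardy_iff: "hardy_inequality q U v w C \<longleftrightarrow>
  (\<forall>f\<in>borel_measurable L. (\<integral>\<^sup>+ t. core.T f t epowr q * w t \<partial>L) epowr (1 / q) \<le> C * (\<integral>\<^sup>+ t. f t * v t \<partial>L))"
proof -
  have "(\<integral>\<^sup>+ t. (\<integral>\<^sup>+ x. f x * ennreal (U x t) \<partial>lebesgue_on {0<..<t}) epowr q * w t \<partial>L)
      = (\<integral>\<^sup>+ t. core.T f t epowr q * w t \<partial>L)" for f
    by (intro nn_integral_cong) (simp add: T_eq)
  then show ?thesis by (simp add: hardy_inequality_def M_plus_def)
qed

lemma T_truncation: "(\<integral>\<^sup>+ t. core.T f t epowr q * w t \<partial>L) = (SUP n. \<integral>\<^sup>+ t. core.T f t epowr q \<partial>\<mu> n)"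
  unfolding nn_integral_mu[OF T_measurable] by (rule nn_integral_SUP_w'[OF borel_imp_L[OF T_measurable]])

text \<open>Built from q and \<theta> alone. The first is the constant of \<open>hardy_if\<close>
  raised to the power p, where (1 - q) p / q = 1 makes \<open>A\<close> enter linearly. The second
  is the constant of \<open>necessity\<close> with C^q in place of D, where q (p + 1) = p.\<close>

definition c\<^sub>1 :: ennreal where "c\<^sub>1 = 2 epowr (p / q) * (3 * core.C\<^sub>Y)"
definition c\<^sub>2 :: ennreal where "c\<^sub>2 = core.C\<^sub>N * (10 * (ennreal (2 * c) * ennreal (2 * c))) epowr (p + 1)"

lemma constants: "0 < c\<^sub>1" "c\<^sub>1 < top" "0 < c\<^sub>2" "c\<^sub>2 < top"
proof -
  have c: "0 < c" using core.c_ge_1 by simp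
  have p1: "0 < p + 1" "0 < p / q" using p_pos q0 by auto
  have pos: "0 < x epowr e \<longleftrightarrow> 0 < x" if "0 < e" for x :: ennreal and e
    using that epowr_less_iff[of e 0 x] by simp
  show "0 < c\<^sub>1" "c\<^sub>1 < top" "0 < c\<^sub>2" "c\<^sub>2 < top"
    unfolding c\<^sub>1_def c\<^sub>2_def core.C\<^sub>Y_def core.C\<^sub>N_def core.C\<^sub>M_def using c p1 p_pos
    by (simp_all add: ennreal_zero_less_mult_iff ennreal_mult_less_top pos add_pos_nonneg)
qed

lemma hardy_if:
  assumes A: "A < top" and C: "0 < C" "(2 * (3 * core.C\<^sub>Y * A) epowr (1 - q)) epowr (1 / q) \<le> C"
  shows "hardy_inequality q U v w C"
  unfolding hardy_iff
proof
  fix f :: "real \<Rightarrow> ennreal" assume f: "f \<in> borel_measurable L"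
  let ?I = "\<integral>\<^sup>+ t. f t * v t \<partial>L"
  let ?B = "3 * core.C\<^sub>Y * A"
  have CY: "core.C\<^sub>Y < top"
    using constants(2) q0 p_pos by (auto simp: c\<^sub>1_def ennreal_mult_less_top less_top)
  show "(\<integral>\<^sup>+ t. core.T f t epowr q * w t \<partial>L) epowr (1 / q) \<le> C * ?I"
  proof (cases "?I < top")
    case False
    then have "?I = top" by (simp add: not_less top_unique)
    \<comment> \<open>For C = 0 the right-hand side would be 0 by convention; positivity of
      \<open>C\<close> makes it infinite.\<close>
    then show ?thesis using C by (simp add: ennreal_mult_top)
  next
    case True
    have "(\<integral>\<^sup>+ t. core.T f t epowr q \<partial>\<mu> n) \<le> 2 * (?I epowr q * ?B epowr (1 - q))" for n
    proof -
      have An: "(\<integral>\<^sup>+ t. core.G n t \<partial>\<mu> n) \<le> A" unfolding A_SUP by (rule SUP_upper) simp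
      have "(\<integral>\<^sup>+ t. core.T f t epowr q \<partial>\<mu> n) \<le> 2 * (?I epowr (p / (p + 1)) * ?B epowr (1 - p / (p + 1)))"
      proof (rule epowr_optimise[OF p_pos True])
        show "?B < top" using A CY by (simp add: ennreal_mult_less_top)
        fix \<theta>' :: real assume "0 < \<theta>'"
        from core.sufficiency_scaled[OF f this, of n]
        have "(\<integral>\<^sup>+ t. core.T f t epowr q \<partial>\<mu> n) \<le> ennreal \<theta>' * ?I + ennreal (\<theta>' powr - p) * (3 * core.C\<^sub>Y * (\<integral>\<^sup>+ t. core.G n t \<partial>\<mu> n))"
          by simp
        also have "\<dots> \<le> ennreal \<theta>' * ?I + ennreal (\<theta>' powr - p) * ?B"
          by (intro add_left_mono mult_left_mono An) auto
        finally show "(\<integral>\<^sup>+ t. core.T f t epowr q \<partial>\<mu> n) \<le> ennreal \<theta>' * ?I + ennreal (\<theta>' powr - p) * ?B" .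
      qed
      then show ?thesis by (simp only: q_eq[symmetric])
    qed
    then have "(\<integral>\<^sup>+ t. core.T f t epowr q * w t \<partial>L) \<le> 2 * (?I epowr q * ?B epowr (1 - q))"
      unfolding T_truncation by (rule SUP_least)
    then have "(\<integral>\<^sup>+ t. core.T f t epowr q * w t \<partial>L) epowr (1 / q) \<le> (2 * (?I epowr q * ?B epowr (1 - q))) epowr (1 / q)"
      using q0 by (intro epowr_mono) auto
    also have "2 * (?I epowr q * ?B epowr (1 - q)) = (2 * ?B epowr (1 - q)) * ?I epowr q" by (simp only: mult_ac)
    also have "\<dots> epowr (1 / q) = (2 * ?B epowr (1 - q)) epowr (1 / q) * ?I"
      using q0 by (simp add: epowr_mult[of "1 / q" "2 * _"] epowr_inverse_cancel)
    also have "\<dots> \<le> C * ?I" by (intro mult_right_mono C) simp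
    finally show ?thesis .
  qed
qed

lemma hardy_imp:
  assumes "hardy_inequality q U v w C"
  shows "A \<le> c\<^sub>2 * C epowr p"
proof (cases "C < top")
  case False
  then have "C = top" by (simp add: not_less top_unique)
  then show ?thesis using p_pos constants(3) by (simp add: ennreal_mult_top)
next
  case True
  have "(\<integral>\<^sup>+ t. core.G n t \<partial>\<mu> n) \<le> c\<^sub>2 * C epowr p" for n
  proof -
    have "(\<integral>\<^sup>+ s. core.T f s epowr q \<partial>\<mu> n) \<le> C epowr q * (\<integral>\<^sup>+ x. f x * v x \<partial>L) epowr q"
      if f: "f \<in> borel_measurable L" for f
    proof -
      let ?X = "\<integral>\<^sup>+ t. core.T f t epowr q * w t \<partial>L"
      have "?X = (?X epowr (1 / q)) epowr q" using q0 by (simp add: epowr_epowr)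
      also have "\<dots> \<le> (C * (\<integral>\<^sup>+ x. f x * v x \<partial>L)) epowr q"
        using assms f by (intro epowr_mono q0) (auto simp: hardy_iff)
      also have "\<dots> = C epowr q * (\<integral>\<^sup>+ x. f x * v x \<partial>L) epowr q" by (rule epowr_mult[OF q0])
      finally show ?thesis
        unfolding T_truncation by (rule order_trans[OF SUP_upper, rotated]) simp
    qed
    then have "(\<integral>\<^sup>+ t. core.G n t \<partial>\<mu> n) \<le> core.C\<^sub>N * (10 * (ennreal (2 * c) * ennreal (2 * c)) * C epowr q) epowr (p + 1)"
      using True q0 by (intro core.necessity) auto
    also have "\<dots> = c\<^sub>2 * C epowr p"
    proof -
      have "0 < p + 1" using p_pos by simp
      then have "(C epowr q) epowr (p + 1) = C epowr p" using q0 by (simp add: epowr_epowr exponents)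
      then show ?thesis unfolding c\<^sub>2_def epowr_mult[OF \<open>0 < p + 1\<close>, of _ "C epowr q"] by (simp add: mult.assoc)
    qed
    finally show ?thesis .
  qed
  then show ?thesis unfolding A_SUP by (rule SUP_least)
qed

lemma least_constant_le: "least_constant q U v w epowr p \<le> c\<^sub>1 * A"
proof (cases "A < top")
  case False
  then have "A = top" by (simp add: not_less top_unique)
  then show ?thesis using constants(1) by (simp add: ennreal_mult_top)
next
  case True
  define C0 where "C0 = (2 * (3 * core.C\<^sub>Y * A) epowr (1 - q)) epowr (1 / q)"
  \<comment> \<open>The slack is there because \<open>hardy_if\<close> demands a positive constant,
    while \<open>C0\<close> is 0 when \<open>A\<close> is.\<close>
  have *: "least_constant q U v w \<le> C0 + ennreal e" if "0 < e" for e
    unfolding least_constant_def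
    using that by (intro Inf_lower) (auto intro!: hardy_if True simp: C0_def[symmetric] add_nonneg_pos)
  have "least_constant q U v w \<le> C0"
    by (rule ennreal_le_epsilon) (rule *)
  then have "least_constant q U v w epowr p \<le> C0 epowr p" by (intro epowr_mono p_pos)
  also have "\<dots> = (2 * (3 * core.C\<^sub>Y * A) epowr (1 - q)) epowr (p / q)"
    unfolding C0_def using q0 p_pos by (simp add: epowr_epowr)
  also have "\<dots> = c\<^sub>1 * A"
    using q0 q1 p_pos exponents(3)
    by (simp add: epowr_mult[of "p / q" 2] epowr_epowr c\<^sub>1_def mult.assoc)
  finally show ?thesis .
qed

text \<open>Solving for \<open>C\<close> first gives a lower bound for all admissible constants,
  which then passes to their infimum whether or not it is attained.\<close>

lemma le_least_constant: "A \<le> c\<^sub>2 * least_constant q U v w epowr p"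
proof -
  have c2: "c\<^sub>2 \<noteq> 0" "c\<^sub>2 \<noteq> top" using constants(3,4) by auto
  have ip: "0 < 1 / p" using p_pos by simp
  have "(A / c\<^sub>2) epowr (1 / p) \<le> C" if "hardy_inequality q U v w C" for C
  proof -
    have "A / c\<^sub>2 \<le> c\<^sub>2 * C epowr p / c\<^sub>2"
      by (intro divide_right_mono_ennreal hardy_imp that)
    also have "\<dots> = C epowr p"
      using c2 mult_divide_eq_ennreal[of c\<^sub>2 "C epowr p"] by (simp add: mult.commute)
    finally have "(A / c\<^sub>2) epowr (1 / p) \<le> (C epowr p) epowr (1 / p)" by (intro epowr_mono ip)
    then show ?thesis using p_pos by (simp add: epowr_inverse_cancel)
  qed
  then have "(A / c\<^sub>2) epowr (1 / p) \<le> least_constant q U v w"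
    unfolding least_constant_def by (intro Inf_greatest) auto
  then have "((A / c\<^sub>2) epowr (1 / p)) epowr p \<le> least_constant q U v w epowr p"
    by (intro epowr_mono p_pos)
  then have "A / c\<^sub>2 \<le> least_constant q U v w epowr p"
    using p_pos by (simp add: epowr_epowr)
  then have "c\<^sub>2 * (A / c\<^sub>2) \<le> c\<^sub>2 * least_constant q U v w epowr p" by (intro mult_left_mono) auto
  then show ?thesis
    using c2 mult_divide_eq_ennreal[of c\<^sub>2 A] by (simp add: ennreal_times_divide mult.commute)
qed

lemma boundedness_iff: "(\<exists>C. 0 < C \<and> C < \<infinity> \<and> hardy_inequality q U v w C) \<longleftrightarrow> A < top"
proof
  assume "\<exists>C. 0 < C \<and> C < \<infinity> \<and> hardy_inequality q U v w C"
  then obtain C where C: "C < top" "hardy_inequality q U v w C" by auto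
  from hardy_imp[OF C(2)] have "A \<le> c\<^sub>2 * C epowr p" .
  also have "\<dots> < top" using C constants p_pos by (simp add: ennreal_mult_less_top)
  finally show "A < top" .
next
  assume A: "A < top"
  define C0 where "C0 = (2 * (3 * core.C\<^sub>Y * A) epowr (1 - q)) epowr (1 / q)"
  have CY: "core.C\<^sub>Y < top"
    using constants(2) q0 p_pos by (auto simp: c\<^sub>1_def ennreal_mult_less_top less_top)
  have "C0 < top" unfolding C0_def using A CY q0 q1 by (simp add: ennreal_mult_less_top)
  moreover have "hardy_inequality q U v w (C0 + 1)"
    by (rule hardy_if[OF A]) (auto simp: C0_def[symmetric] add_nonneg_pos)
  ultimately show "\<exists>C. 0 < C \<and> C < \<infinity> \<and> hardy_inequality q U v w C"
    by (intro exI[of _ "C0 + 1"]) (auto simp: add_nonneg_pos)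
qed

end

theorem corollary10:
  fixes q \<theta> :: real
  assumes "0 < q" and "q < 1" and "0 < \<theta>"
  shows "\<exists>c\<^sub>1 c\<^sub>2 :: real. 0 < c\<^sub>1 \<and> 0 < c\<^sub>2 \<and>
    (\<forall>v w U. weight v \<longrightarrow> weight w \<longrightarrow> regular_kernel \<theta> U \<longrightarrow>
      ((\<exists>C. 0 < C \<and> C < \<infinity> \<and> hardy_inequality q U v w C) \<longleftrightarrow>
         A3 q U v w < \<infinity> \<and> A4 q U v w < \<infinity>) \<and>
      least_constant q U v w epowr (- conj_exponent q)
        \<le> ennreal c\<^sub>1 * (A3 q U v w + A4 q U v w) \<and>
      A3 q U v w + A4 q U v w
        \<le> ennreal c\<^sub>2 * least_constant q U v w epowr (- conj_exponent q))"
proof -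
  let ?c1 = "hardy_setting.c\<^sub>1 q \<theta>" and ?c2 = "hardy_setting.c\<^sub>2 q \<theta>"
  have main: "((\<exists>C. 0 < C \<and> C < \<infinity> \<and> hardy_inequality q U v w C) \<longleftrightarrow>
         A3 q U v w < \<infinity> \<and> A4 q U v w < \<infinity>) \<and>
      least_constant q U v w epowr (- conj_exponent q) \<le> ?c1 * (A3 q U v w + A4 q U v w) \<and>
      A3 q U v w + A4 q U v w \<le> ?c2 * least_constant q U v w epowr (- conj_exponent q) \<and>
      0 < ?c1 \<and> ?c1 < top \<and> 0 < ?c2 \<and> ?c2 < top"
    if "weight v" "weight w" "regular_kernel \<theta> U" for v w U
  proof -
    interpret hardy_setting q \<theta> U v w by unfold_locales (use assms that in auto)
    have "A < top \<longleftrightarrow> A3 q U v w < \<infinity> \<and> A4 q U v w < \<infinity>"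
      unfolding A_eq[symmetric] by simp
    then show ?thesis
      using boundedness_iff least_constant_le le_least_constant constants by (simp add: A_eq conj_eq)
  qed
  show ?thesis
  \<comment> \<open>Positivity and finiteness of the two constants are facts of an interpretation
    and so require some admissible triple; if there is none, the claim is vacuous.\<close>
  proof (cases "\<exists>v w U. weight v \<and> weight w \<and> regular_kernel \<theta> U")
    case True
    then have c: "0 < ?c1 \<and> ?c1 < top \<and> 0 < ?c2 \<and> ?c2 < top" using main by blast
    then have "ennreal (enn2real ?c1) = ?c1" "ennreal (enn2real ?c2) = ?c2" by auto
    moreover have "0 < enn2real ?c1" "0 < enn2real ?c2"
      using c by (auto simp: enn2real_positive_iff)
    ultimately show ?thesis
      using main by (intro exI[of _ "enn2real ?c1"] exI[of _ "enn2real ?c2"]) auto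
  next
    case False
    then show ?thesis by (intro exI[of _ 1]) auto
  qed
qed

end
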